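(* Let $A$ be a $C^{\star}$-algebra, and let $\delta: A\rightarrow A^{**}$ be a continuous linear map. Then $\delta$ satisfies \[ \text{for all } a,b\in A:\quad a^{\star}b=0 \Longrightarrow a^{\star}\delta(b)+\delta(a)^{\star}b=0 \] if and only if there are a continuous $\star$-derivation $d:A\rightarrow A^{**}$ and an element $\eta\in A^{**}$ such that $\delta(a)=d(a)+a\eta$ for all $a\in A$.
   Context: All algebras are over $\mathbb{C}$. For a $C^{\star}$-algebra $A$, the bidual $A^{**}$ carries the (first) Arens product, which coincides with the second Arens product; with it $A^{**}$ is a unital $C^{\star}$-algebra (the enveloping von Neumann algebra) containing $A$ canonically, and $A^{**}$ is an $A$-bimodule via this product. A linear map $d:A\to A^{**}$ is a derivation if $d(ab)=a\,d(b)+d(a)\,b$ for all $a,b\in A$. A map $h:A\to A^{**}$ is a $\star$-map if $h(a^{\star})=h(a)^{\star}$ for all $a\in A$; a $\star$-derivation is a derivation that is a $\star$-map. Continuity is with respect to the norm topologies. *)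

theory Defs
  imports "HOL-Analysis.Analysis"
begin

section \<open>Complex normed spaces, algebras and C*-algebras\<close>

class scaleC =
  fixes scaleC :: "complex \<Rightarrow> 'a \<Rightarrow> 'a" (infixr "*\<^sub>C" 75)

class complex_normed_vector = real_normed_vector + scaleC +
  assumes scaleC_add_right: "c *\<^sub>C (x + y) = c *\<^sub>C x + c *\<^sub>C y"
    and scaleC_add_left: "(c + c') *\<^sub>C x = c *\<^sub>C x + c' *\<^sub>C x"
    and scaleC_scaleC: "c *\<^sub>C (c' *\<^sub>C x) = (c * c') *\<^sub>C x"
    and scaleR_scaleC: "r *\<^sub>R x = complex_of_real r *\<^sub>C x"
    and norm_scaleC: "norm (c *\<^sub>C x) = cmod c * norm x"

class complex_normed_algebra = complex_normed_vector + real_normed_algebra +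
  assumes mult_scaleC_left: "(c *\<^sub>C x) * y = c *\<^sub>C (x * y)"
    and mult_scaleC_right: "x * (c *\<^sub>C y) = c *\<^sub>C (x * y)"

class star =
  fixes star :: "'a \<Rightarrow> 'a" ("(_\<^sup>\<star>)" [1000] 999)

class complex_star_vector = complex_normed_vector + star +
  assumes star_add: "(x + y)\<^sup>\<star> = x\<^sup>\<star> + y\<^sup>\<star>"
    and star_scaleC: "(c *\<^sub>C x)\<^sup>\<star> = cnj c *\<^sub>C x\<^sup>\<star>"
    and star_star: "(x\<^sup>\<star>)\<^sup>\<star> = x"

class isometric_star_vector = complex_star_vector +
  assumes norm_star: "norm (x\<^sup>\<star>) = norm x"

text \<open>No unit is required.\<close>

class cstar_algebra = complex_normed_algebra + banach + complex_star_vector +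
  assumes star_mult: "(x * y)\<^sup>\<star> = y\<^sup>\<star> * x\<^sup>\<star>"
    and cstar_identity: "norm (x\<^sup>\<star> * x) = (norm x)\<^sup>2"
begin

subclass isometric_star_vector
proof
  have le: "norm x \<le> norm (x\<^sup>\<star>)" for x
  proof (cases "norm x = 0")
    case False
    have "norm x * norm x \<le> norm (x\<^sup>\<star>) * norm x"
      using norm_mult_ineq[of "x\<^sup>\<star>" x] cstar_identity[of x] by (simp add: power2_eq_square)
    moreover have "norm x > 0"
      using False norm_ge_zero[of x] by linarith
    ultimately show ?thesis by simp
  qed (use norm_ge_zero[of "x\<^sup>\<star>"] in linarith)
  show "norm (x\<^sup>\<star>) = norm x" for x
    using le[of x] le[of "x\<^sup>\<star>"] by (simp add: star_star)
qed

end

instantiation complex :: complex_normed_algebra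
begin

definition scaleC_complex :: "complex \<Rightarrow> complex \<Rightarrow> complex"
  where "scaleC_complex c x = c * x"

instance
  by standard (simp_all add: scaleC_complex_def algebra_simps norm_mult scaleR_conv_of_real)

end

instantiation complex :: cstar_algebra
begin

definition star_complex :: "complex \<Rightarrow> complex"
  where "star_complex = cnj"

instance
  by standard (simp_all add: star_complex_def scaleC_complex_def norm_mult power2_eq_square)

end

definition clinear :: "('a::complex_normed_vector \<Rightarrow> 'b::complex_normed_vector) \<Rightarrow> bool"
  where "clinear f \<longleftrightarrow> (\<forall>x y. f (x + y) = f x + f y) \<and> (\<forall>c x. f (c *\<^sub>C x) = c *\<^sub>C f x)"

section \<open>The dual Banach space\<close>

typedef (overloaded) 'a cdual =
  "{f :: 'a::complex_normed_vector \<Rightarrow> complex. clinear f \<and> bounded_linear f}"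
  morphisms cdual_apply Abs_cdual
  by (rule exI[of _ "\<lambda>_. 0"]) (simp add: clinear_def scaleC_complex_def)

setup_lifting type_definition_cdual

instantiation cdual :: (complex_normed_vector) complex_normed_vector
begin

lift_definition norm_cdual :: "'a cdual \<Rightarrow> real" is onorm .

lift_definition minus_cdual :: "'a cdual \<Rightarrow> 'a cdual \<Rightarrow> 'a cdual" is "\<lambda>f g x. f x - g x"
  by (auto simp: clinear_def scaleC_complex_def algebra_simps intro: bounded_linear_sub)

lift_definition plus_cdual :: "'a cdual \<Rightarrow> 'a cdual \<Rightarrow> 'a cdual" is "\<lambda>f g x. f x + g x"
  by (auto simp: clinear_def scaleC_complex_def algebra_simps intro: bounded_linear_add)

lift_definition uminus_cdual :: "'a cdual \<Rightarrow> 'a cdual" is "\<lambda>f x. - f x"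
  by (auto simp: clinear_def scaleC_complex_def intro: bounded_linear_minus)

lift_definition zero_cdual :: "'a cdual" is "\<lambda>_. 0"
  by (simp add: clinear_def scaleC_complex_def)

lift_definition scaleC_cdual :: "complex \<Rightarrow> 'a cdual \<Rightarrow> 'a cdual" is "\<lambda>c f x. c * f x"
  by (auto simp: clinear_def scaleC_complex_def algebra_simps intro: bounded_linear_const_mult)

lift_definition scaleR_cdual :: "real \<Rightarrow> 'a cdual \<Rightarrow> 'a cdual" is "\<lambda>r f x. r *\<^sub>R f x"
  by (auto simp: clinear_def scaleC_complex_def algebra_simps
      intro: bounded_linear_compose[OF bounded_linear_scaleR_right])

definition dist_cdual :: "'a cdual \<Rightarrow> 'a cdual \<Rightarrow> real"
  where "dist_cdual f g = norm (f - g)"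

definition uniformity_cdual :: "('a cdual \<times> 'a cdual) filter"
  where "uniformity_cdual = (INF e\<in>{0 <..}. principal {(f, g). dist f g < e})"

definition open_cdual :: "'a cdual set \<Rightarrow> bool"
  where "open_cdual S = (\<forall>f\<in>S. \<forall>\<^sub>F (f', g) in uniformity. f' = f \<longrightarrow> g \<in> S)"

definition sgn_cdual :: "'a cdual \<Rightarrow> 'a cdual"
  where "sgn_cdual f = inverse (norm f) *\<^sub>R f"

instance
proof
  fix f g h :: "'a cdual" and r s :: real and c c' :: complex
  show "f + g + h = f + (g + h)" "f + g = g + f" "0 + f = f" "- f + f = 0" "f - g = f + - g"
    by (transfer, simp add: algebra_simps)+
  show "r *\<^sub>R (f + g) = r *\<^sub>R f + r *\<^sub>R g" "(r + s) *\<^sub>R f = r *\<^sub>R f + s *\<^sub>R f"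
    "r *\<^sub>R s *\<^sub>R f = (r * s) *\<^sub>R f" "1 *\<^sub>R f = f"
    by (transfer, simp add: algebra_simps)+
  show "dist f g = norm (f - g)" by (fact dist_cdual_def)
  show "sgn f = inverse (norm f) *\<^sub>R f" by (fact sgn_cdual_def)
  show "uniformity = (INF e\<in>{0 <..}. principal {(f, g :: 'a cdual). dist f g < e})"
    by (fact uniformity_cdual_def)
  show "open S = (\<forall>f\<in>S. \<forall>\<^sub>F (f', g) in uniformity. f' = f \<longrightarrow> g \<in> S)" for S :: "'a cdual set"
    by (fact open_cdual_def)
  show "(norm f = 0) = (f = 0)"
    by transfer (auto simp: onorm_eq_0)
  show "norm (f + g) \<le> norm f + norm g"
    by transfer (auto intro: onorm_triangle)
  show "norm (r *\<^sub>R f) = \<bar>r\<bar> * norm f"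
    by transfer (auto intro: onorm_scaleR)
  show "c *\<^sub>C (f + g) = c *\<^sub>C f + c *\<^sub>C g" "(c + c') *\<^sub>C f = c *\<^sub>C f + c' *\<^sub>C f"
    "c *\<^sub>C c' *\<^sub>C f = (c * c') *\<^sub>C f" "r *\<^sub>R f = complex_of_real r *\<^sub>C f"
    by (transfer, simp add: algebra_simps scaleR_conv_of_real)+
  show "norm (c *\<^sub>C f) = cmod c * norm f"
  proof transfer
    fix c :: complex and f :: "'a \<Rightarrow> complex"
    assume "clinear f \<and> bounded_linear f"
    then have f: "bounded_linear f" by simp
    have le: "onorm (\<lambda>x. c * g x) \<le> cmod c * onorm g" if g: "bounded_linear g"
      for c and g :: "'a \<Rightarrow> complex"
    proof (rule onorm_bound)
      show "norm (c * g x) \<le> cmod c * onorm g * norm x" for x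
        using mult_left_mono[OF onorm[OF g, of x], of "cmod c"] by (simp add: norm_mult mult.assoc)
    qed (simp add: onorm_pos_le[OF g])
    show "onorm (\<lambda>x. c * f x) = cmod c * onorm f"
    proof (cases "c = 0")
      case False
      have "onorm f \<le> cmod (inverse c) * onorm (\<lambda>x. c * f x)"
        using le[OF bounded_linear_const_mult[OF f, of c], of "inverse c"] False
        by (simp add: mult.assoc[symmetric])
      then have "cmod c * onorm f \<le> cmod c * (cmod (inverse c) * onorm (\<lambda>x. c * f x))"
        by (rule mult_left_mono) simp
      also have "\<dots> = onorm (\<lambda>x. c * f x)"
        using False by (simp add: norm_inverse)
      finally show ?thesis
        using le[OF f, of c] by linarith
    qed (simp add: onorm_zero)
  qed
qed

end

lemma clinear_cdual_apply: "clinear (cdual_apply f)"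
  using cdual_apply[of f] by simp

lemma bounded_linear_cdual_apply: "bounded_linear (cdual_apply f)"
  using cdual_apply[of f] by simp

lemma cdual_eqI: "(\<And>x. cdual_apply f x = cdual_apply g x) \<Longrightarrow> f = g"
  by transfer auto

lemma norm_cdual_apply_le: "cmod (cdual_apply f x) \<le> norm f * norm x"
  by transfer (auto intro: onorm)

lemma norm_cdual_bound:
  "0 \<le> b \<Longrightarrow> (\<And>x. cmod (cdual_apply f x) \<le> b * norm x) \<Longrightarrow> norm f \<le> b"
  by transfer (auto intro: onorm_bound)

lemma clinear_bounded_linearI:
  fixes f :: "'a::complex_normed_vector \<Rightarrow> complex"
  assumes "clinear f" and "\<And>x. cmod (f x) \<le> norm x * K"
  shows "clinear f \<and> bounded_linear f"
  using assms by (auto simp: clinear_def scaleR_scaleC intro!: bounded_linear_intro)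

section \<open>The involution on the dual and on the bidual\<close>

text \<open>If \<open>E\<close> has an isometric conjugate-linear involution then so has its dual, by
  \<open>f\<^sup>\<star>(x) = cnj (f(x\<^sup>\<star>))\<close>. Applied twice this is the usual involution on the bidual.\<close>

lift_definition star_dual :: "'a::isometric_star_vector cdual \<Rightarrow> 'a cdual"
  is "\<lambda>f x. cnj (f (x\<^sup>\<star>))"
proof -
  fix f :: "'a \<Rightarrow> complex"
  assume f: "clinear f \<and> bounded_linear f"
  then obtain K where "\<And>x. cmod (f x) \<le> norm x * K"
    using bounded_linear.bounded by blast
  then have "cmod (cnj (f (x\<^sup>\<star>))) \<le> norm x * K" for x
    by (metis complex_mod_cnj norm_star)
  with f show "clinear (\<lambda>x. cnj (f (x\<^sup>\<star>))) \<and> bounded_linear (\<lambda>x. cnj (f (x\<^sup>\<star>)))"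
    by (intro clinear_bounded_linearI) (auto simp: clinear_def scaleC_complex_def star_add star_scaleC)
qed

instantiation cdual :: (isometric_star_vector) isometric_star_vector
begin

definition star_cdual :: "'a cdual \<Rightarrow> 'a cdual"
  where "star_cdual = star_dual"

instance
proof
  fix f g :: "'a cdual" and c :: complex
  show "(f + g)\<^sup>\<star> = f\<^sup>\<star> + g\<^sup>\<star>" "(c *\<^sub>C f)\<^sup>\<star> = cnj c *\<^sub>C f\<^sup>\<star>" "(f\<^sup>\<star>)\<^sup>\<star> = f"
    unfolding star_cdual_def by (transfer, simp add: star_star)+
  have le: "norm (f\<^sup>\<star>) \<le> norm f" for f :: "'a cdual"
  proof (rule norm_cdual_bound)
    show "cmod (cdual_apply (f\<^sup>\<star>) x) \<le> norm f * norm x" for x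
      using norm_cdual_apply_le[of f "x\<^sup>\<star>"] by (simp add: star_cdual_def star_dual.rep_eq norm_star)
  qed simp
  show "norm (f\<^sup>\<star>) = norm f"
    using le[of f] le[of "f\<^sup>\<star>"] \<open>(f\<^sup>\<star>)\<^sup>\<star> = f\<close> by simp
qed

end

lemma star_cdual_apply: "cdual_apply (f\<^sup>\<star>) x = cnj (cdual_apply f (x\<^sup>\<star>))"
  by (simp add: star_cdual_def star_dual.rep_eq)

section \<open>The bidual and the first Arens product\<close>

type_synonym 'a bidual = "'a cdual cdual"

lift_definition canon :: "'a::complex_normed_vector \<Rightarrow> 'a bidual" is "\<lambda>a f. cdual_apply f a"
proof -
  fix a :: 'a
  show "clinear (\<lambda>f. cdual_apply f a) \<and> bounded_linear (\<lambda>f. cdual_apply f a)"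
    by (rule clinear_bounded_linearI[where K = "norm a"])
      (auto simp: clinear_def scaleC_complex_def plus_cdual.rep_eq scaleC_cdual.rep_eq
        norm_cdual_apply_le)
qed

text \<open>\<open>(f \<cdot> a)(b) = f(ab)\<close>\<close>

lift_definition dual_ract :: "'a::complex_normed_algebra cdual \<Rightarrow> 'a \<Rightarrow> 'a cdual"
  is "\<lambda>f a b. f (a * b)"
  by (auto simp: clinear_def distrib_left mult_scaleC_right
      intro: bounded_linear_compose[OF _ bounded_linear_mult_right])

lemma norm_dual_ract_le: "norm (dual_ract f a) \<le> norm f * norm a"
proof (rule norm_cdual_bound)
  show "cmod (cdual_apply (dual_ract f a) x) \<le> norm f * norm a * norm x" for x
    using norm_cdual_apply_le[of f "a * x"] mult_left_mono[OF norm_mult_ineq[of a x], of "norm f"]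
    by (simp add: dual_ract.rep_eq mult.assoc)
qed simp

lemma dual_ract_add: "dual_ract f (a + b) = dual_ract f a + dual_ract f b"
  by (rule cdual_eqI) (use clinear_cdual_apply[of f] in
      \<open>simp add: dual_ract.rep_eq plus_cdual.rep_eq clinear_def distrib_right\<close>)

lemma dual_ract_scaleC: "dual_ract f (c *\<^sub>C a) = c *\<^sub>C dual_ract f a"
  by (rule cdual_eqI) (use clinear_cdual_apply[of f] in
      \<open>simp add: dual_ract.rep_eq scaleC_cdual.rep_eq clinear_def mult_scaleC_left scaleC_complex_def\<close>)

text \<open>\<open>(G \<cdot> f)(a) = G(f \<cdot> a)\<close>\<close>

lift_definition bidual_lact :: "'a::complex_normed_algebra bidual \<Rightarrow> 'a cdual \<Rightarrow> 'a cdual"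
  is "\<lambda>G f a. cdual_apply G (dual_ract f a)"
proof -
  fix G :: "'a bidual" and f :: "'a cdual"
  have "cmod (cdual_apply G (dual_ract f a)) \<le> norm a * (norm G * norm f)" for a
    using norm_cdual_apply_le[of G "dual_ract f a"]
      mult_left_mono[OF norm_dual_ract_le[of f a], of "norm G"]
    by (simp add: mult_ac)
  then show "clinear (\<lambda>a. cdual_apply G (dual_ract f a)) \<and>
      bounded_linear (\<lambda>a. cdual_apply G (dual_ract f a))"
    using clinear_cdual_apply[of G]
    by (intro clinear_bounded_linearI) (auto simp: clinear_def dual_ract_add dual_ract_scaleC)
qed

lemma norm_bidual_lact_le: "norm (bidual_lact G f) \<le> norm G * norm f"
proof (rule norm_cdual_bound)
  show "cmod (cdual_apply (bidual_lact G f) a) \<le> norm G * norm f * norm a" for a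
    using norm_cdual_apply_le[of G "dual_ract f a"]
      mult_left_mono[OF norm_dual_ract_le[of f a], of "norm G"]
    by (simp add: bidual_lact.rep_eq mult_ac)
qed simp

lemma bidual_lact_add: "bidual_lact G (f + g) = bidual_lact G f + bidual_lact G g"
proof (rule cdual_eqI)
  fix a
  have "dual_ract (f + g) a = dual_ract f a + dual_ract g a"
    by (rule cdual_eqI) (simp add: dual_ract.rep_eq plus_cdual.rep_eq)
  then show "cdual_apply (bidual_lact G (f + g)) a = cdual_apply (bidual_lact G f + bidual_lact G g) a"
    using clinear_cdual_apply[of G] by (simp add: bidual_lact.rep_eq plus_cdual.rep_eq clinear_def)
qed

lemma bidual_lact_scaleC: "bidual_lact G (c *\<^sub>C f) = c *\<^sub>C bidual_lact G f"
proof (rule cdual_eqI)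
  fix a
  have "dual_ract (c *\<^sub>C f) a = c *\<^sub>C dual_ract f a"
    by (rule cdual_eqI) (simp add: dual_ract.rep_eq scaleC_cdual.rep_eq)
  then show "cdual_apply (bidual_lact G (c *\<^sub>C f)) a = cdual_apply (c *\<^sub>C bidual_lact G f) a"
    using clinear_cdual_apply[of G]
    by (simp add: bidual_lact.rep_eq scaleC_cdual.rep_eq clinear_def scaleC_complex_def)
qed

text \<open>\<open>(F \<box> G)(f) = F(G \<cdot> f)\<close>\<close>

lift_definition arens :: "'a::complex_normed_algebra bidual \<Rightarrow> 'a bidual \<Rightarrow> 'a bidual"
    (infixl "\<box>" 70)
  is "\<lambda>F G f. cdual_apply F (bidual_lact G f)"
proof -
  fix F G :: "'a bidual"
  have "cmod (cdual_apply F (bidual_lact G f)) \<le> norm f * (norm F * norm G)" for f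
    using norm_cdual_apply_le[of F "bidual_lact G f"]
      mult_left_mono[OF norm_bidual_lact_le[of G f], of "norm F"]
    by (simp add: mult_ac)
  then show "clinear (\<lambda>f. cdual_apply F (bidual_lact G f)) \<and>
      bounded_linear (\<lambda>f. cdual_apply F (bidual_lact G f))"
    using clinear_cdual_apply[of F]
    by (intro clinear_bounded_linearI) (auto simp: clinear_def bidual_lact_add bidual_lact_scaleC)
qed

lemma arens_canon: "canon a \<box> canon b = canon (a * b)"
  by (rule cdual_eqI) (simp add: arens.rep_eq canon.rep_eq bidual_lact.rep_eq dual_ract.rep_eq)

lemma star_canon: "(canon a)\<^sup>\<star> = canon (a\<^sup>\<star>)" for a :: "'a::isometric_star_vector"
  by (rule cdual_eqI) (simp add: star_cdual_apply canon.rep_eq star_star)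

section \<open>Derivations into the bidual\<close>

text \<open>The \<open>A\<close>-bimodule actions on the bidual are \<open>a F = canon a \<box> F\<close> and \<open>F a = F \<box> canon a\<close>.\<close>

definition bidual_derivation :: "('a::cstar_algebra \<Rightarrow> 'a bidual) \<Rightarrow> bool"
  where "bidual_derivation d \<longleftrightarrow>
    clinear d \<and> (\<forall>a b. d (a * b) = canon a \<box> d b + d a \<box> canon b)"

definition star_map :: "('a::star \<Rightarrow> 'b::star) \<Rightarrow> bool"
  where "star_map h \<longleftrightarrow> (\<forall>a. h (a\<^sup>\<star>) = (h a)\<^sup>\<star>)"

definition bidual_star_derivation :: "('a::cstar_algebra \<Rightarrow> 'a bidual) \<Rightarrow> bool"
  where "bidual_star_derivation d \<longleftrightarrow> bidual_derivation d \<and> star_map d"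

end

theory Submission
  imports Defs "HOL-Computational_Algebra.Polynomial"
begin

text \<open>
  One direction is a computation: if \<open>\<delta> = d + (\<cdot>)\<eta>\<close> with \<open>d\<close> a \<open>\<star>\<close>-derivation, the expression
  \<open>a\<^sup>\<star>\<delta>(b) + \<delta>(a)\<^sup>\<star>b\<close> equals \<open>d(a\<^sup>\<star>b) + a\<^sup>\<star>b\<eta> + \<eta>\<^sup>\<star>a\<^sup>\<star>b\<close>, which depends on \<open>a\<^sup>\<star>b\<close> only.

  For the other direction put \<open>\<psi>(a) = \<delta>(a\<^sup>\<star>)\<^sup>\<star>\<close>. The hypothesis says that the bounded bilinear map
  \<open>\<phi>(a, b) = a\<delta>(b) + \<psi>(a)b\<close> vanishes whenever \<open>ab = 0\<close>. On a \<open>C\<^sup>\<star>\<close>-algebra every such map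
  satisfies \<open>\<phi>(ab, c) = \<phi>(a, bc)\<close> (\<open>zero_product_bilinear_balanced\<close>), that is,
  \<open>ab\<delta>(c) + \<psi>(ab)c = a\<delta>(bc) + \<psi>(a)bc\<close>. Let \<open>a\<close> run through an approximate unit \<open>e\<close> along which \<open>\<delta>(e)\<close>
  has a weak-\<open>\<star>\<close> limit \<open>\<eta>\<close>; the identity becomes \<open>b\<delta>(c) + \<psi>(b)c = \<delta>(bc) + \<eta>\<^sup>\<star>bc\<close>. Letting then \<open>c\<close>
  run through \<open>e\<close> gives \<open>b\<eta> + \<psi>(b) = \<delta>(b) + \<eta>\<^sup>\<star>b\<close>. The second identity says that
  \<open>d(a) = \<delta>(a) - a\<eta>\<close> is a \<open>\<star>\<close>-map, and substituting it into the first one says that \<open>d\<close> is a derivation.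

  Two facts about \<open>C\<^sup>\<star>\<close>-algebras carry this argument, and both are derived here from a continuous
  functional calculus for a self-adjoint contraction \<open>h\<close> in a unital \<open>C\<^sup>\<star>\<close>-algebra. Its core is
  \<open>norm_peval_le\<close>: the norm of \<open>p(h)\<close> is at most the supremum of \<open>\<bar>p\<bar>\<close> on \<open>[-1, 1]\<close>. Indeed \<open>h\<close> is
  the real part of a unitary, so this bound holds up to a factor linear in the degree of \<open>p\<close>, and
  passing to \<open>p\<^bsup>2\<^sup>n\<^esup>\<close> removes the factor. The algebra itself need not have a unit, so the calculus
  takes place in its multiplier algebra.

  The first fact is \<open>zero_product_bilinear_balanced\<close>. Cutting a self-adjoint \<open>x\<close> by \<open>N\<close> ramp functions writes
  \<open>\<phi>(ax, c) - \<phi>(a, xc)\<close> as a sum of \<open>2N\<close> terms of order \<open>1/N\<close>, in which only overlapping pieces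
  of \<open>x\<close> meet; grouping the terms into three classes of pairwise orthogonal ones bounds each class by
  a single value of \<open>\<phi>\<close>, hence the whole sum by a constant times \<open>1/N\<close>.

  The second fact is that the approximate unit acts on every bounded functional in norm, not merely
  weakly (\<open>approximate_unit_for_functionals\<close>); this is what makes \<open>eF \<rightarrow> F\<close> and \<open>Fe \<rightarrow> F\<close>
  weak-\<open>\<star>\<close> in the bidual. If \<open>f\<close> nearly attains its norm at \<open>x\<close> and \<open>ex \<approx> x\<close>, then \<open>f\<close> cannot be
  large on \<open>(1 - e)b\<close>, because \<open>e\<^bsup>1/2\<^esup>x + t(1 - e)\<^bsup>1/2\<^esup>b\<close> has norm at most \<open>sqrt (1 + t\<^sup>2)\<close>. That estimate
  rests on \<open>norm_star_mult_self_le_add\<close>, a form of the positivity of \<open>z\<^sup>\<star>z\<close>.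
\<close>

section \<open>Complex scalars and the involution\<close>

lemma scaleR_scaleC_commute: "r *\<^sub>R (c *\<^sub>C x) = c *\<^sub>C (r *\<^sub>R (x::'a::complex_normed_vector))"
  by (simp add: scaleR_scaleC scaleC_scaleC mult.commute)

lemma scaleC_zero_left [simp]: "0 *\<^sub>C (x::'a::complex_normed_vector) = 0"
  using scaleR_scaleC[of 0 x] by simp

lemma scaleC_one [simp]: "1 *\<^sub>C (x::'a::complex_normed_vector) = x"
  using scaleR_scaleC[of 1 x] by simp

lemma scaleC_zero_right [simp]: "c *\<^sub>C (0::'a::complex_normed_vector) = 0"
  using norm_scaleC[of c "0::'a"] by simp

lemma scaleC_minus_left: "(- c) *\<^sub>C (x::'a::complex_normed_vector) = - (c *\<^sub>C x)"
  using scaleC_add_left[of "-c" c x] by (simp add: eq_neg_iff_add_eq_0)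

lemma scaleC_minus_right: "c *\<^sub>C (- x) = - (c *\<^sub>C (x::'a::complex_normed_vector))"
  using scaleC_add_right[of c "-x" x] by (simp add: eq_neg_iff_add_eq_0)

lemma scaleC_diff_right: "c *\<^sub>C (x - y) = c *\<^sub>C x - c *\<^sub>C (y::'a::complex_normed_vector)"
  using scaleC_add_right[of c x "-y"] by (simp add: scaleC_minus_right)

lemma bounded_linear_scaleC_right:
  "bounded_linear (\<lambda>x::'a::complex_normed_vector. c *\<^sub>C x)"
  by (rule bounded_linear_intro[where K = "cmod c"])
    (simp_all add: scaleC_add_right scaleR_scaleC_commute norm_scaleC mult.commute)

lemma star_scaleR: "(r *\<^sub>R x)\<^sup>\<star> = r *\<^sub>R (x::'a::complex_star_vector)\<^sup>\<star>"
  by (simp add: scaleR_scaleC star_scaleC)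

lemma star_zero [simp]: "(0::'a::complex_star_vector)\<^sup>\<star> = 0"
  using star_scaleR[of 0 "0::'a"] by simp

lemma star_minus: "(- x)\<^sup>\<star> = - (x::'a::complex_star_vector)\<^sup>\<star>"
  using star_scaleR[of "-1" x] by simp

lemma star_diff: "(x - y)\<^sup>\<star> = x\<^sup>\<star> - (y::'a::complex_star_vector)\<^sup>\<star>"
  using star_add[of x "-y"] by (simp add: star_minus)

lemma bounded_linear_star: "bounded_linear (star :: 'a::isometric_star_vector \<Rightarrow> 'a)"
  by (rule bounded_linear_intro[where K = 1]) (simp_all add: star_add star_scaleR norm_star)

lemma star_sum: "(sum f I)\<^sup>\<star> = (\<Sum>i\<in>I. (f i :: 'a::isometric_star_vector)\<^sup>\<star>)"
  by (induction I rule: infinite_finite_induct) (simp_all add: star_add)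

text \<open>Unital \<open>C\<^sup>\<star>\<close>-algebras appear as \<open>{cstar_algebra, monoid_mult}\<close> rather than as an extension of \<open>ring_1\<close>,
  which demands \<open>0 \<noteq> 1\<close>: the zero algebra is admitted, and it is its own multiplier algebra.
  For the same reason the norm of 1 is only bounded by 1.\<close>

lemma star_one [simp]: "(1::'a::{cstar_algebra,monoid_mult})\<^sup>\<star> = 1"
  by (metis mult_1 star_mult star_star mult.right_neutral)

lemma star_power: "(x ^ n)\<^sup>\<star> = ((x::'a::{cstar_algebra,monoid_mult})\<^sup>\<star>) ^ n"
  by (induction n) (simp_all add: star_mult power_commutes)

lemma norm_one_le: "norm (1::'a::{cstar_algebra,monoid_mult}) \<le> 1"
proof -
  have "norm (1::'a) * norm (1::'a) = norm (1::'a)"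
    using cstar_identity[of "1::'a"] by (simp add: power2_eq_square)
  then show ?thesis by (cases "norm (1::'a) = 0") auto
qed

lemma norm_power_le:
  fixes x :: "'a::{cstar_algebra,monoid_mult}"
  shows "norm (x ^ n) \<le> norm x ^ n"
proof (induction n)
  case (Suc n)
  have "norm (x ^ Suc n) \<le> norm x * norm (x ^ n)"
    using norm_mult_ineq[of x "x ^ n"] by simp
  also have "\<dots> \<le> norm x * norm x ^ n"
    using Suc by (rule mult_left_mono) simp
  finally show ?case by simp
qed (simp add: norm_one_le)

lemma norm_selfadjoint_square:
  fixes x :: "'a::cstar_algebra"
  assumes "x\<^sup>\<star> = x"
  shows "norm (x * x) = (norm x)\<^sup>2"
  using cstar_identity[of x] assms by simp

text \<open>Iterating the \<open>C\<^sup>\<star>\<close>-identity turns norm estimates that are only correct up to a factor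
  growing slowly with the exponent into sharp ones.\<close>

lemma selfadjoint_power2_power:
  fixes x :: "'a::{cstar_algebra,monoid_mult}"
  assumes "x\<^sup>\<star> = x"
  shows "norm (x ^ (2 ^ n)) = norm x ^ (2 ^ n)"
proof (induction n)
  case (Suc n)
  have "x ^ (2 ^ Suc n) = x ^ (2 ^ n) * x ^ (2 ^ n)"
    by (simp add: mult_2 power_add)
  moreover have "(x ^ (2 ^ n))\<^sup>\<star> = x ^ (2 ^ n)"
    by (simp add: star_power assms)
  ultimately show ?case
    using Suc norm_selfadjoint_square[of "x ^ (2 ^ n)"]
    by (simp add: power2_eq_square mult_2 power_add)
qed simp

section \<open>Real polynomials in an element of a unital algebra\<close>

definition peval :: "real poly \<Rightarrow> 'a \<Rightarrow> 'a::{real_algebra,monoid_mult}"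
  where "peval p x = fold_coeffs (\<lambda>c y. c *\<^sub>R 1 + x * y) p 0"

lemma peval_0 [simp]: "peval 0 x = 0"
  by (simp add: peval_def)

lemma peval_pCons [simp]: "peval (pCons c p) x = c *\<^sub>R 1 + x * peval p x"
  by (cases "p = 0 \<and> c = 0") (auto simp: peval_def)

lemma peval_1 [simp]: "peval 1 x = 1"
  by (simp add: one_pCons)

lemma peval_add [simp]: "peval (p + q) x = peval p x + peval q x"
  by (induction p q rule: poly_induct2) (simp_all add: algebra_simps)

lemma peval_smult [simp]: "peval (smult c p) x = c *\<^sub>R peval p x"
  by (induction p) (simp_all add: algebra_simps)

lemma peval_minus [simp]: "peval (- p) x = - peval p x"
  using peval_smult[of "-1" p x] by simp

lemma peval_diff [simp]: "peval (p - q) x = peval p x - peval q x"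
  using peval_add[of p "-q" x] by simp

lemma peval_mult [simp]: "peval (p * q) x = peval p x * peval q x"
  by (induction p) (simp_all add: algebra_simps)

lemma peval_power [simp]: "peval (p ^ n) x = peval p x ^ n"
  by (induction n) simp_all

lemma peval_sum: "peval (sum f I) x = (\<Sum>i\<in>I. peval (f i) x)"
  by (induction I rule: infinite_finite_induct) simp_all

lemma peval_conv_sum: "peval p x = (\<Sum>i\<le>degree p. coeff p i *\<^sub>R x ^ i)"
proof -
  have "peval (monom c n) x = c *\<^sub>R x ^ n" for c n
    by (induction n) (simp_all add: monom_0 monom_Suc)
  then have "peval (\<Sum>i\<le>degree p. monom (coeff p i) i) x = (\<Sum>i\<le>degree p. coeff p i *\<^sub>R x ^ i)"
    by (simp add: peval_sum)
  then show ?thesis by (simp add: poly_as_sum_of_monoms)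
qed

lemma peval_of_real: "peval p (complex_of_real t) = complex_of_real (poly p t)"
  by (induction p) (simp_all add: scaleR_conv_of_real)

lemma star_peval:
  fixes x :: "'a::{cstar_algebra,monoid_mult}"
  assumes "x\<^sup>\<star> = x"
  shows "(peval p x)\<^sup>\<star> = peval p x"
  unfolding peval_conv_sum by (simp add: star_sum star_scaleR star_power assms)

lemma isCont_peval_scaleR:
  fixes x :: "'a::{cstar_algebra,monoid_mult}"
  shows "isCont (\<lambda>r. peval p (r *\<^sub>R x)) r"
  by (induction p) (auto intro!: continuous_intros)

section \<open>Self-adjoint contractions as real parts of unitaries\<close>

lemma gbinomial_half_abs_le: "\<bar>(1/2::real) gchoose n\<bar> \<le> 1"
proof (induction n)
  case (Suc n)
  have "(1/2::real) gchoose Suc n = ((1/2) gchoose n) * ((1/2 - real n) / (real n + 1))"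
    by (simp add: gbinomial_prod_rev field_simps prod.atLeast0_lessThan_Suc)
  moreover have "\<bar>(1/2 - real n) / (real n + 1)\<bar> \<le> 1"
    by (simp add: field_simps)
  ultimately show ?case
    using mult_mono[OF Suc, of "\<bar>(1/2 - real n) / (real n + 1)\<bar>" 1] by (simp add: abs_mult)
qed simp

text \<open>The element \<open>s\<close> is the binomial series of \<open>sqrt (1 - t)\<close> at \<open>t = h * h\<close>; its square is computed with the
  Vandermonde identity, as \<open>1/2 + 1/2 = 1\<close> leaves only the terms \<open>1 - t\<close>.\<close>

lemma sqrt_one_minus_square:
  fixes h :: "'a::{cstar_algebra,monoid_mult}"
  assumes h: "h\<^sup>\<star> = h" and less: "norm h < 1"
  obtains s where "s\<^sup>\<star> = s" "s * h = h * s" "h * h + s * s = 1"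
proof -
  define c where "c n = (-1) ^ n * ((1/2::real) gchoose n)" for n
  define s where "s = (\<Sum>n. c n *\<^sub>R (h * h) ^ n)"
  have c_le: "\<bar>c n\<bar> \<le> 1" for n
    using gbinomial_half_abs_le[of n] by (simp add: c_def abs_mult)
  have q: "norm h * norm h < 1"
    using less by (metis abs_norm_cancel abs_square_less_1 power2_eq_square)
  have summ: "summable (\<lambda>n. norm (c n *\<^sub>R (h * h) ^ n))"
  proof (rule summable_comparison_test')
    show "summable (\<lambda>n. (norm h * norm h) ^ n)"
      using q by (intro summable_geometric) simp
    show "norm (norm (c n *\<^sub>R (h * h) ^ n)) \<le> (norm h * norm h) ^ n" for n
    proof -
      have "norm ((h * h) ^ n) \<le> (norm h * norm h) ^ n"
        using norm_power_le[of "h * h" n] power_mono[OF norm_mult_ineq[of h h]]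
        by (meson norm_ge_zero order_trans)
      then show ?thesis
        using mult_mono[OF c_le[of n], of "norm ((h * h) ^ n)"] by simp
    qed
  qed
  then have sm: "summable (\<lambda>n. c n *\<^sub>R (h * h) ^ n)"
    by (rule summable_norm_cancel)
  have comm: "h * (h * h) ^ n = (h * h) ^ n * h" for n
    by (rule power_commuting_commutes[symmetric]) (simp add: mult.assoc)
  have "s\<^sup>\<star> = (\<Sum>n. (c n *\<^sub>R (h * h) ^ n)\<^sup>\<star>)"
    unfolding s_def by (rule bounded_linear.suminf[OF bounded_linear_star sm])
  then have 1: "s\<^sup>\<star> = s"
    by (simp add: s_def star_scaleR star_power star_mult h)
  have 2: "s * h = h * s"
    using suminf_mult[OF sm, of h] suminf_mult2[OF sm, of h] by (simp add: s_def comm)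
  have vander: "(\<Sum>i\<le>k. c i * c (k - i)) = (-1) ^ k * ((1::real) gchoose k)" for k
  proof -
    have "(\<Sum>i\<le>k. c i * c (k - i)) = (\<Sum>i\<le>k. (-1) ^ k * (((1/2) gchoose i) * ((1/2) gchoose (k - i))))"
    proof (rule sum.cong)
      fix i
      assume "i \<in> {..k}"
      then have "(-1::real) ^ k = (-1) ^ i * (-1) ^ (k - i)"
        by (simp flip: power_add)
      then show "c i * c (k - i) = (-1) ^ k * (((1/2) gchoose i) * ((1/2) gchoose (k - i)))"
        by (simp add: c_def)
    qed simp
    then show ?thesis
      using gbinomial_Vandermonde[of "1/2::real" "1/2" k]
      by (simp add: sum_distrib_left[symmetric] atMost_atLeast0)
  qed
  have "(\<lambda>k. \<Sum>i\<le>k. (c i *\<^sub>R (h * h) ^ i) * (c (k - i) *\<^sub>R (h * h) ^ (k - i))) sums (s * s)"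
    unfolding s_def by (rule Cauchy_product_sums[OF summ summ])
  moreover have "(\<Sum>i\<le>k. (c i *\<^sub>R (h * h) ^ i) * (c (k - i) *\<^sub>R (h * h) ^ (k - i)))
      = ((-1) ^ k * ((1::real) gchoose k)) *\<^sub>R (h * h) ^ k" for k
  proof -
    have "(c i *\<^sub>R (h * h) ^ i) * (c (k - i) *\<^sub>R (h * h) ^ (k - i)) = (c i * c (k - i)) *\<^sub>R (h * h) ^ k"
      if "i \<le> k" for i
      using that by (simp flip: power_add)
    then show ?thesis
      by (simp add: scaleR_sum_left flip: vander)
  qed
  ultimately have "(\<lambda>k. ((-1) ^ k * ((1::real) gchoose k)) *\<^sub>R (h * h) ^ k) sums (s * s)"
    by simp
  moreover have "(\<lambda>k. ((-1) ^ k * ((1::real) gchoose k)) *\<^sub>R (h * h) ^ k) sums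
      (\<Sum>k\<in>{0,1}. ((-1) ^ k * ((1::real) gchoose k)) *\<^sub>R (h * h) ^ k)"
  proof (rule sums_finite)
    fix k :: nat
    assume "k \<notin> {0,1}"
    then have "(1::real) gchoose k = 0"
      using binomial_gbinomial[of 1 k, where 'a = real] by (simp add: binomial_eq_0)
    then show "((-1) ^ k * ((1::real) gchoose k)) *\<^sub>R (h * h) ^ k = 0" by simp
  qed simp
  ultimately have "s * s = (\<Sum>k\<in>{0,1}. ((-1) ^ k * ((1::real) gchoose k)) *\<^sub>R (h * h) ^ k)"
    by (rule sums_unique2)
  then have "h * h + s * s = 1"
    by simp
  with 1 2 show ?thesis by (rule that)
qed

text \<open>The unitary is \<open>h + i sqrt (1 - h\<^sup>2)\<close>.\<close>

lemma selfadjoint_re_unitary: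
  fixes h :: "'a::{cstar_algebra,monoid_mult}"
  assumes h: "h\<^sup>\<star> = h" and less: "norm h < 1"
  obtains u where "u\<^sup>\<star> * u = 1" "u * u\<^sup>\<star> = 1" "2 *\<^sub>R h = u + u\<^sup>\<star>"
proof -
  obtain s where s: "s\<^sup>\<star> = s" "s * h = h * s" "h * h + s * s = 1"
    using sqrt_one_minus_square[OF assms] .
  define u where "u = h + \<i> *\<^sub>C s"
  have us: "u\<^sup>\<star> = h - \<i> *\<^sub>C s"
    by (simp add: u_def star_add star_scaleC h s scaleC_minus_left)
  have i: "\<i> *\<^sub>C \<i> *\<^sub>C x = - x" for x :: 'a
    by (simp add: scaleC_scaleC scaleC_minus_left)
  have "u\<^sup>\<star> * u = h * h + s * s" "u * u\<^sup>\<star> = h * h + s * s"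
    unfolding us unfolding u_def
    by (simp_all add: distrib_left distrib_right left_diff_distrib right_diff_distrib
        mult_scaleC_left mult_scaleC_right s(2) i scaleC_add_right scaleC_diff_right)
  then have "u\<^sup>\<star> * u = 1" "u * u\<^sup>\<star> = 1"
    by (simp_all only: s(3))
  moreover have "2 *\<^sub>R h = u + u\<^sup>\<star>"
    unfolding us unfolding u_def by (simp add: scaleR_2)
  ultimately show ?thesis by (rule that)
qed

lemma norm_unitary_power_le:
  fixes u :: "'a::{cstar_algebra,monoid_mult}"
  assumes "u\<^sup>\<star> * u = 1"
  shows "norm (u ^ n) \<le> 1"
proof -
  have "(u ^ n)\<^sup>\<star> * u ^ n = 1"
  proof (induction n)
    case (Suc n)
    have "(u ^ Suc n)\<^sup>\<star> * u ^ Suc n = (u ^ n)\<^sup>\<star> * (u\<^sup>\<star> * u) * u ^ n"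
      by (simp add: star_mult mult.assoc)
    then show ?case using Suc assms by simp
  qed simp
  then have "(norm (u ^ n))\<^sup>2 \<le> 1"
    using cstar_identity[of "u ^ n"] norm_one_le[where 'a = 'a] by simp
  then show ?thesis
    by (simp add: power2_le_iff_abs_le abs_square_le_1)
qed

section \<open>Continuous functions of a self-adjoint element\<close>

text \<open>Fourier inversion on the \<open>N\<close>-th roots of unity: the coefficient is an average of values of \<open>R\<close> on the
  unit circle multiplied by numbers of modulus 1.\<close>

lemma abs_coeff_le_sup_circle:
  fixes R :: "real poly"
  assumes deg: "degree R < N" and bound: "\<And>z. cmod z = 1 \<Longrightarrow> cmod (peval R z) \<le> B"
  shows "\<bar>coeff R k\<bar> \<le> B"
proof (cases "k < N")
  case True
  define w where "w m = exp (2 * complex_of_real pi * \<i> * complex_of_nat m / complex_of_nat N)" for m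
  have w_mult: "w (i * m) = w i ^ m" for i m
    by (simp add: w_def exp_of_nat_mult[symmetric] field_simps)
  have norm_w: "cmod (w m) = 1" for m
    by (simp add: w_def norm_exp_eq_Re)
  have w_nz: "w m \<noteq> 0" for m
    by (simp add: w_def)
  have N: "N \<ge> 1"
    using True by simp
  have wN: "w m ^ N = 1" for m
    using complex_root_unity[of N m] N by (simp add: w_def)
  have orth: "(\<Sum>j<N. w j ^ i * inverse (w j ^ k)) = (if i = k then of_nat N else 0)" if i: "i < N" for i
  proof (cases "i = k")
    case True
    then show ?thesis by (simp add: w_nz)
  next
    case False
    define \<zeta> where "\<zeta> = w i * inverse (w k)"
    have "\<zeta> \<noteq> 1"
    proof
      assume "\<zeta> = 1"
      then have "w i = w k"
        by (simp add: \<zeta>_def w_nz field_simps)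
      then have "i mod N = k mod N"
        using complex_root_unity_eq[OF N, of i k] by (simp add: w_def)
      with False i \<open>k < N\<close> show False by simp
    qed
    moreover have "\<zeta> ^ N = 1"
      by (simp add: \<zeta>_def power_mult_distrib power_inverse wN)
    ultimately have "(\<Sum>j<N. \<zeta> ^ j) = 0"
      by (simp add: geometric_sum)
    moreover have "w j ^ i * inverse (w j ^ k) = \<zeta> ^ j" for j
      by (simp add: \<zeta>_def power_mult_distrib power_inverse w_mult[symmetric] mult.commute)
    ultimately show ?thesis
      using False by simp
  qed
  have "(\<Sum>j<N. peval R (w j) * inverse (w j ^ k))
      = (\<Sum>j<N. \<Sum>i\<le>degree R. coeff R i *\<^sub>R (w j ^ i * inverse (w j ^ k)))"
    by (simp add: peval_conv_sum sum_distrib_right)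
  also have "\<dots> = (\<Sum>i\<le>degree R. coeff R i *\<^sub>R (\<Sum>j<N. w j ^ i * inverse (w j ^ k)))"
    by (subst sum.swap) (simp add: scaleR_sum_right)
  also have "\<dots> = (\<Sum>i\<le>degree R. if i = k then coeff R i *\<^sub>R of_nat N else 0)"
    using deg by (intro sum.cong) (simp_all add: orth)
  also have "\<dots> = coeff R k *\<^sub>R of_nat N"
    by (auto simp: coeff_eq_0)
  finally have "\<bar>coeff R k\<bar> * real N = cmod (\<Sum>j<N. peval R (w j) * inverse (w j ^ k))"
    by simp
  also have "\<dots> \<le> (\<Sum>j<N. B)"
    by (rule sum_norm_le) (simp add: norm_mult norm_inverse norm_power norm_w bound)
  finally show ?thesis
    using N by (simp add: mult.commute)
next
  case False
  then have "coeff R k = 0"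
    using deg by (intro coeff_eq_0) simp
  then show ?thesis
    using bound[of 1] by (smt (verit) norm_ge_zero norm_one)
qed

lemma commuting_power_mult:
  fixes a b :: "'a::monoid_mult"
  assumes "a * b = b * a"
  shows "(a * b) ^ n = a ^ n * b ^ n"
proof (induction n)
  case (Suc n)
  have "a ^ n * b = b * a ^ n"
    by (rule power_commuting_commutes[OF assms])
  then show ?case
    using Suc by (simp add: mult.assoc) (metis mult.assoc)
qed simp

text \<open>With \<open>h = (u + u\<^sup>\<star>)/2\<close> and \<open>D\<close> the degree, \<open>u\<^sup>D p(h)\<close> is a polynomial \<open>R\<close> of degree at most \<open>2D\<close> in the unitary \<open>u\<close>.
  The same \<open>R\<close> satisfies \<open>R(z) = z\<^sup>D p(Re z)\<close> on the unit circle, so its coefficients are bounded by the supremum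
  of \<open>\<bar>p\<bar>\<close> on \<open>[-1, 1]\<close>, and there are at most \<open>2D + 1\<close> of them.\<close>

lemma norm_peval_le_degree:
  fixes h :: "'a::{cstar_algebra,monoid_mult}"
  assumes h: "h\<^sup>\<star> = h" and less: "norm h < 1"
    and S: "\<And>t. t \<in> {-1..1} \<Longrightarrow> \<bar>poly p t\<bar> \<le> S"
  shows "norm (peval p h) \<le> (2 * real (degree p) + 1) * S"
proof -
  obtain u where u: "u\<^sup>\<star> * u = 1" "u * u\<^sup>\<star> = 1" "2 *\<^sub>R h = u + u\<^sup>\<star>"
    using selfadjoint_re_unitary[OF h less] .
  define D where "D = degree p"
  define q where "q = [:1/2, 0, 1/2::real:]"
  define R where "R = (\<Sum>i\<le>D. smult (coeff p i) ([:0,1:] ^ (D - i) * q ^ i))"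
  have deg_q: "degree q = 2"
    by (simp add: q_def)
  have "degree R \<le> 2 * D"
    unfolding R_def
  proof (rule degree_sum_le)
    fix i
    assume "i \<in> {..D}"
    have "degree ([:0,1::real:] ^ (D - i) * q ^ i) \<le> degree ([:0,1::real:] ^ (D - i)) + degree (q ^ i)"
      by (rule degree_mult_le)
    also have "\<dots> \<le> degree [:0,1::real:] * (D - i) + degree q * i"
      by (intro add_mono degree_power_le)
    also have "\<dots> \<le> 2 * D"
      using \<open>i \<in> {..D}\<close> by (simp add: deg_q)
    finally show "degree (smult (coeff p i) ([:0,1:] ^ (D - i) * q ^ i)) \<le> 2 * D"
      using degree_smult_le order_trans by blast
  qed simp
  \<comment> \<open>This is used twice: with \<open>(x, y) = (u, h)\<close> and with \<open>(x, y) = (z, Re z)\<close>.\<close>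
  have R: "peval R x = x ^ D * peval p y"
    if "x * y = y * x" "2 *\<^sub>R (x * y) = x * x + 1" for x y :: "'b::{real_algebra,monoid_mult}"
  proof -
    have q: "peval q x = x * y"
      using arg_cong[OF that(2), of "\<lambda>z. (1/2) *\<^sub>R z"]
      by (simp add: q_def scaleR_add_right)
    have "peval R x = (\<Sum>i\<le>D. coeff p i *\<^sub>R (x ^ (D - i) * (x ^ i * y ^ i)))"
      unfolding R_def by (simp add: peval_sum q commuting_power_mult[OF that(1)])
    also have "\<dots> = (\<Sum>i\<le>D. x ^ D * (coeff p i *\<^sub>R y ^ i))"
      by (intro sum.cong) (simp_all add: mult.assoc[symmetric] power_add[symmetric])
    finally show ?thesis
      by (simp add: peval_conv_sum D_def sum_distrib_left)
  qed
  have "cmod (peval R z) \<le> S" if z: "cmod z = 1" for z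
  proof -
    have "z * cnj z = 1"
      using z by (simp add: complex_norm_square[symmetric])
    moreover have "z + cnj z = complex_of_real (2 * Re z)"
      by (rule complex_add_cnj)
    ultimately have "2 *\<^sub>R (z * complex_of_real (Re z)) = z * z + 1"
      by (simp add: scaleR_conv_of_real) (metis distrib_left mult.left_commute)
    then have "peval R z = z ^ D * peval p (complex_of_real (Re z))"
      by (intro R) (simp_all add: mult.commute)
    moreover have "\<bar>Re z\<bar> \<le> 1"
      using abs_Re_le_cmod[of z] z by simp
    ultimately show ?thesis
      using S[of "Re z"] by (simp add: peval_of_real norm_mult norm_power z abs_le_iff)
  qed
  then have coeff_R: "\<bar>coeff R k\<bar> \<le> S" for k
    using \<open>degree R \<le> 2 * D\<close> by (intro abs_coeff_le_sup_circle[of R "2 * D + 1"]) auto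
  have S0: "0 \<le> S"
    using coeff_R[of 0] by linarith
  have hu: "u * h = h * u" "2 *\<^sub>R (u * h) = u * u + 1"
  proof -
    have "2 *\<^sub>R (u * h) = u * (2 *\<^sub>R h)" "2 *\<^sub>R (h * u) = (2 *\<^sub>R h) * u"
      by simp_all
    then have *: "2 *\<^sub>R (u * h) = u * u + 1" "2 *\<^sub>R (h * u) = u * u + 1"
      by (simp_all only: u(3) distrib_left distrib_right u(1,2))
    then show "2 *\<^sub>R (u * h) = u * u + 1" by simp
    from * have "2 *\<^sub>R (u * h) = 2 *\<^sub>R (h * u)" by simp
    then show "u * h = h * u" by simp
  qed
  have "norm (peval R u) \<le> (\<Sum>i\<le>degree R. S)"
    unfolding peval_conv_sum
  proof (rule sum_norm_le)
    show "norm (coeff R i *\<^sub>R u ^ i) \<le> S" for i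
      using mult_mono[OF coeff_R[of i] norm_unitary_power_le[OF u(1), of i]] S0 by simp
  qed
  also have "\<dots> \<le> (2 * real D + 1) * S"
    using \<open>degree R \<le> 2 * D\<close> S0 by (simp add: mult_right_mono)
  finally have RS: "norm (peval R u) \<le> (2 * real D + 1) * S" .
  have uD: "(u\<^sup>\<star>) ^ D * u ^ D = 1"
    using commuting_power_mult[of "u\<^sup>\<star>" u D] u(1,2) by simp
  have "peval p h = (u\<^sup>\<star>) ^ D * (u ^ D * peval p h)"
    by (simp add: mult.assoc[symmetric] uD)
  also have "\<dots> = (u\<^sup>\<star>) ^ D * peval R u"
    by (simp add: R[OF hu])
  finally have "norm (peval p h) \<le> norm ((u\<^sup>\<star>) ^ D) * norm (peval R u)"
    by (metis norm_mult_ineq)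
  also have "\<dots> \<le> 1 * norm (peval R u)"
    using norm_unitary_power_le[of "u\<^sup>\<star>" D] u(2) by (intro mult_right_mono) (simp_all add: star_star)
  finally show ?thesis
    using RS by (simp add: D_def)
qed

lemma le_of_power2_power_le:
  fixes x S c :: real
  assumes x: "0 \<le> x" and S: "0 \<le> S" and c: "0 \<le> c"
    and le: "\<And>n. x ^ (2 ^ n) \<le> (c * 2 ^ n + 1) * S ^ (2 ^ n)"
  shows "x \<le> S"
proof (rule ccontr)
  assume "\<not> x \<le> S"
  then have "S < x" by simp
  show False
  proof (cases "S = 0")
    case True
    then show False
      using le[of 0] \<open>S < x\<close> by simp
  next
    case False
    define \<rho> where "\<rho> = x / S"
    have \<rho>: "1 < \<rho>"
      using \<open>S < x\<close> False S by (simp add: \<rho>_def)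
    have rle: "\<rho> ^ (2 ^ n) \<le> c * 2 ^ n + 1" for n
      using le[of n] False S by (simp add: \<rho>_def power_divide field_simps)
    define m where "m n = (2::nat) ^ n" for n
    have m: "filterlim m at_top sequentially"
      unfolding m_def by (rule filterlim_subseq) (simp add: strict_monoI_Suc)
    have "(\<lambda>k. real k / \<rho> ^ k) \<longlonglongrightarrow> 0"
      using powser_times_n_limit_0[of "1/\<rho>"] \<rho> by (simp add: power_divide)
    moreover have "(\<lambda>k. 1 / \<rho> ^ k) \<longlonglongrightarrow> 0"
      using LIMSEQ_power_zero[of "1/\<rho>"] \<rho> by (simp add: power_divide)
    ultimately have "(\<lambda>k. c * (real k / \<rho> ^ k) + 1 / \<rho> ^ k) \<longlonglongrightarrow> c * 0 + 0"
      by (intro tendsto_intros)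
    from filterlim_compose[OF this m]
    have "(\<lambda>n. c * (real (m n) / \<rho> ^ m n) + 1 / \<rho> ^ m n) \<longlonglongrightarrow> 0" by simp
    then have "\<forall>\<^sub>F n in sequentially. c * (real (m n) / \<rho> ^ m n) + 1 / \<rho> ^ m n < 1"
      by (rule order_tendstoD) simp
    then obtain n where "c * (real (m n) / \<rho> ^ m n) + 1 / \<rho> ^ m n < 1"
      by (auto simp: eventually_sequentially)
    then have "(c * real (m n) + 1) / \<rho> ^ m n < 1"
      by (simp add: add_divide_distrib)
    then have "c * real (m n) + 1 < \<rho> ^ m n"
      using \<rho> by (simp add: divide_less_eq)
    then show False
      using rle[of n] by (simp add: m_def)
  qed
qed

text \<open>The factor in \<open>norm_peval_le_degree\<close> grows linearly with the degree, hence the bound for \<open>p\<^bsup>2\<^sup>n\<^esup>\<close> loses only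
  a factor of order \<open>2\<^sup>n\<close>, whose \<open>2\<^sup>n\<close>-th root tends to 1. The boundary case of norm exactly 1
  follows by continuity from \<open>r h\<close> with \<open>r < 1\<close>.\<close>

lemma norm_peval_le:
  fixes h :: "'a::{cstar_algebra,monoid_mult}"
  assumes h: "h\<^sup>\<star> = h" and le: "norm h \<le> 1"
    and S: "\<And>t. t \<in> {-1..1} \<Longrightarrow> \<bar>poly p t\<bar> \<le> S"
  shows "norm (peval p h) \<le> S"
proof -
  have S0: "0 \<le> S"
    using S[of 0] by simp
  have strict: "norm (peval p k) \<le> S" if k: "k\<^sup>\<star> = k" "norm k < 1" for k :: 'a
  proof (rule le_of_power2_power_le)
    fix n :: nat
    have "norm (peval p k) ^ (2 ^ n) = norm (peval (p ^ (2 ^ n)) k)"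
      by (simp add: selfadjoint_power2_power star_peval k)
    also have "\<dots> \<le> (2 * real (degree (p ^ (2 ^ n))) + 1) * S ^ (2 ^ n)"
      using S by (intro norm_peval_le_degree k) (simp add: power_mono power_abs)
    also have "\<dots> \<le> (2 * real (degree p) * 2 ^ n + 1) * S ^ (2 ^ n)"
    proof (rule mult_right_mono)
      have "real (degree (p ^ (2 ^ n))) \<le> real (degree p * 2 ^ n)"
        by (simp only: of_nat_le_iff degree_power_le)
      then show "2 * real (degree (p ^ (2 ^ n))) + 1 \<le> 2 * real (degree p) * 2 ^ n + 1"
        by simp
    qed (simp add: S0)
    finally show "norm (peval p k) ^ (2 ^ n) \<le> (2 * real (degree p) * 2 ^ n + 1) * S ^ (2 ^ n)" .
  qed (simp_all add: S0)
  have "((\<lambda>r. norm (peval p (r *\<^sub>R h))) \<longlongrightarrow> norm (peval p (1 *\<^sub>R h))) (at_left 1)"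
    using isCont_peval_scaleR[of 1 p h]
    by (intro tendsto_norm) (simp add: isCont_def filterlim_at_split)
  moreover have "\<forall>\<^sub>F r in at_left 1. norm (peval p (r *\<^sub>R h)) \<le> S"
    using eventually_at_left_real[of 0 "1::real", simplified]
  proof eventually_elim
    case (elim r)
    have "norm (r *\<^sub>R h) \<le> r"
      using elim le by (simp add: mult_left_le)
    then have "norm (r *\<^sub>R h) < 1"
      using elim by linarith
    then show ?case
      by (intro strict) (simp_all add: star_scaleR h)
  qed
  ultimately show ?thesis
    using tendsto_upperbound by fastforce
qed

lemma continuous_approx_by_poly:
  fixes f :: "real \<Rightarrow> real"
  assumes "continuous_on {-1..1} f" "0 < e"
  shows "\<exists>p. \<forall>t\<in>{-1..1}. \<bar>poly p t - f t\<bar> \<le> e"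
proof -
  obtain g where g: "real_polynomial_function g" "\<And>t. t \<in> {-1..1} \<Longrightarrow> \<bar>f t - g t\<bar> < e"
    by (rule Stone_Weierstrass_real_polynomial_function[OF compact_Icc assms]) (rule that; blast)
  obtain a n where "g = (\<lambda>t. \<Sum>i\<le>n. a i * t ^ i)"
    using g(1) by (auto simp: real_polynomial_function_iff_sum)
  then have "poly (\<Sum>i\<le>n. monom (a i) i) t = g t" for t
    by (simp add: poly_sum poly_monom)
  then show ?thesis
    using g(2) by (intro exI[of _ "\<Sum>i\<le>n. monom (a i) i"] ballI) (metis abs_minus_commute less_imp_le)
qed

lemma continuous_approx_by_poly_sequence:
  fixes f :: "real \<Rightarrow> real"
  assumes f: "continuous_on {-1..1} f"
  shows "\<exists>P. \<forall>n. \<forall>t\<in>{-1..1}. \<bar>poly (P n) t - f t\<bar> \<le> inverse (real (Suc n))"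
proof (intro choice allI)
  show "\<exists>p. \<forall>t\<in>{-1..1}. \<bar>poly p t - f t\<bar> \<le> inverse (real (Suc n))" for n
    by (rule continuous_approx_by_poly[OF f]) simp
qed

text \<open>The element \<open>f(h)\<close>, for \<open>h\<close> self-adjoint of norm at most 1 and \<open>f\<close> continuous on \<open>[-1, 1]\<close>,
  pinned down by uniform approximation with polynomials.\<close>

definition cfc :: "'a::{cstar_algebra,monoid_mult} \<Rightarrow> (real \<Rightarrow> real) \<Rightarrow> 'a"
  where "cfc h f = (SOME y. \<forall>e>0. \<exists>p. (\<forall>t\<in>{-1..1}. \<bar>poly p t - f t\<bar> \<le> e) \<and> norm (peval p h - y) \<le> e)"

context
  fixes h :: "'a::{cstar_algebra,monoid_mult}"
  assumes h: "h\<^sup>\<star> = h" and norm_h: "norm h \<le> 1"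
begin

lemma norm_peval_diff_le:
  assumes "\<And>t. t \<in> {-1..1} \<Longrightarrow> \<bar>poly p t - poly q t\<bar> \<le> e"
  shows "norm (peval p h - peval q h) \<le> e"
  using norm_peval_le[OF h norm_h, of "p - q" e] assms by simp

lemma cfc_limit:
  assumes f: "continuous_on {-1..1} f"
  shows "\<forall>e>0. \<exists>p. (\<forall>t\<in>{-1..1}. \<bar>poly p t - f t\<bar> \<le> e) \<and> norm (peval p h - cfc h f) \<le> e"
  unfolding cfc_def
proof (rule someI_ex)
  obtain P where P: "\<And>n t. t \<in> {-1..1} \<Longrightarrow> \<bar>poly (P n) t - f t\<bar> \<le> inverse (real (Suc n))"
    using continuous_approx_by_poly_sequence[OF f] by metis
  have inv: "\<exists>n0. \<forall>n\<ge>n0. inverse (real (Suc n)) \<le> e" if "0 < e" for e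
    using order_tendstoD(2)[OF LIMSEQ_inverse_real_of_nat that]
    by (auto simp: eventually_sequentially intro: less_imp_le)
  have "Cauchy (\<lambda>n. peval (P n) h)"
  proof (rule metric_CauchyI)
    fix e :: real
    assume "0 < e"
    then obtain n0 where n0: "\<forall>n\<ge>n0. inverse (real (Suc n)) \<le> e / 3"
      using inv[of "e/3"] by auto
    have "dist (peval (P m) h) (peval (P n) h) < e" if "m \<ge> n0" "n \<ge> n0" for m n
    proof -
      have "norm (peval (P m) h - peval (P n) h) \<le> e / 3 + e / 3"
      proof (rule norm_peval_diff_le)
        fix t :: real
        assume "t \<in> {-1..1}"
        then have "\<bar>poly (P m) t - f t\<bar> \<le> e / 3" "\<bar>poly (P n) t - f t\<bar> \<le> e / 3"
          using P n0 that order_trans by blast+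
        then show "\<bar>poly (P m) t - poly (P n) t\<bar> \<le> e / 3 + e / 3" by linarith
      qed
      then show ?thesis
        using \<open>0 < e\<close> by (simp add: dist_norm)
    qed
    then show "\<exists>M. \<forall>m\<ge>M. \<forall>n\<ge>M. dist (peval (P m) h) (peval (P n) h) < e" by blast
  qed
  then obtain y where y: "(\<lambda>n. peval (P n) h) \<longlonglongrightarrow> y"
    using Cauchy_convergent convergent_def by blast
  show "\<exists>y. \<forall>e>0. \<exists>p. (\<forall>t\<in>{-1..1}. \<bar>poly p t - f t\<bar> \<le> e) \<and> norm (peval p h - y) \<le> e"
  proof (rule exI[of _ y], intro allI impI)
    fix e :: real
    assume "0 < e"
    obtain n1 where n1: "\<forall>n\<ge>n1. inverse (real (Suc n)) \<le> e"
      using inv[OF \<open>0 < e\<close>] by auto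
    obtain n2 where n2: "\<forall>n\<ge>n2. norm (peval (P n) h - y) < e"
      using LIMSEQ_D[OF y \<open>0 < e\<close>] by blast
    have "(\<forall>t\<in>{-1..1}. \<bar>poly (P (max n1 n2)) t - f t\<bar> \<le> e) \<and> norm (peval (P (max n1 n2)) h - y) \<le> e"
      using P[of _ "max n1 n2"] n1 n2 by (meson less_imp_le max.cobounded1 max.cobounded2 order_trans)
    then show "\<exists>p. (\<forall>t\<in>{-1..1}. \<bar>poly p t - f t\<bar> \<le> e) \<and> norm (peval p h - y) \<le> e" ..
  qed
qed

lemma norm_peval_cfc_le:
  assumes f: "continuous_on {-1..1} f" and p: "\<And>t. t \<in> {-1..1} \<Longrightarrow> \<bar>poly p t - f t\<bar> \<le> e"
  shows "norm (peval p h - cfc h f) \<le> e"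
proof (rule field_le_epsilon)
  fix d :: real
  assume "0 < d"
  then obtain q where q: "\<And>t. t \<in> {-1..1} \<Longrightarrow> \<bar>poly q t - f t\<bar> \<le> d / 2" "norm (peval q h - cfc h f) \<le> d / 2"
    using cfc_limit[OF f] by (meson half_gt_zero)
  have "norm (peval p h - peval q h) \<le> e + d / 2"
    using p q(1) by (intro norm_peval_diff_le) (smt (verit))
  then show "norm (peval p h - cfc h f) \<le> e + d"
    using q(2) norm_triangle_ineq[of "peval p h - peval q h" "peval q h - cfc h f"] by simp
qed

lemma cfc_eq_lim:
  assumes f: "continuous_on {-1..1} f"
  obtains P where "uniform_limit {-1..1} (\<lambda>n t. poly (P n) t) f sequentially"
    "(\<lambda>n. peval (P n) h) \<longlonglongrightarrow> cfc h f"
proof -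
  obtain P where P: "\<And>n t. t \<in> {-1..1} \<Longrightarrow> \<bar>poly (P n) t - f t\<bar> \<le> inverse (real (Suc n))"
    using continuous_approx_by_poly_sequence[OF f] by metis
  show ?thesis
  proof (rule that)
    show "uniform_limit {-1..1} (\<lambda>n t. poly (P n) t) f sequentially"
    proof (rule uniform_limitI)
      fix e :: real
      assume "0 < e"
      then have "\<forall>\<^sub>F n in sequentially. inverse (real (Suc n)) < e"
        using LIMSEQ_inverse_real_of_nat order_tendstoD(2) by blast
      then show "\<forall>\<^sub>F n in sequentially. \<forall>t\<in>{-1..1}. dist (poly (P n) t) (f t) < e"
      proof eventually_elim
        case (elim n)
        then show ?case
          using P[of _ n] unfolding dist_real_def by (meson le_less_trans)
      qed
    qed
    show "(\<lambda>n. peval (P n) h) \<longlonglongrightarrow> cfc h f"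
      by (rule LIM_zero_cancel, rule Lim_null_comparison[OF _ LIMSEQ_inverse_real_of_nat])
        (use norm_peval_cfc_le[OF f P] in simp)
  qed
qed

text \<open>Every sequence of polynomials converging uniformly to \<open>f\<close> computes the same element; the rules for sums and products under
  \<open>cfc\<close> follow by combining approximating sequences.\<close>

lemma cfc_unique:
  assumes f: "continuous_on {-1..1} f"
    and P: "uniform_limit {-1..1} (\<lambda>n t. poly (P n) t) f sequentially"
    and lim: "(\<lambda>n. peval (P n) h) \<longlonglongrightarrow> y"
  shows "cfc h f = y"
proof -
  have "(\<lambda>n. peval (P n) h) \<longlonglongrightarrow> cfc h f"
  proof (rule tendstoI)
    fix e :: real
    assume "0 < e"
    with uniform_limitD[OF P, of "e/2"]
    have "\<forall>\<^sub>F n in sequentially. \<forall>t\<in>{-1..1}. dist (poly (P n) t) (f t) < e/2" by simp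
    then show "\<forall>\<^sub>F n in sequentially. dist (peval (P n) h) (cfc h f) < e"
    proof eventually_elim
      case (elim n)
      then have "norm (peval (P n) h - cfc h f) \<le> e/2"
        by (intro norm_peval_cfc_le f) (force simp: dist_real_def)
      then show ?case
        using \<open>0 < e\<close> by (simp add: dist_norm)
    qed
  qed
  then show ?thesis
    using lim LIMSEQ_unique by blast
qed

lemma cfc_poly: "cfc h (poly p) = peval p h"
  by (rule cfc_unique[where P = "\<lambda>_. p"])
    (auto intro!: continuous_intros uniform_limit_const)

lemma cfc_id: "cfc h (\<lambda>t. t) = h"
proof -
  have "poly [:0,1:] = (\<lambda>t::real. t)" by (simp add: fun_eq_iff)
  then show ?thesis using cfc_poly[of "[:0,1:]"] by simp
qed

lemma cfc_const: "cfc h (\<lambda>t. c) = c *\<^sub>R 1"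
proof -
  have "poly [:c:] = (\<lambda>t::real. c)" by (simp add: fun_eq_iff)
  then show ?thesis using cfc_poly[of "[:c:]"] by simp
qed

lemma cfc_add:
  assumes f: "continuous_on {-1..1} f" and g: "continuous_on {-1..1} g"
  shows "cfc h (\<lambda>t. f t + g t) = cfc h f + cfc h g"
proof -
  obtain P where P: "uniform_limit {-1..1} (\<lambda>n t. poly (P n) t) f sequentially"
    "(\<lambda>n. peval (P n) h) \<longlonglongrightarrow> cfc h f" using cfc_eq_lim[OF f] .
  obtain Q where Q: "uniform_limit {-1..1} (\<lambda>n t. poly (Q n) t) g sequentially"
    "(\<lambda>n. peval (Q n) h) \<longlonglongrightarrow> cfc h g" using cfc_eq_lim[OF g] .
  show ?thesis
    using uniform_limit_add[OF P(1) Q(1)] tendsto_add[OF P(2) Q(2)]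
    by (intro cfc_unique[where P = "\<lambda>n. P n + Q n"] continuous_intros f g) simp_all
qed

lemma cfc_mult:
  assumes f: "continuous_on {-1..1} f" and g: "continuous_on {-1..1} g"
  shows "cfc h (\<lambda>t. f t * g t) = cfc h f * cfc h g"
proof -
  obtain P where P: "uniform_limit {-1..1} (\<lambda>n t. poly (P n) t) f sequentially"
    "(\<lambda>n. peval (P n) h) \<longlonglongrightarrow> cfc h f" using cfc_eq_lim[OF f] .
  obtain Q where Q: "uniform_limit {-1..1} (\<lambda>n t. poly (Q n) t) g sequentially"
    "(\<lambda>n. peval (Q n) h) \<longlonglongrightarrow> cfc h g" using cfc_eq_lim[OF g] .
  have "bounded (f ` {-1..1})" "bounded (g ` {-1..1})"
    using f g by (auto intro: compact_imp_bounded compact_continuous_image)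
  then have "uniform_limit {-1..1} (\<lambda>n t. poly (P n) t * poly (Q n) t) (\<lambda>t. f t * g t) sequentially"
    using P(1) Q(1) by (intro bounded_bilinear.bounded_uniform_limit[OF bounded_bilinear_mult])
  then show ?thesis
    using tendsto_mult[OF P(2) Q(2)]
    by (intro cfc_unique[where P = "\<lambda>n. P n * Q n"] continuous_intros f g) simp_all
qed

lemma cfc_scale:
  assumes "continuous_on {-1..1} f"
  shows "cfc h (\<lambda>t. c * f t) = c *\<^sub>R cfc h f"
  using cfc_mult[OF continuous_on_const assms, of c] by (simp add: cfc_const)

lemma cfc_diff:
  assumes f: "continuous_on {-1..1} f" and g: "continuous_on {-1..1} g"
  shows "cfc h (\<lambda>t. f t - g t) = cfc h f - cfc h g"
  using cfc_add[OF f continuous_on_mult[OF continuous_on_const g], of "-1"] cfc_scale[OF g, of "-1"] by simp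

lemma cfc_power:
  assumes f: "continuous_on {-1..1} f"
  shows "cfc h (\<lambda>t. f t ^ n) = cfc h f ^ n"
proof (induction n)
  case 0
  show ?case using cfc_const[of 1] by simp
next
  case (Suc n)
  then show ?case
    using cfc_mult[OF f continuous_on_power[OF f], of n] by simp
qed

lemma cfc_sum:
  assumes "\<And>i. i \<in> I \<Longrightarrow> continuous_on {-1..1} (f i)"
  shows "cfc h (\<lambda>t. \<Sum>i\<in>I. f i t) = (\<Sum>i\<in>I. cfc h (f i))"
  using assms
proof (induction I rule: infinite_finite_induct)
  case (insert i I)
  then show ?case
    using cfc_add[of "f i" "\<lambda>t. \<Sum>i\<in>I. f i t"] by (simp add: continuous_on_sum)
qed (use cfc_const[of 0] in simp_all)

lemma norm_cfc_le:
  assumes f: "continuous_on {-1..1} f" and S: "\<And>t. t \<in> {-1..1} \<Longrightarrow> \<bar>f t\<bar> \<le> S"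
  shows "norm (cfc h f) \<le> S"
proof (rule field_le_epsilon)
  fix d :: real
  assume "0 < d"
  then obtain q where q: "\<And>t. t \<in> {-1..1} \<Longrightarrow> \<bar>poly q t - f t\<bar> \<le> d / 2" "norm (peval q h - cfc h f) \<le> d / 2"
    using cfc_limit[OF f] by (meson half_gt_zero)
  have "norm (peval q h) \<le> S + d / 2"
    using q(1) S by (intro norm_peval_le h norm_h) (smt (verit))
  then show "norm (cfc h f) \<le> S + d"
    using q(2) norm_triangle_sub[of "cfc h f" "peval q h"] by (simp add: norm_minus_commute)
qed

lemma cfc_cong:
  assumes f: "continuous_on {-1..1} f" and eq: "\<And>t. t \<in> {-1..1} \<Longrightarrow> f t = g t"
  shows "cfc h f = cfc h g"
proof -
  have g: "continuous_on {-1..1} g"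
    using continuous_on_cong[of "{-1..1}" "{-1..1}" f g] f eq by simp
  have "norm (cfc h (\<lambda>t. f t - g t)) \<le> 0"
    using f g eq by (intro norm_cfc_le continuous_intros) simp_all
  then show ?thesis
    by (simp add: cfc_diff f g)
qed

lemma star_cfc:
  assumes f: "continuous_on {-1..1} f"
  shows "(cfc h f)\<^sup>\<star> = cfc h f"
proof -
  obtain P where P: "(\<lambda>n. peval (P n) h) \<longlonglongrightarrow> cfc h f" using cfc_eq_lim[OF f] .
  from bounded_linear.tendsto[OF bounded_linear_star this]
  have "(\<lambda>n. peval (P n) h) \<longlonglongrightarrow> (cfc h f)\<^sup>\<star>" by (simp add: star_peval h)
  then show ?thesis
    using P LIMSEQ_unique by blast
qed

end

section \<open>Positivity\<close>

text \<open>For self-adjoint elements this is positivity: the spectrum lies in \<open>[0, 2t]\<close>. In this form closure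
  under sums is the triangle inequality, and squares qualify by functional calculus.\<close>

definition nonneg :: "'a::{cstar_algebra,monoid_mult} \<Rightarrow> bool"
  where "nonneg b \<longleftrightarrow> (\<exists>t>0. norm (t *\<^sub>R 1 - b) \<le> t)"

lemma nonneg_add:
  assumes "nonneg a" "nonneg b"
  shows "nonneg (a + b)"
proof -
  obtain s t where "0 < s" "norm (s *\<^sub>R 1 - a) \<le> s" "0 < t" "norm (t *\<^sub>R 1 - b) \<le> t"
    using assms by (auto simp: nonneg_def)
  moreover have "(s + t) *\<^sub>R 1 - (a + b) = (s *\<^sub>R 1 - a) + (t *\<^sub>R 1 - b)"
    by (simp add: algebra_simps)
  ultimately show ?thesis
    unfolding nonneg_def by (intro exI[of _ "s + t"]) (metis add_mono add_pos_pos norm_triangle_mono)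
qed

lemma nonneg_zero: "nonneg 0"
  using norm_one_le by (auto simp: nonneg_def intro!: exI[of _ 1])

lemma nonneg_sum: "(\<And>i. i \<in> I \<Longrightarrow> nonneg (f i)) \<Longrightarrow> nonneg (sum f I)"
  by (induction I rule: infinite_finite_induct) (simp_all add: nonneg_zero nonneg_add)

lemma nonneg_scaleR:
  assumes "0 < r" "nonneg a"
  shows "nonneg (r *\<^sub>R a)"
proof -
  obtain t where "0 < t" "norm (t *\<^sub>R 1 - a) \<le> t"
    using assms by (auto simp: nonneg_def)
  moreover have "(r * t) *\<^sub>R 1 - r *\<^sub>R a = r *\<^sub>R (t *\<^sub>R 1 - a)"
    by (simp add: algebra_simps)
  ultimately show ?thesis
    unfolding nonneg_def using assms(1) by (intro exI[of _ "r * t"]) simp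
qed

lemma nonneg_selfadjoint_square:
  assumes k: "k\<^sup>\<star> = k"
  shows "nonneg (k * k)"
proof -
  define r where "r = norm k + 1"
  have r: "0 < r" by (simp add: r_def add_nonneg_pos)
  define h where "h = inverse r *\<^sub>R k"
  have h: "h\<^sup>\<star> = h" "norm h \<le> 1"
    using r k by (simp_all add: h_def star_scaleR) (simp add: r_def field_simps)
  have "norm (peval [:1, 0, -1:] h) \<le> 1"
  proof (rule norm_peval_le[OF h])
    fix t :: real
    assume "t \<in> {-1..1}"
    then have "t * t \<le> 1" by (simp add: abs_le_iff abs_square_le_1 power2_eq_square[symmetric])
    moreover have "0 \<le> t * t" by simp
    ultimately show "\<bar>poly [:1, 0, -1:] t\<bar> \<le> 1" by simp
  qed
  moreover have "r\<^sup>2 *\<^sub>R 1 - k * k = r\<^sup>2 *\<^sub>R peval [:1, 0, -1:] h"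
    using r by (simp add: h_def algebra_simps power2_eq_square)
  ultimately have "norm (r\<^sup>2 *\<^sub>R 1 - k * k) \<le> r\<^sup>2"
    using r by (simp add: mult_left_le)
  then show ?thesis
    unfolding nonneg_def using r by (intro exI[of _ "r\<^sup>2"]) simp
qed

text \<open>The upper bounds of the functional calculus yield a lower bound: \<open>l\<^sup>2 = f(l) (c + l\<^sup>2)\<close> with
  \<open>f(s) = s\<^sup>2 / (c + s\<^sup>2)\<close>, and for \<open>l\<close> of norm 1 the norm of \<open>f(l)\<close> is at most \<open>1 / (c + 1)\<close>.\<close>

lemma norm_add_selfadjoint_square_ge:
  fixes l :: "'a::{cstar_algebra,monoid_mult}"
  assumes l: "l\<^sup>\<star> = l" "l \<noteq> 0" and c: "0 < c"
  shows "c + norm (l * l) \<le> norm (c *\<^sub>R 1 + l * l)"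
proof -
  have unit: "d + 1 \<le> norm (d *\<^sub>R 1 + k * k)"
    if k: "k\<^sup>\<star> = k" "norm k = 1" and d: "0 < d" for k :: 'a and d
  proof -
    define f where "f s = s * s / (d + s * s)" for s :: real
    have pos: "0 < d + s * s" for s :: real
      using d by (simp add: add_pos_nonneg)
    have nz: "d + s * s \<noteq> 0" for s :: real
      using pos[of s] by linarith
    have f: "continuous_on {-1..1} f"
      unfolding f_def by (intro continuous_intros ballI nz)
    have g: "continuous_on {-1..1} (\<lambda>s::real. d + s * s)"
      by (intro continuous_intros)
    have k': "norm k \<le> 1" using k by simp
    note K = k(1) k'
    have kk: "cfc k (\<lambda>s. s * s) = k * k"
      using cfc_mult[OF K, of "\<lambda>t. t" "\<lambda>t. t"] by (simp add: cfc_id[OF K] continuous_on_id)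
    have "cfc k (\<lambda>s. d + s * s) = d *\<^sub>R 1 + k * k"
      by (subst cfc_add[OF K]) (auto intro!: continuous_intros simp: kk cfc_const[OF K])
    moreover have "cfc k (\<lambda>s. f s * (d + s * s)) = k * k"
      unfolding kk[symmetric] by (rule cfc_cong[OF K]) (auto intro!: continuous_intros f simp: f_def nz)
    ultimately have "k * k = cfc k f * (d *\<^sub>R 1 + k * k)"
      using cfc_mult[OF K f g] by simp
    then have "norm (k * k) \<le> norm (cfc k f) * norm (d *\<^sub>R 1 + k * k)"
      by (metis norm_mult_ineq)
    also have "norm (cfc k f) \<le> 1 / (d + 1)"
    proof (rule norm_cfc_le[OF K f])
      fix t :: real
      assume "t \<in> {-1..1}"
      then have "t * t \<le> 1" by (simp add: abs_le_iff abs_square_le_1 power2_eq_square[symmetric])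
      then have "f t \<le> 1 / (d + 1)"
        using pos[of t] d by (simp add: f_def field_simps)
      moreover have "0 \<le> f t"
        using pos[of t] by (simp add: f_def)
      ultimately show "\<bar>f t\<bar> \<le> 1 / (d + 1)" by simp
    qed
    finally have "1 \<le> 1 / (d + 1) * norm (d *\<^sub>R 1 + k * k)"
      using norm_selfadjoint_square[OF k(1)] k(2) by (simp add: mult_right_mono)
    then show ?thesis
      using d by (simp add: field_simps)
  qed
  define N where "N = norm l"
  have N: "0 < N" using l by (simp add: N_def)
  define k where "k = inverse N *\<^sub>R l"
  have "k\<^sup>\<star> = k" "norm k = 1"
    using N by (simp_all add: k_def star_scaleR l) (simp add: N_def)
  moreover have "0 < c / N\<^sup>2" using c N by simp
  ultimately have "c / N\<^sup>2 + 1 \<le> norm ((c / N\<^sup>2) *\<^sub>R 1 + k * k)"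
    by (rule unit)
  then have "N\<^sup>2 * (c / N\<^sup>2 + 1) \<le> norm (N\<^sup>2 *\<^sub>R ((c / N\<^sup>2) *\<^sub>R 1 + k * k))"
    using N by (simp add: mult_left_mono)
  also have "N\<^sup>2 *\<^sub>R ((c / N\<^sup>2) *\<^sub>R 1 + k * k) = c *\<^sub>R 1 + l * l"
  proof -
    have "N * N * (inverse N * inverse N) = 1" using N by (simp add: field_simps)
    then show ?thesis
      using N by (simp add: k_def scaleR_add_right power2_eq_square)
  qed
  finally show ?thesis
    using N norm_selfadjoint_square[OF l(1)] by (simp add: distrib_left N_def)
qed

text \<open>Writing \<open>t + l\<^sup>2 = (l\<^sup>2 + b) + (t - b)\<close> with \<open>t\<close> taken from \<open>nonneg b\<close>, the term \<open>t\<close> cancels between the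
  lower bound above and the triangle inequality.\<close>

lemma norm_selfadjoint_square_le_add:
  assumes l: "l\<^sup>\<star> = l" and b: "nonneg b"
  shows "norm (l * l) \<le> norm (l * l + b)"
proof (cases "l = 0")
  case False
  obtain t where t: "0 < t" "norm (t *\<^sub>R 1 - b) \<le> t"
    using b by (auto simp: nonneg_def)
  have "t + norm (l * l) \<le> norm (t *\<^sub>R 1 + l * l)"
    by (rule norm_add_selfadjoint_square_ge[OF l False t(1)])
  also have "t *\<^sub>R 1 + l * l = (l * l + b) + (t *\<^sub>R 1 - b)" by simp
  also have "norm \<dots> \<le> norm (l * l + b) + t"
    using t(2) norm_triangle_ineq[of "l * l + b" "t *\<^sub>R 1 - b"] by simp
  finally show ?thesis by simp
qed simp

text \<open>Let \<open>x = y\<^sup>\<star>y\<close> and let \<open>w = y g(x)\<close>, where \<open>g\<close> is the negative part. Then \<open>w\<^sup>\<star>w = -p\<close> with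
  \<open>p = g(x)\<^sup>3\<close> positive. Up to a positive factor \<open>w\<^sup>\<star>w + ww\<^sup>\<star>\<close> is a sum of squares of self-adjoint elements, and \<open>q = ww\<^sup>\<star>\<close>, which
  exceeds it by \<open>p\<close>, is positive as well. In terms of spectra this is absurd unless \<open>p = 0\<close>, because \<open>w\<^sup>\<star>w\<close> and \<open>ww\<^sup>\<star>\<close> have the same nonzero
  spectrum. Instead of spectra, the proof uses the intertwining relation \<open>(t - q)w = w(t + p)\<close>: it gives
  \<open>wp = (t - q)\<^sup>n w p (t + p)\<^bsup>-n\<^esup>\<close>, where \<open>t - q\<close> has norm at most \<open>t\<close> while
  \<open>t\<^sup>n p (t + p)\<^bsup>-n\<^esup>\<close> tends to 0. So \<open>p = 0\<close>, the negative part of \<open>x\<close> vanishes, and \<open>x\<close> is the square of the root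
  of its positive part.\<close>

lemma star_mult_self_eq_square:
  fixes y :: "'a::{cstar_algebra,monoid_mult}"
  obtains l where "l\<^sup>\<star> = l" "y\<^sup>\<star> * y = l * l"
proof -
  have contr: "\<exists>l. l\<^sup>\<star> = l \<and> y\<^sup>\<star> * y = l * l" if y: "norm y \<le> 1" for y :: 'a
  proof -
    define x where "x = y\<^sup>\<star> * y"
    have xs: "x\<^sup>\<star> = x" by (simp add: x_def star_mult star_star)
    have xn: "norm x \<le> 1"
      using cstar_identity[of y] y by (simp add: x_def power_le_one)
    note X = xs xn
    define g where "g s = max (- s) 0" for s :: real
    define P where "P s = g s ^ 3" for s
    have g: "continuous_on {-1..1} g"
      unfolding g_def by (intro continuous_intros)
    have P: "continuous_on {-1..1} P"
      unfolding P_def by (intro continuous_intros g)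
    have P01: "0 \<le> P s" "s \<in> {-1..1} \<Longrightarrow> P s \<le> 1" for s
      by (auto simp: P_def g_def intro!: power_le_one)
    define p where "p = cfc x P"
    have ps: "p\<^sup>\<star> = p"
      unfolding p_def by (rule star_cfc[OF X P])
    define w where "w = y * cfc x g"
    have "w\<^sup>\<star> * w = cfc x g * x * cfc x g"
      using star_cfc[OF X g] by (simp add: w_def star_mult mult.assoc flip: x_def) (simp add: x_def mult.assoc)
    also have "\<dots> = cfc x (\<lambda>s. g s * s * g s)"
      using cfc_mult[OF X continuous_on_mult[OF g continuous_on_id] g] cfc_mult[OF X g continuous_on_id]
      by (simp add: cfc_id[OF X])
    also have "\<dots> = cfc x (\<lambda>s. (-1) * P s)"
    proof (rule cfc_cong[OF X])
      show "continuous_on {-1..1} (\<lambda>s. g s * s * g s)" by (intro continuous_intros g)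
    qed (simp add: g_def P_def max_def power3_eq_cube)
    also have "\<dots> = - p"
      by (subst cfc_scale[OF X P]) (simp add: p_def)
    finally have ww: "w\<^sup>\<star> * w = - p" .
    define q where "q = w * w\<^sup>\<star>"
    define c where "c = w + w\<^sup>\<star>"
    define d where "d = \<i> *\<^sub>C (w - w\<^sup>\<star>)"
    have cs: "c\<^sup>\<star> = c"
      by (simp add: c_def star_add star_star add.commute)
    have ds: "d\<^sup>\<star> = d"
      by (simp add: d_def star_scaleC star_diff star_star scaleC_minus_left scaleC_diff_right)
    have dd: "d * d = - ((w - w\<^sup>\<star>) * (w - w\<^sup>\<star>))"
      by (simp add: d_def mult_scaleC_left mult_scaleC_right scaleC_scaleC scaleC_minus_left)
    have "c * c + d * d = 2 *\<^sub>R (q + w\<^sup>\<star> * w)"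
      by (simp add: dd c_def q_def algebra_simps scaleR_2)
    then have qeq: "q = (1/2) *\<^sub>R (c * c + d * d) + p"
      by (simp add: ww)
    have "nonneg p"
      unfolding nonneg_def
    proof (intro exI[of _ 1] conjI)
      have "1 *\<^sub>R 1 - p = cfc x (\<lambda>s. 1 - P s)"
        using cfc_diff[OF X continuous_on_const P] by (simp add: p_def cfc_const[OF X])
      also have "norm \<dots> \<le> 1"
        using P01 by (intro norm_cfc_le[OF X] continuous_intros P) force
      finally show "norm (1 *\<^sub>R 1 - p) \<le> 1" .
    qed simp
    then have "nonneg q"
      unfolding qeq by (intro nonneg_add nonneg_scaleR nonneg_selfadjoint_square cs ds) simp_all
    then obtain t where t: "0 < t" "norm (t *\<^sub>R 1 - q) \<le> t"
      by (auto simp: nonneg_def)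
    have step: "(t *\<^sub>R 1 - q) * w = w * (t *\<^sub>R 1 + p)"
      using ww by (simp add: q_def left_diff_distrib distrib_left mult.assoc)
    have pow: "(t *\<^sub>R 1 - q) ^ n * w = w * (t *\<^sub>R 1 + p) ^ n" for n
    proof (induction n)
      case (Suc n)
      have "(t *\<^sub>R 1 - q) ^ Suc n * w = (t *\<^sub>R 1 - q) * ((t *\<^sub>R 1 - q) ^ n * w)"
        by (simp add: mult.assoc)
      also have "\<dots> = (t *\<^sub>R 1 - q) * w * (t *\<^sub>R 1 + p) ^ n"
        by (simp add: Suc mult.assoc)
      also have "\<dots> = w * (t *\<^sub>R 1 + p) ^ Suc n"
        by (simp add: step mult.assoc)
      finally show ?case .
    qed simp
    have tP: "0 < t + P s" for s
      using t(1) P01(1)[of s] by linarith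
    have tP_nz: "t + P s \<noteq> 0" for s
      using tP[of s] by linarith
    \<comment> \<open>Bernoulli's inequality bounds \<open>P / (1 + P/t)\<^sup>m\<close> by \<open>t/m\<close>.\<close>
    have bound: "norm (w * p) \<le> norm w * t / real (Suc n)" for n
    proof -
      define m where "m = Suc n"
      define j where "j s = P s / (t + P s) ^ m" for s
      have tp: "continuous_on {-1..1} (\<lambda>s. t + P s)"
        by (intro continuous_intros P)
      have j: "continuous_on {-1..1} j"
        unfolding j_def by (intro continuous_intros P ballI) (simp add: tP_nz)
      have "cfc x (\<lambda>s. t + P s) = t *\<^sub>R 1 + p"
        using cfc_add[OF X continuous_on_const P] by (simp add: cfc_const[OF X] p_def)
      then have tpm: "cfc x (\<lambda>s. (t + P s) ^ m) = (t *\<^sub>R 1 + p) ^ m"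
        using cfc_power[OF X tp] by simp
      have "p = cfc x (\<lambda>s. (t + P s) ^ m * j s)"
        unfolding p_def by (rule cfc_cong[OF X P]) (simp add: j_def tP_nz)
      also have "\<dots> = (t *\<^sub>R 1 + p) ^ m * cfc x j"
        using cfc_mult[OF X continuous_on_power[OF tp] j] tpm by simp
      finally have "w * p = (t *\<^sub>R 1 - q) ^ m * w * cfc x j"
        by (simp add: pow mult.assoc)
      also have "norm \<dots> \<le> norm ((t *\<^sub>R 1 - q) ^ m) * norm w * norm (cfc x j)"
        by (meson mult_right_mono norm_ge_zero norm_mult_ineq order_trans)
      also have "\<dots> \<le> t ^ m * norm w * (t / (real m * t ^ m))"
      proof (intro mult_mono)
        show "norm ((t *\<^sub>R 1 - q) ^ m) \<le> t ^ m"
          using norm_power_le[of "t *\<^sub>R 1 - q" m] power_mono[OF t(2)] by (meson norm_ge_zero order_trans)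
        show "norm (cfc x j) \<le> t / (real m * t ^ m)"
        proof (rule norm_cfc_le[OF X j])
          fix s :: real
          have "real m * (P s / t) \<le> (1 + P s / t) ^ m"
            using Bernoulli_inequality[of "P s / t" m] P01(1)[of s] t(1)
            by (smt (verit) divide_nonneg_pos)
          then have "real m * (P s / t) * t ^ m \<le> ((1 + P s / t) * t) ^ m"
            unfolding power_mult_distrib using t(1) by (intro mult_right_mono) simp_all
          also have "(1 + P s / t) * t = t + P s"
            using t(1) by (simp add: field_simps)
          finally have "P s * (real m * t ^ m) \<le> t * (t + P s) ^ m"
            using t(1) by (simp add: field_simps)
          then have "j s \<le> t / (real m * t ^ m)"
            using t(1) tP[of s] by (simp add: j_def divide_le_eq le_divide_eq m_def mult_ac)
          moreover have "0 \<le> j s"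
            using P01(1)[of s] tP[of s] by (simp add: j_def)
          ultimately show "\<bar>j s\<bar> \<le> t / (real m * t ^ m)" by simp
        qed
      qed (use t(1) in simp_all)
      also have "\<dots> = norm w * t / real (Suc n)"
      proof -
        have "t ^ m \<noteq> 0" using t(1) by simp
        then have "t ^ m * norm w * (t / (real m * t ^ m)) = norm w * t / real m"
          by (simp add: field_simps)
        then show ?thesis by (simp add: m_def)
      qed
      finally show ?thesis .
    qed
    have "(\<lambda>n. norm w * t * inverse (real (Suc n))) \<longlonglongrightarrow> norm w * t * 0"
      by (intro tendsto_intros LIMSEQ_inverse_real_of_nat)
    then have "norm (w * p) \<le> 0"
      using bound by (intro LIMSEQ_le_const[of _ 0 "norm (w * p)"]) (auto simp: divide_inverse)
    then have "w\<^sup>\<star> * (w * p) = 0" by simp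
    then have "p * p = 0"
      by (simp add: mult.assoc[symmetric] ww)
    then have "p = 0"
      using norm_selfadjoint_square[OF ps] by simp
    moreover have "p = cfc x g ^ 3"
      unfolding p_def P_def by (rule cfc_power[OF X g])
    ultimately have "cfc x g ^ (2 ^ 2) = 0"
      by (simp add: eval_nat_numeral)
    then have "norm (cfc x g) ^ (2 ^ 2) = 0"
      using selfadjoint_power2_power[OF star_cfc[OF X g], of 2] by simp
    then have g0: "cfc x g = 0" by simp
    define r where "r s = sqrt (max s 0)" for s
    have r: "continuous_on {-1..1} r"
      unfolding r_def by (intro continuous_intros)
    have "cfc x r * cfc x r = cfc x (\<lambda>s. r s * r s)"
      by (rule cfc_mult[OF X r r, symmetric])
    also have "\<dots> = cfc x (\<lambda>s. s + g s)"
    proof (rule cfc_cong[OF X])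
      show "continuous_on {-1..1} (\<lambda>s. r s * r s)" by (intro continuous_intros r)
    qed (simp add: r_def g_def max_def)
    also have "\<dots> = x"
      using cfc_add[OF X continuous_on_id g] by (simp add: cfc_id[OF X] g0)
    finally show ?thesis
      using star_cfc[OF X r] unfolding x_def by metis
  qed
  define N where "N = norm y + 1"
  have N: "0 < N" by (simp add: N_def add_nonneg_pos)
  have "norm (inverse N *\<^sub>R y) \<le> 1"
    using N by (simp add: N_def field_simps)
  then obtain l where l: "l\<^sup>\<star> = l" "(inverse N *\<^sub>R y)\<^sup>\<star> * (inverse N *\<^sub>R y) = l * l"
    using contr by blast
  show ?thesis
  proof (rule that)
    show "(N *\<^sub>R l)\<^sup>\<star> = N *\<^sub>R l" by (simp add: star_scaleR l)
    have "y\<^sup>\<star> * y = (N * N) *\<^sub>R ((inverse N *\<^sub>R y)\<^sup>\<star> * (inverse N *\<^sub>R y))"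
    proof -
      have "N * N * (inverse N * inverse N) = 1" using N by (simp add: field_simps)
      then show ?thesis using N by (simp add: star_scaleR)
    qed
    also have "\<dots> = (N *\<^sub>R l) * (N *\<^sub>R l)"
      unfolding l(2) by simp
    finally show "y\<^sup>\<star> * y = (N *\<^sub>R l) * (N *\<^sub>R l)" .
  qed
qed

lemma nonneg_star_mult_self: "nonneg (z\<^sup>\<star> * z)"
  by (metis nonneg_selfadjoint_square star_mult_self_eq_square)

lemma norm_star_mult_self_le_add:
  assumes "nonneg b"
  shows "norm (y\<^sup>\<star> * y) \<le> norm (y\<^sup>\<star> * y + b)"
  by (metis assms norm_selfadjoint_square_le_add star_mult_self_eq_square)

section \<open>The multiplier algebra\<close>

text \<open>A multiplier of \<open>A\<close> is an adjointable operator for the \<open>A\<close>-valued inner product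
  \<open>(a, b) \<mapsto> a\<^sup>\<star> * b\<close>.\<close>

definition adjoint_pair :: "('a::cstar_algebra \<Rightarrow>\<^sub>L 'a) \<Rightarrow> ('a \<Rightarrow>\<^sub>L 'a) \<Rightarrow> bool"
  where "adjoint_pair T S \<longleftrightarrow> (\<forall>a b. (blinfun_apply T a)\<^sup>\<star> * b = a\<^sup>\<star> * blinfun_apply S b)"

lemma cstar_left_cancel:
  fixes x y :: "'a::cstar_algebra"
  assumes "\<And>a. a\<^sup>\<star> * x = a\<^sup>\<star> * y"
  shows "x = y"
proof -
  have "(x - y)\<^sup>\<star> * (x - y) = 0"
    using assms[of "x - y"] by (simp add: right_diff_distrib)
  then show ?thesis
    using cstar_identity[of "x - y"] by simp
qed

lemma adjoint_pair_sym: "adjoint_pair T S \<Longrightarrow> adjoint_pair S T"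
  unfolding adjoint_pair_def
proof (intro allI)
  fix a b
  assume *: "\<forall>a b. (blinfun_apply T a)\<^sup>\<star> * b = a\<^sup>\<star> * blinfun_apply S b"
  have "(blinfun_apply S a)\<^sup>\<star> * b = (b\<^sup>\<star> * blinfun_apply S a)\<^sup>\<star>"
    by (simp add: star_mult star_star)
  also have "\<dots> = ((blinfun_apply T b)\<^sup>\<star> * a)\<^sup>\<star>"
    by (simp only: *)
  finally show "(blinfun_apply S a)\<^sup>\<star> * b = a\<^sup>\<star> * blinfun_apply T b"
    by (simp add: star_mult star_star)
qed

lemma adjoint_pair_unique: "adjoint_pair T S \<Longrightarrow> adjoint_pair T S' \<Longrightarrow> S = S'"
  unfolding adjoint_pair_def by (rule blinfun_eqI, rule cstar_left_cancel) simp

text \<open>This inequality becomes the \<open>C\<^sup>\<star>\<close>-identity of the multiplier algebra. It comes from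
  \<open>(Ta)\<^sup>\<star>(Ta) = a\<^sup>\<star>(STa)\<close>.\<close>

lemma adjoint_pair_norm_le:
  assumes "adjoint_pair T S"
  shows "norm T ^ 2 \<le> norm (S o\<^sub>L T)"
proof -
  have "norm T \<le> sqrt (norm (S o\<^sub>L T))"
  proof (rule norm_blinfun_bound)
    fix a
    have "(norm (blinfun_apply T a))\<^sup>2 = norm (a\<^sup>\<star> * blinfun_apply S (blinfun_apply T a))"
      using assms cstar_identity[of "blinfun_apply T a"] by (simp add: adjoint_pair_def)
    also have "\<dots> \<le> norm a * (norm (S o\<^sub>L T) * norm a)"
      using norm_mult_ineq[of "a\<^sup>\<star>" "blinfun_apply S (blinfun_apply T a)"] norm_blinfun[of "S o\<^sub>L T" a]
      by (smt (verit) blinfun_apply_blinfun_compose mult_left_mono norm_ge_zero norm_star)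
    also have "\<dots> = (sqrt (norm (S o\<^sub>L T)) * norm a)\<^sup>2"
      by (simp add: power_mult_distrib power2_eq_square)
    finally show "norm (blinfun_apply T a) \<le> sqrt (norm (S o\<^sub>L T)) * norm a"
      by (rule power2_le_imp_le) simp
  qed simp
  then show ?thesis
    by (metis norm_ge_zero power_mono real_sqrt_pow2)
qed

lemma adjoint_pair_norm_eq:
  assumes "adjoint_pair T S"
  shows "norm S = norm T"
proof -
  have le: "norm T \<le> norm S" if "adjoint_pair T S" for T S :: "'a \<Rightarrow>\<^sub>L 'a"
  proof (cases "norm T = 0")
    case False
    have "norm T * norm T \<le> norm S * norm T"
      using adjoint_pair_norm_le[OF that] norm_blinfun_compose[of S T] by (simp add: power2_eq_square)
    then show ?thesis
      using False by simp
  qed simp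
  show ?thesis
    using le[OF assms] le[OF adjoint_pair_sym[OF assms]] by simp
qed

lemma adjoint_pair_add: "adjoint_pair T S \<Longrightarrow> adjoint_pair T' S' \<Longrightarrow> adjoint_pair (T + T') (S + S')"
  by (simp add: adjoint_pair_def blinfun.add_left star_add distrib_left distrib_right)

lemma adjoint_pair_scaleR: "adjoint_pair T S \<Longrightarrow> adjoint_pair (r *\<^sub>R T) (r *\<^sub>R S)"
  by (simp add: adjoint_pair_def blinfun.scaleR_left star_scaleR)

lemma adjoint_pair_compose: "adjoint_pair T S \<Longrightarrow> adjoint_pair T' S' \<Longrightarrow> adjoint_pair (T o\<^sub>L T') (S' o\<^sub>L S)"
  by (simp add: adjoint_pair_def)

lemma adjoint_pair_id: "adjoint_pair id_blinfun id_blinfun"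
  by (simp add: adjoint_pair_def)

lemma adjoint_pair_zero: "adjoint_pair 0 0"
  by (simp add: adjoint_pair_def)

lift_definition scaleC_blinfun :: "complex \<Rightarrow> 'a::cstar_algebra \<Rightarrow>\<^sub>L 'a" is "\<lambda>c a. c *\<^sub>C a"
  by (rule bounded_linear_scaleC_right)

lemma adjoint_pair_scaleC: "adjoint_pair (scaleC_blinfun c) (scaleC_blinfun (cnj c))"
  by (simp add: adjoint_pair_def scaleC_blinfun.rep_eq star_scaleC mult_scaleC_left mult_scaleC_right)

lift_definition mult_blinfun :: "'a::cstar_algebra \<Rightarrow> 'a \<Rightarrow>\<^sub>L 'a" is "\<lambda>x a. x * a"
  by (rule bounded_linear_mult_right)

lemma adjoint_pair_mult: "adjoint_pair (mult_blinfun x) (mult_blinfun (x\<^sup>\<star>))"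
  by (simp add: adjoint_pair_def mult_blinfun.rep_eq star_mult mult.assoc)

typedef (overloaded) 'a multiplier = "{T :: 'a::cstar_algebra \<Rightarrow>\<^sub>L 'a. \<exists>S. adjoint_pair T S}"
  using adjoint_pair_id by blast

setup_lifting type_definition_multiplier

instantiation multiplier :: (cstar_algebra) real_normed_vector
begin

lift_definition norm_multiplier :: "'a multiplier \<Rightarrow> real" is norm .
lift_definition zero_multiplier :: "'a multiplier" is 0 using adjoint_pair_zero by blast
lift_definition plus_multiplier :: "'a multiplier \<Rightarrow> 'a multiplier \<Rightarrow> 'a multiplier" is "(+)"
  using adjoint_pair_add by blast
lift_definition scaleR_multiplier :: "real \<Rightarrow> 'a multiplier \<Rightarrow> 'a multiplier" is "(*\<^sub>R)"
  using adjoint_pair_scaleR by blast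
lift_definition uminus_multiplier :: "'a multiplier \<Rightarrow> 'a multiplier" is uminus
proof -
  fix T :: "'a \<Rightarrow>\<^sub>L 'a"
  assume "\<exists>S. adjoint_pair T S"
  then obtain S where "adjoint_pair ((-1) *\<^sub>R T) ((-1) *\<^sub>R S)"
    using adjoint_pair_scaleR by blast
  then show "\<exists>S. adjoint_pair (- T) S" by auto
qed
lift_definition minus_multiplier :: "'a multiplier \<Rightarrow> 'a multiplier \<Rightarrow> 'a multiplier" is "(-)"
proof -
  fix T T' :: "'a \<Rightarrow>\<^sub>L 'a"
  assume "\<exists>S. adjoint_pair T S" "\<exists>S. adjoint_pair T' S"
  then obtain S S' where "adjoint_pair T S" "adjoint_pair ((-1) *\<^sub>R T') ((-1) *\<^sub>R S')"
    using adjoint_pair_scaleR by blast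
  from adjoint_pair_add[OF this] show "\<exists>S. adjoint_pair (T - T') S" by auto
qed

definition dist_multiplier :: "'a multiplier \<Rightarrow> 'a multiplier \<Rightarrow> real"
  where "dist_multiplier f g = norm (f - g)"

definition uniformity_multiplier :: "('a multiplier \<times> 'a multiplier) filter"
  where "uniformity_multiplier = (INF e\<in>{0 <..}. principal {(f, g). dist f g < e})"

definition open_multiplier :: "'a multiplier set \<Rightarrow> bool"
  where "open_multiplier S = (\<forall>f\<in>S. \<forall>\<^sub>F (f', g) in uniformity. f' = f \<longrightarrow> g \<in> S)"

definition sgn_multiplier :: "'a multiplier \<Rightarrow> 'a multiplier"
  where "sgn_multiplier f = inverse (norm f) *\<^sub>R f"

instance
proof
  fix f g h :: "'a multiplier" and r s :: real
  show "f + g + h = f + (g + h)" "f + g = g + f" "0 + f = f" "- f + f = 0" "f - g = f + - g"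
    by (transfer, simp)+
  show "r *\<^sub>R (f + g) = r *\<^sub>R f + r *\<^sub>R g" "(r + s) *\<^sub>R f = r *\<^sub>R f + s *\<^sub>R f"
    "r *\<^sub>R s *\<^sub>R f = (r * s) *\<^sub>R f" "1 *\<^sub>R f = f"
    by (transfer, simp add: algebra_simps)+
  show "dist f g = norm (f - g)" by (fact dist_multiplier_def)
  show "sgn f = inverse (norm f) *\<^sub>R f" by (fact sgn_multiplier_def)
  show "uniformity = (INF e\<in>{0 <..}. principal {(f, g :: 'a multiplier). dist f g < e})"
    by (fact uniformity_multiplier_def)
  show "open S = (\<forall>f\<in>S. \<forall>\<^sub>F (f', g) in uniformity. f' = f \<longrightarrow> g \<in> S)" for S :: "'a multiplier set"
    by (fact open_multiplier_def)
  show "(norm f = 0) = (f = 0)" "norm (f + g) \<le> norm f + norm g" "norm (r *\<^sub>R f) = \<bar>r\<bar> * norm f"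
    by (transfer, simp add: norm_triangle_ineq)+
qed

end

text \<open>An adjoint has the norm of the operator, so the adjoints of a Cauchy sequence form a Cauchy sequence
  too, and the adjointness relation passes to the limit.\<close>

instance multiplier :: (cstar_algebra) banach
proof
  fix X :: "nat \<Rightarrow> 'a multiplier"
  assume X: "Cauchy X"
  define T where "T n = Rep_multiplier (X n)" for n
  have "\<exists>S. adjoint_pair (T n) S" for n
    using Rep_multiplier[of "X n"] by (simp add: T_def)
  then obtain S where S: "\<And>n. adjoint_pair (T n) (S n)" by metis
  have dT: "norm (T m - T n) = dist (X m) (X n)" for m n
    by (simp add: T_def dist_norm norm_multiplier.rep_eq minus_multiplier.rep_eq)
  have dS: "norm (S m - S n) = dist (X m) (X n)" for m n
  proof -
    have "adjoint_pair (T m + (-1) *\<^sub>R T n) (S m + (-1) *\<^sub>R S n)"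
      by (intro adjoint_pair_add adjoint_pair_scaleR S)
    from adjoint_pair_norm_eq[OF this] show ?thesis
      using dT by simp
  qed
  have "Cauchy T" "Cauchy S"
    using X by (simp_all add: Cauchy_def dist_norm[of "T _"] dist_norm[of "S _"] dT dS)
  then obtain T' S' where lim: "T \<longlonglongrightarrow> T'" "S \<longlonglongrightarrow> S'"
    using Cauchy_convergent convergent_def by metis
  have "adjoint_pair T' S'"
    unfolding adjoint_pair_def
  proof (intro allI)
    fix a b
    have "(\<lambda>n. (blinfun_apply (T n) a)\<^sup>\<star> * b) \<longlonglongrightarrow> (blinfun_apply T' a)\<^sup>\<star> * b"
      by (intro tendsto_intros bounded_linear.tendsto[OF bounded_linear_star] lim)
    moreover have "(\<lambda>n. a\<^sup>\<star> * blinfun_apply (S n) b) \<longlonglongrightarrow> a\<^sup>\<star> * blinfun_apply S' b"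
      by (intro tendsto_intros lim)
    ultimately show "(blinfun_apply T' a)\<^sup>\<star> * b = a\<^sup>\<star> * blinfun_apply S' b"
      using S LIMSEQ_unique by (simp add: adjoint_pair_def)
  qed
  then have T': "Rep_multiplier (Abs_multiplier T') = T'"
    by (intro Abs_multiplier_inverse) blast
  have "X \<longlonglongrightarrow> Abs_multiplier T'"
  proof (rule metric_LIMSEQ_I)
    fix e :: real
    assume "0 < e"
    then obtain n0 where "\<forall>n\<ge>n0. norm (T n - T') < e"
      using LIMSEQ_D[OF lim(1)] by blast
    then show "\<exists>n0. \<forall>n\<ge>n0. dist (X n) (Abs_multiplier T') < e"
      by (auto simp: dist_norm norm_multiplier.rep_eq minus_multiplier.rep_eq T' T_def)
  qed
  then show "convergent X"
    by (auto simp: convergent_def)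
qed

instantiation multiplier :: (cstar_algebra) cstar_algebra
begin

lift_definition times_multiplier :: "'a multiplier \<Rightarrow> 'a multiplier \<Rightarrow> 'a multiplier" is "(o\<^sub>L)"
  using adjoint_pair_compose by blast

lift_definition scaleC_multiplier :: "complex \<Rightarrow> 'a multiplier \<Rightarrow> 'a multiplier"
  is "\<lambda>c T. scaleC_blinfun c o\<^sub>L T"
  using adjoint_pair_compose adjoint_pair_scaleC by blast

lift_definition star_multiplier :: "'a multiplier \<Rightarrow> 'a multiplier" is "\<lambda>T. THE S. adjoint_pair T S"
proof -
  fix T :: "'a \<Rightarrow>\<^sub>L 'a"
  assume "\<exists>S. adjoint_pair T S"
  then obtain S where S: "adjoint_pair T S" ..
  then have "(THE S. adjoint_pair T S) = S"
    using adjoint_pair_unique by blast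
  then show "\<exists>S'. adjoint_pair (THE S. adjoint_pair T S) S'"
    using adjoint_pair_sym[OF S] by auto
qed

lemma adjoint_pair_star: "adjoint_pair (Rep_multiplier T) (Rep_multiplier (T\<^sup>\<star>))"
proof -
  obtain S where S: "adjoint_pair (Rep_multiplier T) S"
    using Rep_multiplier[of T] by auto
  then have "(THE S. adjoint_pair (Rep_multiplier T) S) = S"
    using adjoint_pair_unique by blast
  then show ?thesis
    using S by (simp add: star_multiplier.rep_eq)
qed

lemma star_multiplier_eqI:
  assumes "adjoint_pair (Rep_multiplier T) (Rep_multiplier S)"
  shows "T\<^sup>\<star> = S"
  using adjoint_pair_unique[OF adjoint_pair_star assms] by (simp add: Rep_multiplier_inject)

instance
proof
  fix f g h :: "'a multiplier" and r :: real and c c' :: complex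
  show "f * g * h = f * (g * h)" "(f + g) * h = f * h + g * h" "f * (g + h) = f * g + f * h"
    "r *\<^sub>R f * g = r *\<^sub>R (f * g)" "f * r *\<^sub>R g = r *\<^sub>R (f * g)"
    by (transfer, auto intro!: blinfun_eqI simp: blinfun.bilinear_simps)+
  show norm_mult: "norm (f * g) \<le> norm f * norm g" for f g :: "'a multiplier"
    by transfer (rule norm_blinfun_compose)
  have clin: "blinfun_apply (Rep_multiplier f) (c *\<^sub>C a) = c *\<^sub>C blinfun_apply (Rep_multiplier f) a"
    for f :: "'a multiplier" and a c
  proof (rule cstar_left_cancel)
    fix b
    have *: "b\<^sup>\<star> * blinfun_apply (Rep_multiplier f) x = (blinfun_apply (Rep_multiplier (f\<^sup>\<star>)) b)\<^sup>\<star> * x" for x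
      using adjoint_pair_sym[OF adjoint_pair_star[of f]] by (simp add: adjoint_pair_def)
    show "b\<^sup>\<star> * blinfun_apply (Rep_multiplier f) (c *\<^sub>C a) = b\<^sup>\<star> * (c *\<^sub>C blinfun_apply (Rep_multiplier f) a)"
      by (simp add: * mult_scaleC_right)
  qed
  show "c *\<^sub>C (f + g) = c *\<^sub>C f + c *\<^sub>C g" "(c + c') *\<^sub>C f = c *\<^sub>C f + c' *\<^sub>C f"
    "c *\<^sub>C c' *\<^sub>C f = (c * c') *\<^sub>C f" "r *\<^sub>R f = complex_of_real r *\<^sub>C f"
    "c *\<^sub>C f * g = c *\<^sub>C (f * g)"
    by (transfer, auto intro!: blinfun_eqI simp: blinfun.bilinear_simps scaleC_blinfun.rep_eq
        scaleC_add_right scaleC_add_left scaleC_scaleC scaleR_scaleC)+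
  show "f * c *\<^sub>C g = c *\<^sub>C (f * g)"
    unfolding Rep_multiplier_inject[symmetric] times_multiplier.rep_eq scaleC_multiplier.rep_eq
    by (rule blinfun_eqI) (simp add: scaleC_blinfun.rep_eq clin)
  have le: "norm (c *\<^sub>C f) \<le> cmod c * norm f" for c and f :: "'a multiplier"
    by transfer (auto intro!: norm_blinfun_bound mult_left_mono norm_blinfun
        simp: scaleC_blinfun.rep_eq norm_scaleC mult.assoc)
  show "norm (c *\<^sub>C f) = cmod c * norm f"
  proof (cases "c = 0")
    case True
    then show ?thesis using le[of c f] by simp
  next
    case False
    have "inverse c *\<^sub>C c *\<^sub>C f = f"
      unfolding Rep_multiplier_inject[symmetric] scaleC_multiplier.rep_eq
      by (rule blinfun_eqI) (simp add: scaleC_blinfun.rep_eq scaleC_scaleC False)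
    then have "cmod c * norm f \<le> cmod c * (cmod (inverse c) * norm (c *\<^sub>C f))"
      using le[of "inverse c" "c *\<^sub>C f"] by (simp add: mult_left_mono)
    also have "\<dots> = norm (c *\<^sub>C f)"
      using False by (simp add: norm_inverse)
    finally show ?thesis
      using le[of c f] by linarith
  qed
  show "(f + g)\<^sup>\<star> = f\<^sup>\<star> + g\<^sup>\<star>"
    by (rule star_multiplier_eqI) (simp add: plus_multiplier.rep_eq adjoint_pair_add adjoint_pair_star)
  show "(c *\<^sub>C f)\<^sup>\<star> = cnj c *\<^sub>C f\<^sup>\<star>"
  proof (rule star_multiplier_eqI)
    have "Rep_multiplier (f\<^sup>\<star>) o\<^sub>L scaleC_blinfun (cnj c) = scaleC_blinfun (cnj c) o\<^sub>L Rep_multiplier (f\<^sup>\<star>)"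
      by (rule blinfun_eqI) (simp add: scaleC_blinfun.rep_eq clin)
    then show "adjoint_pair (Rep_multiplier (c *\<^sub>C f)) (Rep_multiplier (cnj c *\<^sub>C f\<^sup>\<star>))"
      using adjoint_pair_compose[OF adjoint_pair_scaleC[of c] adjoint_pair_star[of f]]
      by (simp add: scaleC_multiplier.rep_eq)
  qed
  show "(f\<^sup>\<star>)\<^sup>\<star> = f"
    by (rule star_multiplier_eqI) (rule adjoint_pair_sym[OF adjoint_pair_star])
  show "(f * g)\<^sup>\<star> = g\<^sup>\<star> * f\<^sup>\<star>"
    by (rule star_multiplier_eqI) (simp add: times_multiplier.rep_eq adjoint_pair_compose adjoint_pair_star)
  show "norm (f\<^sup>\<star> * f) = (norm f)\<^sup>2"
  proof (rule antisym)
    have "norm (f\<^sup>\<star>) = norm f"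
      using adjoint_pair_norm_eq[OF adjoint_pair_star[of f]] by (simp add: norm_multiplier.rep_eq)
    then show "norm (f\<^sup>\<star> * f) \<le> (norm f)\<^sup>2"
      using norm_mult[of "f\<^sup>\<star>" f]
      by (simp add: power2_eq_square)
    show "(norm f)\<^sup>2 \<le> norm (f\<^sup>\<star> * f)"
      using adjoint_pair_norm_le[OF adjoint_pair_star[of f]]
      by (simp add: norm_multiplier.rep_eq times_multiplier.rep_eq)
  qed
qed

end

instantiation multiplier :: (cstar_algebra) monoid_mult
begin

lift_definition one_multiplier :: "'a multiplier" is id_blinfun
  using adjoint_pair_id by blast

instance
  by standard (transfer, rule blinfun_eqI, simp)+

end

text \<open>The algebra is an ideal among its multipliers, and \<open>lmult\<close> and \<open>rmult\<close> are the products with a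
  multiplier on either side. The involution carries one into the other.\<close>

definition lmult :: "'a::cstar_algebra multiplier \<Rightarrow> 'a \<Rightarrow> 'a"
  where "lmult m a = blinfun_apply (Rep_multiplier m) a"

definition rmult :: "'a::cstar_algebra \<Rightarrow> 'a multiplier \<Rightarrow> 'a"
  where "rmult a m = (lmult (m\<^sup>\<star>) (a\<^sup>\<star>))\<^sup>\<star>"

lift_definition incl :: "'a::cstar_algebra \<Rightarrow> 'a multiplier" is mult_blinfun
  using adjoint_pair_mult by blast

lemma bounded_bilinear_lmult: "bounded_bilinear lmult"
  by (rule bounded_bilinear.intro)
    (auto simp: lmult_def plus_multiplier.rep_eq scaleR_multiplier.rep_eq norm_multiplier.rep_eq
      blinfun.bilinear_simps intro!: exI[of _ 1] norm_blinfun)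

lemma norm_lmult_le: "norm (lmult m a) \<le> norm m * norm a"
  by (simp add: lmult_def norm_multiplier.rep_eq norm_blinfun)

lemma norm_rmult_le: "norm (rmult a m) \<le> norm a * norm m"
  using norm_lmult_le[of "m\<^sup>\<star>" "a\<^sup>\<star>"] by (simp add: rmult_def norm_star mult.commute)

lemma bounded_bilinear_rmult: "bounded_bilinear rmult"
proof -
  interpret L: bounded_bilinear "lmult :: 'a multiplier \<Rightarrow> 'a \<Rightarrow> 'a"
    by (rule bounded_bilinear_lmult)
  show ?thesis
    by (rule bounded_bilinear.intro)
      (auto simp: rmult_def star_add star_scaleR L.add_left L.add_right L.scaleR_left L.scaleR_right
        intro!: exI[of _ 1] norm_rmult_le[unfolded rmult_def])
qed

lemma lmult_mult: "lmult (m * n) a = lmult m (lmult n a)"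
  by (simp add: lmult_def times_multiplier.rep_eq)

lemma lmult_one [simp]: "lmult 1 a = a"
  by (simp add: lmult_def one_multiplier.rep_eq)

lemma rmult_one [simp]: "rmult a 1 = a"
  by (simp add: rmult_def star_star)

lemma lmult_incl [simp]: "lmult (incl x) a = x * a"
  by (simp add: lmult_def incl.rep_eq mult_blinfun.rep_eq)

lemma star_incl: "(incl x)\<^sup>\<star> = incl (x\<^sup>\<star>)"
  by (rule star_multiplier_eqI) (simp add: incl.rep_eq adjoint_pair_mult)

lemma rmult_incl [simp]: "rmult a (incl x) = a * x"
  by (simp add: rmult_def star_incl star_mult star_star)

text \<open>Adjointness, read as associativity of the product of two algebra elements around a multiplier.\<close>

lemma rmult_mult_eq: "rmult a m * b = a * lmult m b"
  using adjoint_pair_star[of "m\<^sup>\<star>"] by (simp add: adjoint_pair_def rmult_def lmult_def star_star)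

lemma multiplier_eqI: "(\<And>a. lmult m a = lmult n a) \<Longrightarrow> m = n"
  unfolding Rep_multiplier_inject[symmetric] lmult_def by (rule blinfun_eqI) simp

lemma lmult_times: "lmult m (a * b) = lmult m a * b"
proof (rule cstar_left_cancel)
  fix c
  show "c\<^sup>\<star> * lmult m (a * b) = c\<^sup>\<star> * (lmult m a * b)"
    by (simp add: mult.assoc[symmetric] rmult_mult_eq[symmetric])
qed

lemma incl_lmult: "incl (lmult m a) = m * incl a"
proof (rule multiplier_eqI)
  fix b
  show "lmult (incl (lmult m a)) b = lmult (m * incl a) b"
    by (simp add: lmult_mult lmult_times)
qed

lemma incl_add: "incl (a + b) = incl a + incl b"
  by (rule multiplier_eqI)
    (simp add: bounded_bilinear.add_left[OF bounded_bilinear_lmult] distrib_right)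

lemma incl_scaleR: "incl (r *\<^sub>R a) = r *\<^sub>R incl a"
  by (rule multiplier_eqI)
    (simp add: bounded_bilinear.scaleR_left[OF bounded_bilinear_lmult])

lemma incl_mult: "incl (a * b) = incl a * incl b"
  by (rule multiplier_eqI) (simp add: lmult_mult mult.assoc)

lemma norm_incl: "norm (incl a) = norm a"
proof (rule antisym)
  show "norm (incl a) \<le> norm a"
    by transfer (rule norm_blinfun_bound, simp_all add: mult_blinfun.rep_eq norm_mult_ineq)
  show "norm a \<le> norm (incl a)"
  proof (cases "a = 0")
    case False
    have "norm a * norm a \<le> norm (incl a) * norm a"
      using norm_lmult_le[of "incl a" "a\<^sup>\<star>"] cstar_identity[of "a\<^sup>\<star>"]
      by (simp add: star_star norm_star power2_eq_square)
    then show ?thesis using False by simp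
  qed simp
qed

section \<open>Approximate units\<close>

lemma lmult_scaleC: "lmult m (c *\<^sub>C a) = c *\<^sub>C lmult m a"
proof (rule cstar_left_cancel)
  fix b
  show "b\<^sup>\<star> * lmult m (c *\<^sub>C a) = b\<^sup>\<star> * (c *\<^sub>C lmult m a)"
    by (simp add: mult_scaleC_right rmult_mult_eq[symmetric])
qed

lemma incl_sum: "incl (sum f I) = (\<Sum>i\<in>I. incl (f i))"
proof (induction I rule: infinite_finite_induct)
  case (infinite I)
  show ?case using incl_scaleR[of 0 0] infinite by simp
next
  case empty
  show ?case using incl_scaleR[of 0 0] by simp
next
  case (insert i I)
  then show ?case by (simp add: incl_add)
qed

lemma inj_incl: "incl a = incl b \<Longrightarrow> a = b"
proof -
  assume "incl a = incl b"
  then have "incl (a + (-1) *\<^sub>R b) = 0"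
    by (simp only: incl_add incl_scaleR) simp
  then show "a = b"
    using norm_incl[of "a + (-1) *\<^sub>R b"] by simp
qed

text \<open>Let \<open>\<Phi> = \<phi>(H)\<close>. For \<open>z\<close> in \<open>X\<close> the elements \<open>\<Phi>zz\<^sup>\<star>\<Phi>\<close> are positive and sum to
  \<open>\<Phi>H\<Phi>/\<rho>\<close>, so each of them, in particular the one of norm \<open>\<parallel>\<Phi>x\<parallel>\<^sup>2\<close>, is bounded by the supremum of
  \<open>\<phi>(s)\<^sup>2\<bar>s\<bar>/\<rho>\<close>. The factor \<open>\<rho>\<close> only serves to make \<open>H\<close> a contraction.\<close>

lemma norm_cfc_lmult_le:
  fixes X :: "'a::cstar_algebra set"
  assumes X: "finite X" "x \<in> X" and \<rho>: "0 < \<rho>"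
    and H: "H = incl (\<rho> *\<^sub>R (\<Sum>x\<in>X. x * x\<^sup>\<star>))" "norm H \<le> 1"
    and \<phi>: "continuous_on {-1..1} \<phi>"
    and le: "\<And>s. s \<in> {-1..1} \<Longrightarrow> (\<phi> s)\<^sup>2 * \<bar>s\<bar> \<le> \<rho> * e\<^sup>2" and e: "0 \<le> e"
  shows "norm (lmult (cfc H \<phi>) x) \<le> e"
proof -
  define \<Phi> where "\<Phi> = cfc H \<phi>"
  have Hs: "H\<^sup>\<star> = H"
    by (simp add: H(1) star_incl star_scaleR star_sum star_mult star_star)
  note H' = Hs H(2)
  have \<Phi>s: "\<Phi>\<^sup>\<star> = \<Phi>"
    unfolding \<Phi>_def by (rule star_cfc[OF H' \<phi>])
  define y where "y z = (\<Phi> * incl z)\<^sup>\<star>" for z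
  have y: "(y z)\<^sup>\<star> * y z = \<Phi> * incl (z * z\<^sup>\<star>) * \<Phi>" for z
    by (simp add: y_def star_star star_mult star_incl \<Phi>s incl_mult mult.assoc)
  have "(\<Sum>z\<in>X. (y z)\<^sup>\<star> * y z) = \<Phi> * incl (\<Sum>z\<in>X. z * z\<^sup>\<star>) * \<Phi>"
    by (simp add: y incl_sum sum_distrib_left sum_distrib_right)
  also have "\<dots> = inverse \<rho> *\<^sub>R (\<Phi> * H * \<Phi>)"
    using \<rho> by (simp add: H(1) incl_scaleR)
  also have "\<Phi> * H * \<Phi> = cfc H (\<lambda>s. \<phi> s * s * \<phi> s)"
    using cfc_mult[OF H' continuous_on_mult[OF \<phi> continuous_on_id] \<phi>] cfc_mult[OF H' \<phi> continuous_on_id]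
    by (simp add: cfc_id[OF H'] \<Phi>_def)
  finally have sum_eq: "(\<Sum>z\<in>X. (y z)\<^sup>\<star> * y z) = inverse \<rho> *\<^sub>R cfc H (\<lambda>s. \<phi> s * s * \<phi> s)" .
  have "norm (cfc H (\<lambda>s. \<phi> s * s * \<phi> s)) \<le> \<rho> * e\<^sup>2"
  proof (rule norm_cfc_le[OF H'])
    show "continuous_on {-1..1} (\<lambda>s. \<phi> s * s * \<phi> s)"
      by (intro continuous_intros \<phi>)
    show "\<bar>\<phi> s * s * \<phi> s\<bar> \<le> \<rho> * e\<^sup>2" if "s \<in> {-1..1}" for s
      using le[OF that] by (simp add: abs_mult power2_eq_square mult_ac)
  qed
  then have "norm (\<Sum>z\<in>X. (y z)\<^sup>\<star> * y z) \<le> e\<^sup>2"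
    unfolding sum_eq using \<rho> by (simp add: field_simps)
  moreover have "(\<Sum>z\<in>X. (y z)\<^sup>\<star> * y z) = (y x)\<^sup>\<star> * y x + (\<Sum>z\<in>X - {x}. (y z)\<^sup>\<star> * y z)"
    using X by (simp add: sum.remove)
  moreover have "nonneg (\<Sum>z\<in>X - {x}. (y z)\<^sup>\<star> * y z)"
    by (intro nonneg_sum nonneg_star_mult_self)
  ultimately have "norm ((y x)\<^sup>\<star> * y x) \<le> e\<^sup>2"
    using norm_star_mult_self_le_add[of "\<Sum>z\<in>X - {x}. (y z)\<^sup>\<star> * y z" "y x"] by simp
  then have "(norm (y x))\<^sup>2 \<le> e\<^sup>2"
    by (simp add: cstar_identity)
  then have "norm (y x) \<le> e"
    using e power2_le_imp_le by blast
  also have "norm (y x) = norm (lmult \<Phi> x)"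
    by (simp add: y_def norm_star incl_lmult[symmetric] norm_incl)
  finally show ?thesis
    by (simp add: \<Phi>_def)
qed

text \<open>An element \<open>e\<close> with \<open>0 \<le> e \<le> 1\<close> together with commuting self-adjoint square roots \<open>k\<close> of \<open>e\<close> and \<open>m\<close> of
  \<open>1 - e\<close> among the multipliers.\<close>

definition partial_unit :: "'a::cstar_algebra \<Rightarrow> 'a multiplier \<Rightarrow> 'a multiplier \<Rightarrow> bool"
  where "partial_unit e k m \<longleftrightarrow> e\<^sup>\<star> = e \<and> norm e \<le> 1 \<and> k\<^sup>\<star> = k \<and> m\<^sup>\<star> = m \<and> norm m \<le> 1 \<and>
    k * m = m * k \<and> k * k + m * m = 1 \<and> incl e = k * k"

text \<open>The witnesses are functions of \<open>h\<close>, a multiple of the sum of all \<open>xx\<^sup>\<star>\<close>: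
  \<open>e = h\<^sup>2/(h\<^sup>2 + r\<^sup>2)\<close>, which lies in the algebra because it has the form \<open>h g(h) h\<close>. For these
  \<open>(1 - k)\<^sup>2 \<le> 1 - k\<^sup>2 = r\<^sup>2/(s\<^sup>2 + r\<^sup>2)\<close>, and \<open>r\<^sup>2\<bar>s\<bar>/(s\<^sup>2 + r\<^sup>2) \<le> r\<close>, so \<open>norm_cfc_lmult_le\<close> applies as soon as
  \<open>r\<close> is small.\<close>

lemma partial_unit_exists:
  fixes X :: "'a::cstar_algebra set"
  assumes X: "finite X" and \<epsilon>: "0 < \<epsilon>"
  obtains e k m where "partial_unit e k m" "\<And>x. x \<in> X \<Longrightarrow> norm (x - lmult k x) \<le> \<epsilon>"
proof -
  define h0 where "h0 = (\<Sum>x\<in>X. x * x\<^sup>\<star>)"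
  define \<rho> where "\<rho> = inverse (1 + norm h0)"
  have \<rho>: "0 < \<rho>"
    by (simp add: \<rho>_def add_pos_nonneg)
  define h where "h = \<rho> *\<^sub>R h0"
  define H where "H = incl h"
  have H: "H = incl (\<rho> *\<^sub>R (\<Sum>x\<in>X. x * x\<^sup>\<star>))"
    by (simp add: H_def h_def h0_def)
  have Hn: "norm H \<le> 1"
    using \<rho> by (simp add: H_def norm_incl h_def) (simp add: \<rho>_def field_simps add_pos_nonneg)
  have Hs: "H\<^sup>\<star> = H"
    by (simp add: H star_incl star_scaleR star_sum star_mult star_star)
  note H' = Hs Hn
  define r where "r = \<rho> * \<epsilon>\<^sup>2"
  have r: "0 < r" using \<rho> \<epsilon> by (simp add: r_def)
  have pos: "0 < s\<^sup>2 + r\<^sup>2" for s :: real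
    using r by (simp add: add_nonneg_pos)
  have nz: "s\<^sup>2 + r\<^sup>2 \<noteq> 0" for s :: real
    using pos[of s] by linarith
  define \<kappa> where "\<kappa> s = \<bar>s\<bar> / sqrt (s\<^sup>2 + r\<^sup>2)" for s
  define \<mu> where "\<mu> s = r / sqrt (s\<^sup>2 + r\<^sup>2)" for s
  define g where "g s = 1 / (s\<^sup>2 + r\<^sup>2)" for s
  have \<kappa>: "continuous_on {-1..1} \<kappa>"
    unfolding \<kappa>_def by (intro continuous_intros ballI) (use r in \<open>simp add: nz\<close>)
  have \<mu>: "continuous_on {-1..1} \<mu>"
    unfolding \<mu>_def by (intro continuous_intros ballI) (use r in \<open>simp add: nz\<close>)
  have g: "continuous_on {-1..1} g"
    unfolding g_def by (intro continuous_intros ballI) (use r in \<open>simp add: nz\<close>)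
  have \<kappa>2: "\<kappa> s * \<kappa> s = s * g s * s" for s
    using pos[of s] by (simp add: \<kappa>_def g_def power_divide power2_eq_square[symmetric])
  have \<mu>2: "\<mu> s * \<mu> s = r\<^sup>2 * g s" for s
    using pos[of s] by (simp add: \<mu>_def g_def power_divide power2_eq_square[symmetric])
  have sum1: "\<kappa> s * \<kappa> s + \<mu> s * \<mu> s = 1" for s
    using pos[of s] r by (simp add: \<kappa>2 \<mu>2 g_def power2_eq_square add_divide_distrib[symmetric])
  have \<kappa>01: "0 \<le> \<kappa> s" "\<kappa> s \<le> 1" and \<mu>01: "0 \<le> \<mu> s" "\<mu> s \<le> 1" for s
  proof -
    show "0 \<le> \<kappa> s" "0 \<le> \<mu> s"
      using pos[of s] r by (simp_all add: \<kappa>_def \<mu>_def)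
    have "(\<kappa> s)\<^sup>2 \<le> 1\<^sup>2" "(\<mu> s)\<^sup>2 \<le> 1\<^sup>2"
      using sum1[of s] zero_le_square[of "\<kappa> s"] zero_le_square[of "\<mu> s"]
      unfolding power2_eq_square by linarith+
    then show "\<kappa> s \<le> 1" "\<mu> s \<le> 1"
      by (auto intro: power2_le_imp_le)
  qed
  define k m where "k = cfc H \<kappa>" and "m = cfc H \<mu>"
  define e where "e = h * lmult (cfc H g) h"
  have ie: "incl e = k * k"
  proof -
    have "incl e = H * (cfc H g * H)"
      by (simp add: e_def incl_mult incl_lmult H_def)
    also have "\<dots> = cfc H (\<lambda>s. s * g s * s)"
      using cfc_mult[OF H' continuous_on_mult[OF continuous_on_id g] continuous_on_id]
        cfc_mult[OF H' continuous_on_id g]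
      by (simp add: cfc_id[OF H'] mult.assoc)
    also have "\<dots> = k * k"
      using cfc_mult[OF H' \<kappa> \<kappa>] by (simp add: k_def \<kappa>2)
    finally show ?thesis .
  qed
  have ks: "k\<^sup>\<star> = k" and ms: "m\<^sup>\<star> = m"
    unfolding k_def m_def by (rule star_cfc[OF H' \<kappa>], rule star_cfc[OF H' \<mu>])
  have "partial_unit e k m"
    unfolding partial_unit_def
  proof (intro conjI ks ms ie)
    have "incl (e\<^sup>\<star>) = incl e"
      by (simp add: star_incl[symmetric] ie star_mult ks)
    then show "e\<^sup>\<star> = e" by (rule inj_incl)
    have "norm k \<le> 1"
      unfolding k_def using \<kappa>01 by (intro norm_cfc_le[OF H' \<kappa>]) (simp add: abs_le_iff)
    then have "norm (k * k) \<le> 1"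
      using norm_selfadjoint_square[OF ks] by (simp add: power_le_one)
    then show "norm e \<le> 1"
      using norm_incl[of e] ie by simp
    show "norm m \<le> 1"
      unfolding m_def using \<mu>01 by (intro norm_cfc_le[OF H' \<mu>]) (simp add: abs_le_iff)
    show "k * m = m * k"
      using cfc_mult[OF H' \<kappa> \<mu>] cfc_mult[OF H' \<mu> \<kappa>] by (simp add: k_def m_def mult.commute)
    have "k * k + m * m = cfc H (\<lambda>s. \<kappa> s * \<kappa> s + \<mu> s * \<mu> s)"
      by (subst cfc_add[OF H'])
        (auto intro!: continuous_intros \<kappa> \<mu> simp: cfc_mult[OF H'] \<kappa> \<mu> k_def m_def)
    then show "k * k + m * m = 1"
      by (simp add: sum1 cfc_const[OF H'])
  qed
  moreover have "norm (x - lmult k x) \<le> \<epsilon>" if x: "x \<in> X" for x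
  proof -
    have "cfc H (\<lambda>s. 1 - \<kappa> s) = 1 - k"
      using cfc_diff[OF H' continuous_on_const \<kappa>] by (simp add: cfc_const[OF H'] k_def)
    then have "x - lmult k x = lmult (cfc H (\<lambda>s. 1 - \<kappa> s)) x"
      by (simp add: bounded_bilinear.diff_left[OF bounded_bilinear_lmult])
    also have "norm \<dots> \<le> \<epsilon>"
    proof (rule norm_cfc_lmult_le[OF X x \<rho> H Hn])
      show "continuous_on {-1..1} (\<lambda>s. 1 - \<kappa> s)"
        by (intro continuous_intros \<kappa>)
      fix s :: real
      have "(1 - \<kappa> s)\<^sup>2 \<le> (1 - \<kappa> s) * (1 + \<kappa> s)"
        using \<kappa>01[of s] by (simp add: power2_eq_square mult_left_mono)
      also have "\<dots> = r\<^sup>2 * g s"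
        using sum1[of s] by (simp add: \<mu>2 algebra_simps)
      finally have "(1 - \<kappa> s)\<^sup>2 * \<bar>s\<bar> \<le> r\<^sup>2 * g s * \<bar>s\<bar>"
        by (rule mult_right_mono) simp
      also have "\<dots> \<le> r"
      proof -
        have "0 \<le> (\<bar>s\<bar> - r)\<^sup>2" by simp
        then have "2 * (r * \<bar>s\<bar>) \<le> s\<^sup>2 + r\<^sup>2"
          by (simp add: power2_diff mult_ac)
        moreover have "0 \<le> r * \<bar>s\<bar>" using r by simp
        ultimately have "r * \<bar>s\<bar> \<le> s\<^sup>2 + r\<^sup>2" by linarith
        then have "r * (r * \<bar>s\<bar>) \<le> r * (s\<^sup>2 + r\<^sup>2)"
          using r by (intro mult_left_mono) simp_all
        then show ?thesis
          using pos[of s] by (simp add: g_def divide_le_eq power2_eq_square mult_ac)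
      qed
      finally show "(1 - \<kappa> s)\<^sup>2 * \<bar>s\<bar> \<le> \<rho> * \<epsilon>\<^sup>2"
        by (simp add: r_def)
    qed (use \<epsilon> in simp)
    finally show ?thesis .
  qed
  ultimately show ?thesis by (rule that)
qed

text \<open>The matrix with rows \<open>(k, m)\<close> and \<open>(m, -k)\<close> is unitary. Hence \<open>V = kx + tmb\<close> and \<open>W = mx - tkb\<close> satisfy
  \<open>V\<^sup>\<star>V + W\<^sup>\<star>W = x\<^sup>\<star>x + t\<^sup>2b\<^sup>\<star>b\<close>, and \<open>V\<^sup>\<star>V\<close> is dominated by this sum.\<close>

lemma partial_unit_row_contraction:
  assumes u: "partial_unit e k m"
    and x: "norm x \<le> 1" and b: "norm b \<le> 1"
  shows "(norm (lmult k x + t *\<^sub>R lmult m b))\<^sup>2 \<le> 1 + t\<^sup>2"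
proof -
  have k: "k\<^sup>\<star> = k" and m: "m\<^sup>\<star> = m" and km: "k * m = m * k" and km1: "k * k + m * m = 1"
    using u by (simp_all add: partial_unit_def)
  define X B where "X = incl x" and "B = incl b"
  define V W where "V = k * X + t *\<^sub>R (m * B)" and "W = m * X - t *\<^sub>R (k * B)"
  have exp: "V\<^sup>\<star> * V + W\<^sup>\<star> * W = X\<^sup>\<star> * ((k * k + m * m) * X) + (t * t) *\<^sub>R (B\<^sup>\<star> * ((k * k + m * m) * B))
      + t *\<^sub>R (X\<^sup>\<star> * ((k * m - m * k) * B)) + t *\<^sub>R (B\<^sup>\<star> * ((m * k - k * m) * X))"
    by (simp add: V_def W_def star_add star_diff star_scaleR star_mult k m algebra_simps)
  have "V\<^sup>\<star> * V + W\<^sup>\<star> * W = X\<^sup>\<star> * X + (t * t) *\<^sub>R (B\<^sup>\<star> * B)"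
    unfolding exp by (simp add: km1 km)
  also have "norm \<dots> \<le> norm (X\<^sup>\<star> * X) + norm ((t * t) *\<^sub>R (B\<^sup>\<star> * B))"
    by (rule norm_triangle_ineq)
  also have "\<dots> = (norm x)\<^sup>2 + t * t * (norm b)\<^sup>2"
    by (simp add: cstar_identity X_def B_def norm_incl)
  also have "\<dots> \<le> 1 + t\<^sup>2"
    using x b by (intro add_mono) (simp_all add: power_le_one power2_eq_square[of t] mult_left_le)
  finally have "norm (V\<^sup>\<star> * V + W\<^sup>\<star> * W) \<le> 1 + t\<^sup>2" .
  then have "norm (V\<^sup>\<star> * V) \<le> 1 + t\<^sup>2"
    using norm_star_mult_self_le_add[OF nonneg_star_mult_self[of W], of V] by simp
  moreover have "V = incl (lmult k x + t *\<^sub>R lmult m b)"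
    by (simp add: V_def X_def B_def incl_add incl_scaleR incl_lmult)
  ultimately show ?thesis
    by (simp add: cstar_identity norm_incl)
qed

lemma cdual_apply_add: "cdual_apply f (x + y) = cdual_apply f x + cdual_apply f y"
  using clinear_cdual_apply[of f] by (simp add: clinear_def)

lemma cdual_apply_scaleC: "cdual_apply f (c *\<^sub>C x) = c * cdual_apply f x"
  using clinear_cdual_apply[of f] by (simp add: clinear_def scaleC_complex_def)

lemma cdual_apply_zero [simp]: "cdual_apply f 0 = 0"
  using cdual_apply_scaleC[of f 0 0] by simp

lemma cdual_apply_minus: "cdual_apply f (- x) = - cdual_apply f x"
  using cdual_apply_scaleC[of f "-1" x] by (simp add: scaleC_minus_left)

lemma cdual_apply_diff: "cdual_apply f (x - y) = cdual_apply f x - cdual_apply f y"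
  using cdual_apply_add[of f x "-y"] by (simp add: cdual_apply_minus)

lemma cdual_apply_scaleR: "cdual_apply f (r *\<^sub>R x) = complex_of_real r * cdual_apply f x"
  by (simp add: scaleR_scaleC cdual_apply_scaleC)

text \<open>Rotating the argument makes the value of the functional a nonnegative real.\<close>

lemma cdual_almost_attains_norm:
  assumes d: "0 < d"
  obtains x where "norm x \<le> 1" "cdual_apply f x = complex_of_real (cmod (cdual_apply f x))"
    "norm f - d \<le> cmod (cdual_apply f x)"
proof (cases "norm f \<le> d")
  case True
  then show ?thesis by (intro that[of 0]) simp_all
next
  case False
  have "\<exists>y. (norm f - d) * norm y < cmod (cdual_apply f y)"
  proof (rule ccontr)
    assume "\<not> ?thesis"
    then have "norm f \<le> norm f - d"
      using False by (intro norm_cdual_bound) (simp_all add: not_less)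
    with d show False by simp
  qed
  then obtain y where y: "(norm f - d) * norm y < cmod (cdual_apply f y)" ..
  define w where "w = cdual_apply f y"
  have "0 \<le> (norm f - d) * norm y"
    using False by simp
  with y have w: "w \<noteq> 0" by (auto simp: w_def)
  then have y0: "y \<noteq> 0" by (auto simp: w_def)
  define c where "c = cnj w / complex_of_real (cmod w * norm y)"
  have c: "cmod c = 1 / norm y"
    using w by (simp add: c_def norm_divide norm_mult)
  have "cdual_apply f (c *\<^sub>C y) = cnj w * w / complex_of_real (cmod w * norm y)"
    by (simp add: cdual_apply_scaleC c_def w_def)
  also have "cnj w * w = complex_of_real ((cmod w)\<^sup>2)"
    by (metis complex_norm_square mult.commute)
  also have "\<dots> / complex_of_real (cmod w * norm y) = complex_of_real (cmod w / norm y)"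
    using w by (simp add: power2_eq_square)
  finally have fc: "cdual_apply f (c *\<^sub>C y) = complex_of_real (cmod w / norm y)" .
  show ?thesis
  proof (rule that[of "c *\<^sub>C y"])
    show "norm (c *\<^sub>C y) \<le> 1"
      using y0 by (simp add: norm_scaleC c)
    show "cdual_apply f (c *\<^sub>C y) = complex_of_real (cmod (cdual_apply f (c *\<^sub>C y)))"
      unfolding fc by (simp add: norm_divide)
    show "norm f - d \<le> cmod (cdual_apply f (c *\<^sub>C y))"
      unfolding fc using y y0 by (simp add: w_def norm_divide le_divide_eq)
  qed
qed

text \<open>With \<open>b\<close> rotated so that \<open>f(mb) \<ge> 0\<close>, the real part of \<open>f(kx + tmb)\<close> is about \<open>\<parallel>f\<parallel> + t f(mb)\<close>,
  while the row contraction bounds it by \<open>\<parallel>f\<parallel> (1 + t\<^sup>2)\<close>. All errors are of order \<open>t\<^sup>2\<close>, so \<open>f(mb)\<close> is of order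
  \<open>t\<close>, uniformly in the unit ball. Applied to \<open>mb\<close> in place of \<open>b\<close>, this bounds \<open>f(b) - f(eb) = f(mmb)\<close>.\<close>

lemma dual_ract_near_of_partial_unit:
  assumes u: "partial_unit e k m" and t: "0 < t"
    and x: "norm x \<le> 1" "cdual_apply f x = complex_of_real (cmod (cdual_apply f x))"
      "norm f - t\<^sup>2 \<le> cmod (cdual_apply f x)"
    and kx: "norm (x - lmult k x) \<le> t\<^sup>2"
  shows "norm (dual_ract f e - f) \<le> t * (1 + 2 * norm f)"
proof -
  have unit: "cmod (cdual_apply f (lmult m b)) \<le> t * (1 + 2 * norm f)" if b: "norm b \<le> 1" for b
  proof (cases "cdual_apply f (lmult m b) = 0")
    case True
    then show ?thesis using t by simp
  next
    case False
    define w where "w = cdual_apply f (lmult m b)"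
    have w: "w \<noteq> 0" using False by (simp add: w_def)
    define c where "c = cnj w / complex_of_real (cmod w)"
    have "cmod c = 1"
      using w by (simp add: c_def norm_divide)
    then have cb: "norm (c *\<^sub>C b) \<le> 1"
      using b by (simp add: norm_scaleC)
    have "cdual_apply f (lmult m (c *\<^sub>C b)) = cnj w * w / complex_of_real (cmod w)"
      by (simp add: lmult_scaleC cdual_apply_scaleC c_def w_def)
    also have "cnj w * w = complex_of_real ((cmod w)\<^sup>2)"
      by (metis complex_norm_square mult.commute)
    also have "\<dots> / complex_of_real (cmod w) = complex_of_real (cmod w)"
      using w by (simp add: power2_eq_square)
    finally have fc: "cdual_apply f (lmult m (c *\<^sub>C b)) = complex_of_real (cmod w)" .
    define v where "v = lmult k x + t *\<^sub>R lmult m (c *\<^sub>C b)"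
    have "(norm v)\<^sup>2 \<le> (1 + t\<^sup>2)\<^sup>2"
    proof -
      have "(norm v)\<^sup>2 \<le> 1 + t\<^sup>2"
        unfolding v_def by (rule partial_unit_row_contraction[OF u x(1) cb])
      also have "\<dots> \<le> (1 + t\<^sup>2)\<^sup>2"
        by (rule self_le_power) simp_all
      finally show ?thesis .
    qed
    then have nv: "norm v \<le> 1 + t\<^sup>2"
      by (rule power2_le_imp_le) simp
    have "cdual_apply f v = cdual_apply f x - cdual_apply f (x - lmult k x) + complex_of_real (t * cmod w)"
      by (simp add: v_def cdual_apply_add cdual_apply_diff cdual_apply_scaleR fc)
    then have "cmod (cdual_apply f x) + t * cmod w
        = Re (cdual_apply f v) + Re (cdual_apply f (x - lmult k x))"
      using arg_cong[OF x(2), of Re] by simp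
    also have "\<dots> \<le> norm f * norm v + norm f * norm (x - lmult k x)"
      by (meson add_mono complex_Re_le_cmod norm_cdual_apply_le order_trans)
    also have "\<dots> \<le> norm f * (1 + t\<^sup>2) + norm f * t\<^sup>2"
      by (intro add_mono mult_left_mono nv kx) simp_all
    finally have "t * cmod w \<le> t * (t * (1 + 2 * norm f))"
      using x(3) by (simp add: power2_eq_square algebra_simps)
    then show ?thesis
      using t by (simp add: w_def)
  qed
  have gen: "cmod (cdual_apply f (lmult m b)) \<le> t * (1 + 2 * norm f) * norm b" for b
  proof (cases "b = 0")
    case True
    then show ?thesis
      by (simp add: bounded_bilinear.zero_right[OF bounded_bilinear_lmult])
  next
    case False
    have "cmod (cdual_apply f (lmult m (inverse (norm b) *\<^sub>R b))) \<le> t * (1 + 2 * norm f)"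
      using False by (intro unit) simp
    then show ?thesis
      using False by (simp add: bounded_bilinear.scaleR_right[OF bounded_bilinear_lmult]
          cdual_apply_scaleR norm_mult norm_inverse norm_divide field_simps)
  qed
  have m: "norm m \<le> 1" "incl e = k * k" "k * k + m * m = 1"
    using u by (simp_all add: partial_unit_def)
  show ?thesis
  proof (rule norm_cdual_bound)
    fix b
    have "b = lmult (k * k + m * m) b"
      by (simp add: m(3))
    then have "b = e * b + lmult m (lmult m b)"
      by (simp add: bounded_bilinear.add_left[OF bounded_bilinear_lmult] m(2)[symmetric] lmult_mult)
    then have "cdual_apply f b = cdual_apply f (e * b) + cdual_apply f (lmult m (lmult m b))"
      by (metis cdual_apply_add)
    then have "cmod (cdual_apply (dual_ract f e - f) b) = cmod (cdual_apply f (lmult m (lmult m b)))"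
      by (simp add: minus_cdual.rep_eq dual_ract.rep_eq)
    also have "\<dots> \<le> t * (1 + 2 * norm f) * norm (lmult m b)"
      by (rule gen)
    also have "\<dots> \<le> t * (1 + 2 * norm f) * norm b"
    proof (rule mult_left_mono)
      show "norm (lmult m b) \<le> norm b"
        using norm_lmult_le[of m b] mult_right_mono[OF m(1), of "norm b"] by simp
    qed (use t in simp)
    finally show "cmod (cdual_apply (dual_ract f e - f) b) \<le> t * (1 + 2 * norm f) * norm b" .
  qed (use t in simp)
qed

lemma approximate_unit_for_functionals:
  fixes F :: "'a::cstar_algebra cdual set"
  assumes F: "finite F" and \<epsilon>: "0 < \<epsilon>"
  obtains e where "e\<^sup>\<star> = e" "norm e \<le> 1" "\<And>f. f \<in> F \<Longrightarrow> norm (dual_ract f e - f) \<le> \<epsilon>"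
proof -
  define S where "S = (\<Sum>f\<in>F. norm f)"
  have S0: "0 \<le> S" by (simp add: S_def sum_nonneg)
  define t where "t = \<epsilon> / (1 + 2 * S)"
  have t: "0 < t"
    using \<epsilon> S0 by (simp add: t_def)
  have "\<exists>x. norm x \<le> 1 \<and> cdual_apply f x = complex_of_real (cmod (cdual_apply f x)) \<and>
    norm f - t\<^sup>2 \<le> cmod (cdual_apply f x)" for f :: "'a cdual"
    by (rule cdual_almost_attains_norm[of "t\<^sup>2" f]) (use t in auto)
  then obtain x where x: "\<And>f :: 'a cdual. norm (x f) \<le> 1"
    "\<And>f. cdual_apply f (x f) = complex_of_real (cmod (cdual_apply f (x f)))"
    "\<And>f. norm f - t\<^sup>2 \<le> cmod (cdual_apply f (x f))"
    by metis
  obtain e k m where u: "partial_unit e k m" "\<And>y. y \<in> x ` F \<Longrightarrow> norm (y - lmult k y) \<le> t\<^sup>2"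
    using partial_unit_exists[of "x ` F" "t\<^sup>2"] F t by auto
  show ?thesis
  proof (rule that)
    show "e\<^sup>\<star> = e" "norm e \<le> 1"
      using u(1) by (simp_all add: partial_unit_def)
    fix f
    assume f: "f \<in> F"
    have "norm (dual_ract f e - f) \<le> t * (1 + 2 * norm f)"
      using f by (intro dual_ract_near_of_partial_unit[OF u(1) t x] u(2)) simp
    also have "\<dots> \<le> t * (1 + 2 * S)"
      using t F f member_le_sum[of f F norm] by (intro mult_left_mono) (simp_all add: S_def)
    also have "\<dots> = \<epsilon>"
      using S0 by (simp add: t_def)
    finally show "norm (dual_ract f e - f) \<le> \<epsilon>" .
  qed
qed

section \<open>Bilinear maps vanishing on zero products\<close>

lemma sum_clamp:
  fixes x :: real
  shows "(\<Sum>i<n. max 0 (min 1 (x - real i))) = max 0 (min (real n) x)"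
  by (induction n) (auto simp: max_def min_def)

text \<open>Put \<open>B(p, q) = \<phi>(a p(h), q(h) c)\<close>; it vanishes when \<open>pq = 0\<close> on \<open>[-1, 1]\<close>. For each \<open>N\<close> let
  \<open>\<tau>(t) = N(t + 1)/2\<close>, let \<open>g\<^sub>i\<close> be the ramp rising from 0 to 1 for \<open>\<tau>\<close> between \<open>i - 1\<close> and \<open>i\<close>, and let
  \<open>f\<^sub>i = g\<^sub>i - g\<^bsub>i+1\<^esub>\<close>, a tent with support \<open>i - 1 \<le> \<tau> \<le> i + 1\<close>. The sum of \<open>g\<^sub>1, \<dots>, g\<^sub>N\<close> is \<open>\<tau>\<close>.
  For one ramp, the difference \<open>B(g\<^bsub>i+1\<^esub>, 1) - B(1, g\<^bsub>i+1\<^esub>)\<close> collapses to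
  \<open>B(f\<^bsub>i+1\<^esub>, f\<^sub>i) - B(f\<^sub>i, f\<^bsub>i+1\<^esub>)\<close>, everything else being a product of functions with disjoint supports. When
  \<open>i\<close> runs through one residue class modulo 3, the pairs for different \<open>i\<close> do not interact, so that the sum of the
  \<open>B(f\<^bsub>i+1\<^esub>, f\<^sub>i)\<close> is a single value of \<open>B\<close> at functions bounded by 1. Thus \<open>B(\<tau>, 1) - B(1, \<tau>)\<close> is bounded
  independently of \<open>N\<close>, whereas it equals \<open>N/2\<close> times \<open>B(id, 1) - B(1, id)\<close>.\<close>

lemma balanced_selfadjoint_contraction:
  fixes \<phi> :: "'a::cstar_algebra \<Rightarrow> 'a \<Rightarrow> 'b::real_normed_vector"
  assumes bb: "bounded_bilinear \<phi>" and zero: "\<And>a c. a * c = 0 \<Longrightarrow> \<phi> a c = 0"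
    and h: "h\<^sup>\<star> = h" "norm h \<le> 1"
  shows "\<phi> (rmult a h) c = \<phi> a (lmult h c)"
proof -
  interpret \<phi>: bounded_bilinear \<phi> by (rule bb)
  interpret L: bounded_bilinear "lmult :: 'a multiplier \<Rightarrow> 'a \<Rightarrow> 'a" by (rule bounded_bilinear_lmult)
  interpret R: bounded_bilinear "rmult :: 'a \<Rightarrow> 'a multiplier \<Rightarrow> 'a" by (rule bounded_bilinear_rmult)
  obtain K where K: "0 \<le> K" "\<And>a b. norm (\<phi> a b) \<le> norm a * norm b * K"
    using \<phi>.nonneg_bounded by blast
  let ?C = "continuous_on {-1..1::real}"
  define B where "B p q = \<phi> (rmult a (cfc h p)) (lmult (cfc h q) c)" for p q
  define C where "C = norm a * norm c * K"
  have B_zero: "B p q = 0" if p: "?C p" and q: "?C q" and pq: "\<And>t. t \<in> {-1..1} \<Longrightarrow> p t * q t = 0" for p q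
  proof -
    have "cfc h p * cfc h q = cfc h (\<lambda>t. p t * q t)"
      by (rule cfc_mult[OF h p q, symmetric])
    also have "\<dots> = cfc h (\<lambda>t. 0)"
      by (rule cfc_cong[OF h continuous_on_mult[OF p q] pq])
    finally have "cfc h p * cfc h q = 0"
      by (simp add: cfc_const[OF h])
    then have "rmult a (cfc h p) * lmult (cfc h q) c = 0"
      by (simp add: rmult_mult_eq lmult_mult[symmetric] L.zero_left)
    then show ?thesis
      unfolding B_def by (rule zero)
  qed
  have B_sum1: "B (\<lambda>t. \<Sum>i\<in>I. p i t) q = (\<Sum>i\<in>I. B (p i) q)"
    if "\<And>i. i \<in> I \<Longrightarrow> ?C (p i)" for I :: "nat set" and p q
    unfolding B_def using that by (simp add: cfc_sum[OF h] R.sum_right \<phi>.sum_left)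
  have B_sum2: "B q (\<lambda>t. \<Sum>i\<in>I. p i t) = (\<Sum>i\<in>I. B q (p i))"
    if "\<And>i. i \<in> I \<Longrightarrow> ?C (p i)" for I :: "nat set" and p q
    unfolding B_def using that by (simp add: cfc_sum[OF h] L.sum_left \<phi>.sum_right)
  have B_add1: "B (\<lambda>t. p t + p' t) q = B p q + B p' q" if "?C p" "?C p'" for p p' q
    unfolding B_def using that by (simp add: cfc_add[OF h] R.add_right \<phi>.add_left)
  have B_add2: "B q (\<lambda>t. p t + p' t) = B q p + B q p'" if "?C p" "?C p'" for p p' q
    unfolding B_def using that by (simp add: cfc_add[OF h] L.add_left \<phi>.add_right)
  have B_scale1: "B (\<lambda>t. r * p t) q = r *\<^sub>R B p q" if "?C p" for p q r
    unfolding B_def using that by (simp add: cfc_scale[OF h] R.scaleR_right \<phi>.scaleR_left)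
  have B_scale2: "B q (\<lambda>t. r * p t) = r *\<^sub>R B q p" if "?C p" for p q r
    unfolding B_def using that by (simp add: cfc_scale[OF h] L.scaleR_left \<phi>.scaleR_right)
  have B_cong: "B p q = B p' q'" if "?C p" "?C q" "\<And>t. t \<in> {-1..1} \<Longrightarrow> p t = p' t"
    "\<And>t. t \<in> {-1..1} \<Longrightarrow> q t = q' t" for p q p' q'
    unfolding B_def using cfc_cong[OF h that(1,3)] cfc_cong[OF h that(2,4)] by simp
  have B_norm: "norm (B p q) \<le> C" if p: "?C p" and q: "?C q"
    and le: "\<And>t. t \<in> {-1..1} \<Longrightarrow> \<bar>p t\<bar> \<le> 1" "\<And>t. t \<in> {-1..1} \<Longrightarrow> \<bar>q t\<bar> \<le> 1" for p q
  proof -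
    have "norm (rmult a (cfc h p)) \<le> norm a * 1"
      using norm_rmult_le[of a "cfc h p"] norm_cfc_le[OF h p le(1)] by (meson mult_left_mono norm_ge_zero order_trans)
    moreover have "norm (lmult (cfc h q) c) \<le> 1 * norm c"
      using norm_lmult_le[of "cfc h q" c] norm_cfc_le[OF h q le(2)] by (meson mult_right_mono norm_ge_zero order_trans)
    ultimately have "norm (rmult a (cfc h p)) * norm (lmult (cfc h q) c) * K \<le> norm a * norm c * K"
      using K(1) by (intro mult_right_mono mult_mono) simp_all
    then show ?thesis
      unfolding B_def C_def using K(2) order_trans by blast
  qed
  have diag: "(\<Sum>i\<in>I. B (p i) (q i)) = B (\<lambda>t. \<Sum>i\<in>I. p i t) (\<lambda>t. \<Sum>i\<in>I. q i t)"
    if p: "\<And>i. ?C (p i)" and q: "\<And>i. ?C (q i)" and I: "finite I"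
      and disj: "\<And>i j t. \<lbrakk>i \<in> I; j \<in> I; i \<noteq> j; t \<in> {-1..1}\<rbrakk> \<Longrightarrow> p i t * q j t = 0"
    for I :: "nat set" and p q
  proof -
    have "B (\<lambda>t. \<Sum>i\<in>I. p i t) (\<lambda>t. \<Sum>i\<in>I. q i t) = (\<Sum>i\<in>I. \<Sum>j\<in>I. B (p i) (q j))"
      using p q by (simp add: B_sum1 B_sum2)
    also have "\<dots> = (\<Sum>i\<in>I. \<Sum>j\<in>I. if j = i then B (p i) (q i) else 0)"
      by (intro sum.cong refl) (use disj in \<open>auto intro!: B_zero p q\<close>)
    also have "\<dots> = (\<Sum>i\<in>I. B (p i) (q i))"
      using I by simp
    finally show ?thesis ..
  qed
  define one where "one = (\<lambda>t::real. 1::real)"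
  have Cone: "?C one" unfolding one_def by simp
  have key: "real N * norm (B (\<lambda>t. t) one - B one (\<lambda>t. t)) \<le> 12 * C" for N
  proof -
    define \<tau> where "\<tau> t = real N * (t + 1) / 2" for t
    define g where "g i t = max 0 (min 1 (\<tau> t - real i + 1))" for i t
    define f where "f i t = g i t - g (Suc i) t" for i t
    have Cg: "?C (g i)" for i
      unfolding g_def \<tau>_def by (intro continuous_intros) auto
    have Cf: "?C (f i)" for i
      unfolding f_def by (intro continuous_intros Cg)
    have \<tau>: "0 \<le> \<tau> t" "\<tau> t \<le> real N" if "t \<in> {-1..1}" for t
      using that mult_left_mono[of "t + 1" 2 "real N"] by (auto simp: \<tau>_def)
    have g01: "0 \<le> g i t" "g i t \<le> 1" for i t
      by (simp_all add: g_def)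
    have g0: "g 0 t = 1" if "t \<in> {-1..1}" for t
      using \<tau>(1)[OF that] by (simp add: g_def)
    have f0: "0 \<le> f i t" for i t
      by (auto simp: f_def g_def)
    have f_sum: "(\<Sum>i\<in>I. f i t) \<le> 1" if I: "finite I" for I t
    proof -
      obtain M where "I \<subseteq> {..<M}"
        using finite_nat_iff_bounded[of I] I by blast
      then have "(\<Sum>i\<in>I. f i t) \<le> (\<Sum>i<M. f i t)"
        by (intro sum_mono2) (simp_all add: f0)
      also have "\<dots> = g 0 t - g M t"
        unfolding f_def by (rule sum_lessThan_telescope')
      also have "\<dots> \<le> 1"
        using g01(1)[of M t] g01(2)[of 0 t] by linarith
      finally show ?thesis .
    qed
    have f_abs: "\<bar>\<Sum>i\<in>I. f i t\<bar> \<le> 1" if I: "finite I" for I t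
      using f_sum[OF I] f0 by (simp add: abs_of_nonneg sum_nonneg)
    have gap: "g j t * (1 - g i t) = 0" if "i < j" for i j t
      using that by (auto simp: g_def max_def min_def)
    have f_disj: "f i t * f j t = 0" if "Suc i < j" for i j t
      using that by (auto simp: f_def g_def max_def min_def)
    have swap: "B (g (Suc i)) one - B one (g (Suc i)) = B (f (Suc i)) (f i) - B (f i) (f (Suc i))" for i
    proof -
      define n where "n t = 1 - g (Suc i) t" for t
      define n' where "n' t = 1 - g i t" for t
      have Cn: "?C n" "?C n'"
        unfolding n_def n'_def by (intro continuous_intros Cg)+
      have one_eq: "one = (\<lambda>t. g (Suc i) t + n t)"
        by (simp add: one_def n_def)
      have g_eq: "g (Suc i) = (\<lambda>t. f (Suc i) t + g (Suc (Suc i)) t)"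
        by (simp add: f_def)
      have n_eq: "n = (\<lambda>t. n' t + f i t)"
        by (simp add: fun_eq_iff n_def n'_def f_def)
      have z1: "g (Suc (Suc i)) t * n t = 0" "n t * g (Suc (Suc i)) t = 0" for t
        using gap[of "Suc i" "Suc (Suc i)" t] by (auto simp: n_def)
      have z2: "f (Suc i) t * n' t = 0" "n' t * f (Suc i) t = 0" for t
        using gap[of i "Suc i" t] gap[of i "Suc (Suc i)" t] by (auto simp: n'_def f_def)
      have "B (g (Suc i)) one = B (g (Suc i)) (g (Suc i)) + B (g (Suc i)) n"
        unfolding one_eq by (rule B_add2[OF Cg Cn(1)])
      moreover have "B one (g (Suc i)) = B (g (Suc i)) (g (Suc i)) + B n (g (Suc i))"
        unfolding one_eq by (rule B_add1[OF Cg Cn(1)])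
      moreover have "B (g (Suc i)) n = B (f (Suc i)) n"
        by (subst g_eq, subst B_add1[OF Cf Cg], subst B_zero[OF Cg Cn(1) z1(1)]) simp_all
      moreover have "B n (g (Suc i)) = B n (f (Suc i))"
        by (subst g_eq, subst B_add2[OF Cf Cg], subst B_zero[OF Cn(1) Cg z1(2)]) simp_all
      moreover have "B (f (Suc i)) n = B (f (Suc i)) (f i)"
        by (subst n_eq, subst B_add2[OF Cn(2) Cf], subst B_zero[OF Cf Cn(2) z2(1)]) simp_all
      moreover have "B n (f (Suc i)) = B (f i) (f (Suc i))"
        by (subst n_eq, subst B_add1[OF Cn(2) Cf], subst B_zero[OF Cn(2) Cf z2(2)]) simp_all
      ultimately show ?thesis by simp
    qed
    have classes: "norm (\<Sum>i<N. X i) \<le> 3 * C"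
      if "\<And>r. norm (\<Sum>i\<in>{i \<in> {..<N}. i mod 3 = r}. X i) \<le> C" for X :: "nat \<Rightarrow> 'b"
    proof -
      have "(\<Sum>i<N. X i) = (\<Sum>r<3. \<Sum>i\<in>{i \<in> {..<N}. i mod 3 = r}. X i)"
        by (rule sum.group[symmetric]) auto
      also have "norm \<dots> \<le> (\<Sum>r<3::nat. C)"
        by (rule sum_norm_le) (rule that)
      finally show ?thesis by simp
    qed
    have shift_abs: "\<bar>\<Sum>i\<in>I. f (Suc i) t\<bar> \<le> 1" if "finite I" for I t
      using f_abs[of "Suc ` I" t] that by (simp add: sum.reindex)
    have f_disj': "f (Suc i) t * f j t = 0" if "i \<noteq> j" "i mod 3 = j mod 3" for i j t
    proof (cases "i < j")
      case True
      then have "Suc (Suc i) < j"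
        using that(2) by presburger
      then show ?thesis by (rule f_disj)
    next
      case False
      then have "Suc j < Suc i" using that(1) by simp
      then show ?thesis
        using f_disj[of j "Suc i" t] by (simp add: mult.commute)
    qed
    have up: "norm (\<Sum>i<N. B (f (Suc i)) (f i)) \<le> 3 * C"
    proof (rule classes)
      fix r :: nat
      let ?I = "{i \<in> {..<N}. i mod 3 = r}"
      have "(\<Sum>i\<in>?I. B (f (Suc i)) (f i)) = B (\<lambda>t. \<Sum>i\<in>?I. f (Suc i) t) (\<lambda>t. \<Sum>i\<in>?I. f i t)"
      proof (rule diag)
        fix i j t
        assume "i \<in> ?I" "j \<in> ?I" "i \<noteq> j"
        then show "f (Suc i) t * f j t = 0"
          by (intro f_disj') auto
      qed (auto intro: Cf)
      also have "norm \<dots> \<le> C"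
        by (rule B_norm) (auto intro!: continuous_intros Cf f_abs shift_abs)
      finally show "norm (\<Sum>i\<in>?I. B (f (Suc i)) (f i)) \<le> C" .
    qed
    have down: "norm (\<Sum>i<N. B (f i) (f (Suc i))) \<le> 3 * C"
    proof (rule classes)
      fix r :: nat
      let ?I = "{i \<in> {..<N}. i mod 3 = r}"
      have "(\<Sum>i\<in>?I. B (f i) (f (Suc i))) = B (\<lambda>t. \<Sum>i\<in>?I. f i t) (\<lambda>t. \<Sum>i\<in>?I. f (Suc i) t)"
      proof (rule diag)
        fix i j t
        assume "i \<in> ?I" "j \<in> ?I" "i \<noteq> j"
        then show "f i t * f (Suc j) t = 0"
          using f_disj'[of j i t] by (simp add: mult.commute)
      qed (auto intro: Cf)
      also have "norm \<dots> \<le> C"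
        by (rule B_norm) (auto intro!: continuous_intros Cf f_abs shift_abs)
      finally show "norm (\<Sum>i\<in>?I. B (f i) (f (Suc i))) \<le> C" .
    qed
    have C\<tau>: "?C \<tau>"
      unfolding \<tau>_def by (intro continuous_intros) auto
    have g_sum: "(\<Sum>i<N. g (Suc i) t) = \<tau> t" if "t \<in> {-1..1}" for t
      using sum_clamp[of "\<tau> t" N] \<tau>[OF that] by (simp add: g_def algebra_simps)
    have \<tau>_eq: "\<tau> = (\<lambda>t. (real N / 2) * t + (real N / 2) * one t)"
      by (simp add: \<tau>_def one_def field_simps fun_eq_iff)
    have Cid: "?C (\<lambda>t. t)" by (rule continuous_on_id)
    have CN: "?C (\<lambda>t. (real N / 2) * t)" "?C (\<lambda>t. (real N / 2) * one t)"
      by (intro continuous_intros Cone)+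
    have "(\<Sum>i<N. B (f (Suc i)) (f i)) - (\<Sum>i<N. B (f i) (f (Suc i)))
        = (\<Sum>i<N. B (g (Suc i)) one) - (\<Sum>i<N. B one (g (Suc i)))"
      by (simp add: sum_subtractf[symmetric] swap)
    also have "(\<Sum>i<N. B (g (Suc i)) one) = B \<tau> one"
      unfolding B_sum1[OF Cg, symmetric]
      by (rule B_cong) (auto intro!: continuous_intros Cg Cone simp: g_sum)
    also have "(\<Sum>i<N. B one (g (Suc i))) = B one \<tau>"
      unfolding B_sum2[OF Cg, symmetric]
      by (rule B_cong) (auto intro!: continuous_intros Cg Cone simp: g_sum)
    also have "B \<tau> one - B one \<tau> = (real N / 2) *\<^sub>R (B (\<lambda>t. t) one - B one (\<lambda>t. t))"
      unfolding \<tau>_eq B_add1[OF CN] B_add2[OF CN] B_scale1[OF Cid] B_scale2[OF Cid]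
        B_scale1[OF Cone] B_scale2[OF Cone]
      by (simp add: scaleR_diff_right)
    finally have "real N / 2 * norm (B (\<lambda>t. t) one - B one (\<lambda>t. t))
        = norm ((\<Sum>i<N. B (f (Suc i)) (f i)) - (\<Sum>i<N. B (f i) (f (Suc i))))"
      by simp
    also have "\<dots> \<le> 3 * C + 3 * C"
      using norm_triangle_ineq4 up down by (meson add_mono order_trans)
    finally show ?thesis by simp
  qed
  have "B (\<lambda>t. t) one - B one (\<lambda>t. t) = 0"
  proof (rule ccontr)
    assume "\<not> ?thesis"
    then have "0 < norm (B (\<lambda>t. t) one - B one (\<lambda>t. t))" by simp
    then obtain N where "12 * C < real N * norm (B (\<lambda>t. t) one - B one (\<lambda>t. t))"
      using reals_Archimedean3 by blast
    with key[of N] show False by simp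
  qed
  then show ?thesis
    by (simp add: B_def one_def cfc_id[OF h] cfc_const[OF h])
qed

text \<open>Every element is a complex combination of two self-adjoint ones.\<close>

theorem zero_product_bilinear_balanced:
  fixes \<phi> :: "'a::cstar_algebra \<Rightarrow> 'a \<Rightarrow> 'b::real_normed_vector"
  assumes bb: "bounded_bilinear \<phi>" and zero: "\<And>a c. a * c = 0 \<Longrightarrow> \<phi> a c = 0"
    and scaleC: "\<And>k a c. \<phi> (k *\<^sub>C a) c = \<phi> a (k *\<^sub>C c)"
  shows "\<phi> (a * b) c = \<phi> a (b * c)"
proof -
  interpret \<phi>: bounded_bilinear \<phi> by (rule bb)
  have sa: "\<phi> (a * x) c = \<phi> a (x * c)" if x: "x\<^sup>\<star> = x" for a c x
  proof -
    define r where "r = norm x + 1"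
    have r: "0 < r" by (simp add: r_def add_nonneg_pos)
    define h where "h = incl (inverse r *\<^sub>R x)"
    have "norm h \<le> 1"
      using r by (simp add: h_def norm_incl) (simp add: r_def field_simps)
    moreover have "h\<^sup>\<star> = h"
      by (simp add: h_def star_incl star_scaleR x)
    ultimately have "\<phi> (rmult a h) c = \<phi> a (lmult h c)"
      by (intro balanced_selfadjoint_contraction bb zero)
    then have "inverse r *\<^sub>R \<phi> (a * x) c = inverse r *\<^sub>R \<phi> a (x * c)"
      by (simp add: h_def \<phi>.scaleR_left \<phi>.scaleR_right)
    then show ?thesis using r by simp
  qed
  define x where "x = (1/2) *\<^sub>R (b + b\<^sup>\<star>)"
  define y where "y = (- \<i> / 2) *\<^sub>C (b - b\<^sup>\<star>)"
  have x: "x\<^sup>\<star> = x"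
    by (simp add: x_def star_scaleR star_add star_star add.commute)
  have y: "y\<^sup>\<star> = y"
    by (simp add: y_def star_scaleC star_diff star_star scaleC_minus_left scaleC_diff_right)
  have "\<i> *\<^sub>C y = (1/2) *\<^sub>R (b - b\<^sup>\<star>)"
    by (simp add: y_def scaleC_scaleC scaleR_scaleC)
  then have b: "b = x + \<i> *\<^sub>C y"
    by (simp add: x_def scaleR_add_right[symmetric] scaleR_2[symmetric])
  have "\<phi> (a * (\<i> *\<^sub>C y)) c = \<phi> (a * y) (\<i> *\<^sub>C c)"
    by (simp add: mult_scaleC_right scaleC)
  also have "\<dots> = \<phi> a ((\<i> *\<^sub>C y) * c)"
    by (simp add: sa[OF y] mult_scaleC_left mult_scaleC_right)
  finally show ?thesis
    unfolding b by (simp add: distrib_left distrib_right \<phi>.add_left \<phi>.add_right sa[OF x])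
qed

section \<open>The Arens product\<close>

lemma arens_add_left: "(F + G) \<box> H = F \<box> H + G \<box> H"
  by (rule cdual_eqI) (simp add: arens.rep_eq plus_cdual.rep_eq)

lemma bidual_lact_add_left: "bidual_lact (F + G) f = bidual_lact F f + bidual_lact G f"
  by (rule cdual_eqI) (simp add: bidual_lact.rep_eq plus_cdual.rep_eq)

lemma bidual_lact_scaleC_left: "bidual_lact (c *\<^sub>C F) f = c *\<^sub>C bidual_lact F f"
  by (rule cdual_eqI) (simp add: bidual_lact.rep_eq scaleC_cdual.rep_eq)

lemma arens_add_right: "F \<box> (G + H) = F \<box> G + F \<box> H"
  by (rule cdual_eqI) (simp add: arens.rep_eq plus_cdual.rep_eq bidual_lact_add_left cdual_apply_add)

lemma arens_scaleC_left: "(c *\<^sub>C F) \<box> G = c *\<^sub>C (F \<box> G)"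
  by (rule cdual_eqI) (simp add: arens.rep_eq scaleC_cdual.rep_eq)

lemma arens_scaleC_right: "F \<box> (c *\<^sub>C G) = c *\<^sub>C (F \<box> G)"
  by (rule cdual_eqI) (simp add: arens.rep_eq scaleC_cdual.rep_eq bidual_lact_scaleC_left cdual_apply_scaleC)

lemma arens_scaleR_left: "(r *\<^sub>R F) \<box> G = r *\<^sub>R (F \<box> G)"
  by (simp add: scaleR_scaleC arens_scaleC_left)

lemma arens_scaleR_right: "F \<box> (r *\<^sub>R G) = r *\<^sub>R (F \<box> G)"
  by (simp add: scaleR_scaleC arens_scaleC_right)

lemma arens_diff_left: "(F - G) \<box> H = F \<box> H - G \<box> H"
  using arens_add_left[of "F - G" G H] by simp

lemma arens_diff_right: "F \<box> (G - H) = F \<box> G - F \<box> H"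
  using arens_add_right[of F "G - H" H] by simp

lemma bidual_lact_arens: "bidual_lact (F \<box> G) f = bidual_lact F (bidual_lact G f)"
proof (rule cdual_eqI)
  fix a
  have "dual_ract (dual_ract f a) b = dual_ract f (a * b)" for b
    by (rule cdual_eqI) (simp add: dual_ract.rep_eq mult.assoc)
  then have "bidual_lact G (dual_ract f a) = dual_ract (bidual_lact G f) a"
    by (intro cdual_eqI) (simp add: bidual_lact.rep_eq dual_ract.rep_eq)
  then show "cdual_apply (bidual_lact (F \<box> G) f) a = cdual_apply (bidual_lact F (bidual_lact G f)) a"
    by (simp add: bidual_lact.rep_eq arens.rep_eq)
qed

lemma arens_assoc: "(F \<box> G) \<box> H = F \<box> (G \<box> H)"
  by (rule cdual_eqI) (simp add: arens.rep_eq bidual_lact_arens)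

lemma norm_arens_le: "norm (F \<box> G) \<le> norm F * norm G"
proof (rule norm_cdual_bound)
  fix f
  show "cmod (cdual_apply (F \<box> G) f) \<le> norm F * norm G * norm f"
    using norm_cdual_apply_le[of F "bidual_lact G f"]
      mult_left_mono[OF norm_bidual_lact_le[of G f], of "norm F"]
    by (simp add: arens.rep_eq mult_ac)
qed simp

lemma canon_add: "canon (a + b) = canon a + canon b"
  by (rule cdual_eqI) (simp add: canon.rep_eq plus_cdual.rep_eq cdual_apply_add)

lemma canon_scaleC: "canon (c *\<^sub>C a) = c *\<^sub>C canon a"
  by (rule cdual_eqI) (simp add: canon.rep_eq scaleC_cdual.rep_eq cdual_apply_scaleC)

lemma canon_scaleR: "canon (r *\<^sub>R a) = r *\<^sub>R canon a"
  by (simp add: scaleR_scaleC canon_scaleC)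

lemma norm_canon_le: "norm (canon a) \<le> norm a"
  by (rule norm_cdual_bound) (simp_all add: canon.rep_eq, metis mult.commute norm_cdual_apply_le)

lemma canon_arens_apply: "cdual_apply (canon a \<box> G) f = cdual_apply G (dual_ract f a)"
  by (simp add: arens.rep_eq canon.rep_eq bidual_lact.rep_eq)

lemma bidual_lact_canon_apply: "cdual_apply (bidual_lact (canon a) f) b = cdual_apply f (b * a)"
  by (simp add: bidual_lact.rep_eq canon.rep_eq dual_ract.rep_eq)

lemma star_bidual_lact_canon:
  fixes a :: "'a::cstar_algebra"
  shows "(bidual_lact (canon a) f)\<^sup>\<star> = dual_ract (f\<^sup>\<star>) (a\<^sup>\<star>)"
  by (rule cdual_eqI)
    (simp add: star_cdual_apply bidual_lact_canon_apply dual_ract.rep_eq star_mult star_star)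

text \<open>For two general elements of the bidual, star reverses the first Arens product only up to exchanging it
  with the second one; with a canonical factor the two products visibly agree.\<close>

lemma star_canon_arens:
  fixes a :: "'a::cstar_algebra"
  shows "(canon a \<box> G)\<^sup>\<star> = G\<^sup>\<star> \<box> canon (a\<^sup>\<star>)"
  by (rule cdual_eqI)
    (simp add: star_cdual_apply canon_arens_apply,
      simp add: star_cdual_apply arens.rep_eq star_bidual_lact_canon star_star)

section \<open>Limits along an approximate unit\<close>

lemma clinear_continuous_imp_bounded_linear:
  fixes f :: "'a::complex_normed_vector \<Rightarrow> 'b::complex_normed_vector"
  assumes f: "clinear f" and cont: "continuous_on UNIV f"
  shows "bounded_linear f"
proof -
  have add: "f (x + y) = f x + f y" and scale: "f (r *\<^sub>R x) = r *\<^sub>R f x" for x y r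
    using f by (simp_all add: clinear_def scaleR_scaleC)
  have f0: "f 0 = 0" using scale[of 0 0] by simp
  have "isCont f 0"
    using cont continuous_on_eq_continuous_at[OF open_UNIV] by blast
  then obtain s where s: "0 < s" "\<And>x. norm x < s \<Longrightarrow> norm (f x) < 1"
    unfolding continuous_at_eps_delta by (metis diff_zero dist_norm f0 zero_less_one)
  show ?thesis
  proof (rule bounded_linear_intro[OF add scale])
    fix x
    show "norm (f x) \<le> norm x * (2 / s)"
    proof (cases "x = 0")
      case False
      define r where "r = s / (2 * norm x)"
      have r: "0 < r" using s False by (simp add: r_def)
      have "norm (r *\<^sub>R x) < s"
        using s False by (simp add: r_def)
      then have "norm (f (r *\<^sub>R x)) < 1" by (rule s(2))
      then have "r * norm (f x) < 1"
        using r by (simp add: scale)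
      then show ?thesis
        using s False by (simp add: r_def field_simps)
    qed (simp add: f0)
  qed
qed

text \<open>A stand-in for an approximate unit indexed by a directed set: the basic sets consist of the self-adjoint
  contractions that act almost as a unit on finitely many given functionals.\<close>

definition approx_unit_filter :: "'a::cstar_algebra filter"
  where "approx_unit_filter = (INF (f, \<epsilon>)\<in>UNIV \<times> {0<..}.
    principal {e. e\<^sup>\<star> = e \<and> norm e \<le> 1 \<and> norm (dual_ract f e - f) \<le> \<epsilon>})"

lemma approx_unit_filter_not_bot: "approx_unit_filter \<noteq> (bot :: 'a::cstar_algebra filter)"
  unfolding approx_unit_filter_def
proof (rule INF_filter_not_bot)
  fix X :: "('a cdual \<times> real) set"
  assume X: "X \<subseteq> UNIV \<times> {0<..}" "finite X"
  let ?U = "\<lambda>(f, \<epsilon>). {e :: 'a. e\<^sup>\<star> = e \<and> norm e \<le> 1 \<and> norm (dual_ract f e - f) \<le> \<epsilon>}"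
  define \<epsilon> where "\<epsilon> = Min (insert 1 (snd ` X))"
  have "0 < \<epsilon>"
    using X by (auto simp: \<epsilon>_def)
  then obtain e :: 'a where e: "e\<^sup>\<star> = e" "norm e \<le> 1" "\<And>f. f \<in> fst ` X \<Longrightarrow> norm (dual_ract f e - f) \<le> \<epsilon>"
    using approximate_unit_for_functionals[of "fst ` X" \<epsilon>] X(2) by auto
  have le: "\<epsilon> \<le> snd p" if "p \<in> X" for p
    using X(2) that by (simp add: \<epsilon>_def)
  have "e \<in> (\<Inter>p\<in>X. ?U p)"
  proof
    fix p
    assume p: "p \<in> X"
    then have "norm (dual_ract (fst p) e - fst p) \<le> snd p"
      using e(3)[of "fst p"] le[OF p] by force
    then show "e \<in> ?U p"
      using e(1,2) by (simp add: case_prod_beta)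
  qed
  moreover have "(INF p\<in>X. principal (?U p)) = principal (\<Inter>p\<in>X. ?U p)"
    by (rule INF_principal_finite[OF X(2)])
  ultimately have "(INF p\<in>X. principal (?U p)) \<noteq> bot"
    by (auto simp: principal_eq_bot_iff)
  then show "(INF (f, \<epsilon>)\<in>X. principal {e :: 'a. e\<^sup>\<star> = e \<and> norm e \<le> 1 \<and> norm (dual_ract f e - f) \<le> \<epsilon>}) \<noteq> bot"
    by (simp add: case_prod_beta)
qed

lemma eventually_approx_unit_filter:
  assumes "0 < \<epsilon>"
  shows "\<forall>\<^sub>F e in approx_unit_filter. e\<^sup>\<star> = e \<and> norm e \<le> 1 \<and> norm (dual_ract f e - f) \<le> \<epsilon>"
proof -
  have "approx_unit_filter \<le> principal {e. e\<^sup>\<star> = e \<and> norm e \<le> 1 \<and> norm (dual_ract f e - f) \<le> \<epsilon>}"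
    unfolding approx_unit_filter_def using assms by (intro INF_lower2[of "(f, \<epsilon>)"]) auto
  then show ?thesis
    by (simp add: le_principal)
qed

lemma tendsto_dual_ract_approx_unit:
  assumes L: "L \<le> approx_unit_filter"
  shows "((\<lambda>e. dual_ract f e) \<longlongrightarrow> f) L"
proof (rule tendstoI)
  fix \<epsilon> :: real
  assume "0 < \<epsilon>"
  then have "\<forall>\<^sub>F e in L. e\<^sup>\<star> = e \<and> norm e \<le> 1 \<and> norm (dual_ract f e - f) \<le> \<epsilon> / 2"
    using filter_leD[OF L] eventually_approx_unit_filter half_gt_zero by blast
  then show "\<forall>\<^sub>F e in L. dist (dual_ract f e) f < \<epsilon>"
    by eventually_elim (use \<open>0 < \<epsilon>\<close> in \<open>simp add: dist_norm\<close>)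
qed

lemma eventually_selfadjoint_approx_unit:
  assumes L: "L \<le> approx_unit_filter"
  shows "\<forall>\<^sub>F e in L. e\<^sup>\<star> = e"
proof -
  have "\<forall>\<^sub>F e in L. e\<^sup>\<star> = e \<and> norm e \<le> 1 \<and> norm (dual_ract 0 e - 0) \<le> 1"
    by (rule filter_leD[OF L eventually_approx_unit_filter]) simp
  then show ?thesis by eventually_elim simp
qed

text \<open>For self-adjoint \<open>e\<close> the left action on \<open>f\<close> is the star of the right action on \<open>f\<^sup>\<star>\<close>.\<close>

lemma tendsto_bidual_lact_approx_unit:
  assumes L: "L \<le> approx_unit_filter"
  shows "((\<lambda>e. bidual_lact (canon e) f) \<longlongrightarrow> f) L"
proof -
  have "((\<lambda>e. (dual_ract (f\<^sup>\<star>) e)\<^sup>\<star>) \<longlongrightarrow> (f\<^sup>\<star>)\<^sup>\<star>) L"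
    by (intro bounded_linear.tendsto[OF bounded_linear_star] tendsto_dual_ract_approx_unit L)
  then have "((\<lambda>e. (dual_ract (f\<^sup>\<star>) e)\<^sup>\<star>) \<longlongrightarrow> f) L"
    by (simp add: star_star)
  moreover have "\<forall>\<^sub>F e in L. (dual_ract (f\<^sup>\<star>) e)\<^sup>\<star> = bidual_lact (canon e) f"
    using eventually_selfadjoint_approx_unit[OF L]
    by eventually_elim (metis star_bidual_lact_canon star_star)
  ultimately show ?thesis
    by (rule Lim_transform_eventually)
qed

lemma tendsto_cdual_apply:
  "(X \<longlongrightarrow> f) L \<Longrightarrow> ((\<lambda>e. cdual_apply G (X e)) \<longlongrightarrow> cdual_apply G f) L"
  by (rule bounded_linear.tendsto[OF bounded_linear_cdual_apply])

lemma tendsto_canon_arens_approx_unit: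
  assumes "L \<le> approx_unit_filter"
  shows "((\<lambda>e. cdual_apply (canon e \<box> G) f) \<longlongrightarrow> cdual_apply G f) L"
  unfolding canon_arens_apply by (intro tendsto_cdual_apply tendsto_dual_ract_approx_unit assms)

lemma tendsto_arens_canon_approx_unit:
  assumes "L \<le> approx_unit_filter"
  shows "((\<lambda>e. cdual_apply (G \<box> canon e) f) \<longlongrightarrow> cdual_apply G f) L"
  unfolding arens.rep_eq by (intro tendsto_cdual_apply tendsto_bidual_lact_approx_unit assms)

lemma tendsto_mult_right_approx_unit:
  assumes "L \<le> approx_unit_filter"
  shows "((\<lambda>e. cdual_apply f (b * e)) \<longlongrightarrow> cdual_apply f b) L"
  using tendsto_cdual_apply[OF tendsto_bidual_lact_approx_unit[OF assms], of "canon b" f]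
  by (simp add: canon.rep_eq bidual_lact_canon_apply)

text \<open>This is weak-\<open>\<star>\<close> compactness of balls in a dual space. The functionals, viewed as points of a product of
  closed discs, have a cluster point \<open>g\<close> by Tychonoff's theorem; refining \<open>F\<close> by the preimages of the neighbourhoods of
  \<open>g\<close> gives a proper filter along which they converge pointwise, and so \<open>g\<close> is linear.\<close>

lemma bounded_family_cluster_point:
  fixes \<delta> :: "'a \<Rightarrow> 'b::complex_normed_vector cdual"
  assumes F: "F \<noteq> bot" and bound: "\<forall>\<^sub>F e in F. norm (\<delta> e) \<le> M"
  obtains L \<eta> where "L \<noteq> bot" "L \<le> F" "\<And>f. ((\<lambda>e. cdual_apply (\<delta> e) f) \<longlongrightarrow> cdual_apply \<eta> f) L"
proof -
  define S :: "('b \<Rightarrow> complex) set" where "S = (\<Pi>\<^sub>E f\<in>UNIV. cball 0 (M * norm f))"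
  have "compactin (product_topology (\<lambda>i::'b. euclidean :: complex topology) UNIV) S"
    unfolding S_def compactin_PiE by (simp add: compactin_euclidean_iff)
  then have "compact S"
    by (simp add: euclidean_product_topology compactin_euclidean_iff)
  define x where "x e = cdual_apply (\<delta> e)" for e
  have "\<forall>\<^sub>F y in filtermap x F. y \<in> S"
    unfolding eventually_filtermap using bound
  proof eventually_elim
    case (elim e)
    then have "cmod (x e f) \<le> M * norm f" for f
      unfolding x_def by (meson mult_right_mono norm_cdual_apply_le norm_ge_zero order_trans)
    then show ?case
      by (auto simp: S_def)
  qed
  moreover have "filtermap x F \<noteq> bot"
    using F by (simp add: filtermap_bot_iff)
  ultimately obtain g where g: "g \<in> S" "inf (nhds g) (filtermap x F) \<noteq> bot"
    using \<open>compact S\<close> unfolding compact_filter by blast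
  define L where "L = inf F (filtercomap x (nhds g))"
  have L: "L \<noteq> bot"
  proof
    assume "L = bot"
    then have "eventually (\<lambda>_. False) L" by simp
    then obtain P Q where PQ: "eventually P F" "eventually Q (filtercomap x (nhds g))" "\<And>e. P e \<Longrightarrow> Q e \<Longrightarrow> False"
      unfolding L_def eventually_inf by blast
    obtain R where R: "eventually R (nhds g)" "\<And>e. R (x e) \<Longrightarrow> Q e"
      using PQ(2) unfolding eventually_filtercomap by blast
    have "eventually (\<lambda>y. \<not> R y) (filtermap x F)"
      unfolding eventually_filtermap using PQ(1) by eventually_elim (use PQ(3) R(2) in blast)
    then have "eventually (\<lambda>_. False) (inf (nhds g) (filtermap x F))"
      unfolding eventually_inf using R(1) by blast
    with g(2) show False by (simp add: trivial_limit_def)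
  qed
  have "filtermap x L \<le> nhds g"
    unfolding L_def using filtermap_filtercomap[of x "nhds g"] filtermap_mono[OF inf_le2] order_trans by blast
  then have xg: "(x \<longlongrightarrow> g) L"
    by (simp add: filterlim_def)
  have lim: "((\<lambda>e. cdual_apply (\<delta> e) f) \<longlongrightarrow> g f) L" for f
  proof (rule topological_tendstoI)
    fix U
    assume U: "open U" "g f \<in> U"
    have "open ((\<lambda>y. y f) -` U)"
      by (rule open_vimage[OF U(1)]) simp
    then have "\<forall>\<^sub>F e in L. x e \<in> (\<lambda>y. y f) -` U"
      by (rule topological_tendstoD[OF xg]) (simp add: U(2))
    then show "\<forall>\<^sub>F e in L. cdual_apply (\<delta> e) f \<in> U"
      by (simp add: x_def)
  qed
  have "clinear g \<and> bounded_linear g"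
  proof (rule clinear_bounded_linearI)
    show "clinear g"
      unfolding clinear_def
    proof (intro conjI allI)
      fix f f' c
      have "((\<lambda>e. cdual_apply (\<delta> e) f + cdual_apply (\<delta> e) f') \<longlongrightarrow> g (f + f')) L"
        using lim[of "f + f'"] by (simp add: cdual_apply_add)
      then show "g (f + f') = g f + g f'"
        using tendsto_unique[OF L _ tendsto_add[OF lim lim]] by blast
      have "((\<lambda>e. c * cdual_apply (\<delta> e) f) \<longlongrightarrow> g (c *\<^sub>C f)) L"
        using lim[of "c *\<^sub>C f"] by (simp add: cdual_apply_scaleC)
      then show "g (c *\<^sub>C f) = c *\<^sub>C g f"
        using tendsto_unique[OF L _ tendsto_mult[OF tendsto_const lim]] by (simp add: scaleC_complex_def)
    qed
    show "cmod (g f) \<le> norm f * M" for f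
      using g(1) by (simp add: S_def PiE_def Pi_def mult.commute)
  qed
  then have "cdual_apply (Abs_cdual g) = g"
    by (intro Abs_cdual_inverse) simp
  moreover have "L \<le> F"
    by (simp add: L_def)
  ultimately show ?thesis
    using lim by (intro that[of L "Abs_cdual g", OF L]) simp_all
qed

section \<open>Zero products and derivations\<close>

lemma star_derivation_plus_multiplier_zero_product:
  fixes \<delta> :: "'a::cstar_algebra \<Rightarrow> 'a bidual"
  assumes d: "bidual_star_derivation d" and \<delta>: "\<And>a. \<delta> a = d a + canon a \<box> \<eta>"
    and ab: "a\<^sup>\<star> * b = 0"
  shows "canon (a\<^sup>\<star>) \<box> \<delta> b + (\<delta> a)\<^sup>\<star> \<box> canon b = 0"
proof -
  have lin: "clinear d" and der: "d (x * y) = canon x \<box> d y + d x \<box> canon y" and star: "d (x\<^sup>\<star>) = (d x)\<^sup>\<star>" for x y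
    using d by (simp_all add: bidual_star_derivation_def bidual_derivation_def star_map_def)
  have zero: "canon (0::'a) = 0" "d 0 = 0" "0 \<box> F = 0" "F \<box> 0 = 0" for F :: "'a bidual"
    using canon_scaleC[of 0 "0::'a"] lin arens_scaleC_left[of 0 0 F] arens_scaleC_right[of F 0 0]
    by (simp_all add: clinear_def) (metis scaleC_zero_left)
  have "canon (a\<^sup>\<star>) \<box> \<delta> b + (\<delta> a)\<^sup>\<star> \<box> canon b
      = (canon (a\<^sup>\<star>) \<box> d b + d (a\<^sup>\<star>) \<box> canon b) + canon (a\<^sup>\<star> * b) \<box> \<eta> + \<eta>\<^sup>\<star> \<box> canon (a\<^sup>\<star> * b)"
    by (simp add: \<delta> star star_add star_canon_arens arens_add_left arens_add_right arens_assoc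
        flip: arens_canon)
  also have "\<dots> = 0"
    by (simp add: ab zero flip: der)
  finally show ?thesis .
qed

text \<open>The multiplier \<open>\<eta>\<close> is a weak-\<open>\<star>\<close> cluster point of \<open>\<delta>\<close> along the approximate unit.\<close>

lemma star_derivation_of_zero_product:
  fixes \<delta> :: "'a::cstar_algebra \<Rightarrow> 'a bidual"
  assumes lin: "clinear \<delta>" and cont: "continuous_on UNIV \<delta>"
    and zp: "\<And>a b. a\<^sup>\<star> * b = 0 \<Longrightarrow> canon (a\<^sup>\<star>) \<box> \<delta> b + (\<delta> a)\<^sup>\<star> \<box> canon b = 0"
  obtains d \<eta> where "bidual_star_derivation d" "continuous_on UNIV d" "\<And>a. \<delta> a = d a + canon a \<box> \<eta>"
proof -
  have bl: "bounded_linear \<delta>"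
    by (rule clinear_continuous_imp_bounded_linear[OF lin cont])
  then obtain M where M: "0 \<le> M" "\<And>a. norm (\<delta> a) \<le> norm a * M"
    using bounded_linear.nonneg_bounded by blast
  have \<delta>_add: "\<delta> (a + b) = \<delta> a + \<delta> b" and \<delta>_scaleC: "\<delta> (c *\<^sub>C a) = c *\<^sub>C \<delta> a" for a b c
    using lin by (simp_all add: clinear_def)
  have \<delta>_scaleR: "\<delta> (r *\<^sub>R a) = r *\<^sub>R \<delta> a" for r a
    by (simp add: scaleR_scaleC \<delta>_scaleC)
  define \<psi> where "\<psi> a = (\<delta> (a\<^sup>\<star>))\<^sup>\<star>" for a
  have \<psi>_add: "\<psi> (a + b) = \<psi> a + \<psi> b" and \<psi>_scaleR: "\<psi> (r *\<^sub>R a) = r *\<^sub>R \<psi> a"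
    and \<psi>_scaleC: "\<psi> (c *\<^sub>C a) = c *\<^sub>C \<psi> a" and \<psi>_norm: "norm (\<psi> a) \<le> norm a * M" for a b c r
    using M(2)[of "a\<^sup>\<star>"]
    by (simp_all add: \<psi>_def star_add star_scaleR star_scaleC \<delta>_add \<delta>_scaleR \<delta>_scaleC norm_star)
  define \<phi> where "\<phi> a b = canon a \<box> \<delta> b + \<psi> a \<box> canon b" for a b
  have "bounded_bilinear \<phi>"
  proof (rule bounded_bilinear.intro)
    show "\<exists>K. \<forall>a b. norm (\<phi> a b) \<le> norm a * norm b * K"
    proof (intro exI allI)
      fix a b
      have "norm (canon a \<box> \<delta> b) \<le> norm a * (norm b * M)"
        by (rule order_trans[OF norm_arens_le mult_mono[OF norm_canon_le M(2)]]) simp_all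
      moreover have "norm (\<psi> a \<box> canon b) \<le> (norm a * M) * norm b"
        by (rule order_trans[OF norm_arens_le mult_mono[OF \<psi>_norm norm_canon_le]]) (simp_all add: M)
      ultimately have "norm (\<phi> a b) \<le> norm a * (norm b * M) + (norm a * M) * norm b"
        unfolding \<phi>_def by (rule norm_triangle_mono)
      then show "norm (\<phi> a b) \<le> norm a * norm b * (2 * M)"
        by (simp add: algebra_simps)
    qed
  qed (simp_all add: \<phi>_def canon_add canon_scaleR \<delta>_add \<delta>_scaleR \<psi>_add \<psi>_scaleR
      arens_add_left arens_add_right arens_scaleR_left arens_scaleR_right scaleR_add_right)
  moreover have "\<phi> a b = 0" if "a * b = 0" for a b
    using zp[of "a\<^sup>\<star>" b] that by (simp add: \<phi>_def \<psi>_def star_star)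
  moreover have "\<phi> (c *\<^sub>C a) b = \<phi> a (c *\<^sub>C b)" for a b c
    by (simp add: \<phi>_def canon_scaleC \<delta>_scaleC \<psi>_scaleC arens_scaleC_left arens_scaleC_right)
  ultimately have "\<phi> (a * b) c = \<phi> a (b * c)" for a b c
    by (rule zero_product_bilinear_balanced)
  then have balanced: "canon (a * b) \<box> \<delta> c + \<psi> (a * b) \<box> canon c
      = canon a \<box> \<delta> (b * c) + \<psi> a \<box> canon (b * c)" for a b c
    by (simp add: \<phi>_def)
  have "\<forall>\<^sub>F e :: 'a in approx_unit_filter. norm (\<delta> e) \<le> M"
    using eventually_approx_unit_filter[of 1 0, OF zero_less_one]
  proof eventually_elim
    case (elim e)
    then show ?case
      using M(2)[of e] mult_right_mono[of "norm e" 1 M] M(1) by simp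
  qed
  then obtain L \<eta> where L: "L \<noteq> bot" "L \<le> approx_unit_filter"
    and \<eta>: "\<And>f. ((\<lambda>e. cdual_apply (\<delta> e) f) \<longlongrightarrow> cdual_apply \<eta> f) L"
    using bounded_family_cluster_point[OF approx_unit_filter_not_bot] by blast
  have "\<exists>D. \<forall>b. cdual_apply D b = cdual_apply (\<delta> b) f" for f
  proof -
    have "clinear (\<lambda>b. cdual_apply (\<delta> b) f) \<and> bounded_linear (\<lambda>b. cdual_apply (\<delta> b) f)"
    proof (rule clinear_bounded_linearI)
      show "clinear (\<lambda>b. cdual_apply (\<delta> b) f)"
        by (simp add: clinear_def \<delta>_add \<delta>_scaleC plus_cdual.rep_eq scaleC_cdual.rep_eq scaleC_complex_def)
      fix b
      have "cmod (cdual_apply (\<delta> b) f) \<le> norm (\<delta> b) * norm f"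
        by (rule norm_cdual_apply_le)
      also have "\<dots> \<le> norm b * M * norm f"
        by (rule mult_right_mono[OF M(2)]) simp
      finally show "cmod (cdual_apply (\<delta> b) f) \<le> norm b * (M * norm f)"
        by (simp add: mult.assoc)
    qed
    then show ?thesis
      by (intro exI[of _ "Abs_cdual (\<lambda>b. cdual_apply (\<delta> b) f)"]) (simp add: Abs_cdual_inverse)
  qed
  \<comment> \<open>The functional \<open>D f\<close> transports weak convergence \<open>b * e \<rightarrow> b\<close> in the algebra through \<open>\<delta>\<close>.\<close>
  then obtain D where D: "\<And>f b. cdual_apply (D f) b = cdual_apply (\<delta> b) f"
    by metis
  have \<psi>_apply: "cdual_apply (\<psi> b) f = cnj (cdual_apply (\<delta> (b\<^sup>\<star>)) (f\<^sup>\<star>))" for b f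
    by (simp add: \<psi>_def star_cdual_apply)
  have \<delta>_lim: "((\<lambda>e. cdual_apply (\<delta> (b * e)) f) \<longlongrightarrow> cdual_apply (\<delta> b) f) L" for b f
    using tendsto_mult_right_approx_unit[OF L(2), of "D f" b] by (simp add: D)
  have sa: "\<forall>\<^sub>F e in L. e\<^sup>\<star> = e"
    by (rule eventually_selfadjoint_approx_unit[OF L(2)])
  have \<psi>_lim: "((\<lambda>e. cdual_apply (\<psi> (e * b)) f) \<longlongrightarrow> cdual_apply (\<psi> b) f) L" for b f
  proof (rule Lim_transform_eventually)
    show "((\<lambda>e. cnj (cdual_apply (\<delta> (b\<^sup>\<star> * e)) (f\<^sup>\<star>))) \<longlongrightarrow> cdual_apply (\<psi> b) f) L"
      unfolding \<psi>_apply by (intro tendsto_cnj \<delta>_lim)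
    show "\<forall>\<^sub>F e in L. cnj (cdual_apply (\<delta> (b\<^sup>\<star> * e)) (f\<^sup>\<star>)) = cdual_apply (\<psi> (e * b)) f"
      using sa by eventually_elim (simp add: \<psi>_apply star_mult)
  qed
  have \<psi>_unit: "((\<lambda>e. cdual_apply (\<psi> e) f) \<longlongrightarrow> cdual_apply (\<eta>\<^sup>\<star>) f) L" for f
  proof (rule Lim_transform_eventually)
    show "((\<lambda>e. cnj (cdual_apply (\<delta> e) (f\<^sup>\<star>))) \<longlongrightarrow> cdual_apply (\<eta>\<^sup>\<star>) f) L"
      unfolding star_cdual_apply by (intro tendsto_cnj \<eta>)
    show "\<forall>\<^sub>F e in L. cnj (cdual_apply (\<delta> e) (f\<^sup>\<star>)) = cdual_apply (\<psi> e) f"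
      using sa by eventually_elim (simp add: \<psi>_apply)
  qed
  \<comment> \<open>The limit of \<open>balanced\<close> as its first argument runs through the approximate unit.\<close>
  have left: "canon b \<box> \<delta> c + \<psi> b \<box> canon c = \<delta> (b * c) + \<eta>\<^sup>\<star> \<box> canon (b * c)" for b c
  proof (rule cdual_eqI)
    fix f
    have "((\<lambda>e. cdual_apply (canon e \<box> (canon b \<box> \<delta> c)) f + cdual_apply (\<psi> (e * b)) (bidual_lact (canon c) f))
        \<longlongrightarrow> cdual_apply (canon b \<box> \<delta> c) f + cdual_apply (\<psi> b) (bidual_lact (canon c) f)) L"
      by (intro tendsto_add tendsto_canon_arens_approx_unit L \<psi>_lim)
    moreover have "((\<lambda>e. cdual_apply (canon e \<box> \<delta> (b * c)) f + cdual_apply (\<psi> e) (bidual_lact (canon (b * c)) f))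
        \<longlongrightarrow> cdual_apply (\<delta> (b * c)) f + cdual_apply (\<eta>\<^sup>\<star>) (bidual_lact (canon (b * c)) f)) L"
      by (intro tendsto_add tendsto_canon_arens_approx_unit L \<psi>_unit)
    moreover have "cdual_apply (canon e \<box> (canon b \<box> \<delta> c)) f + cdual_apply (\<psi> (e * b)) (bidual_lact (canon c) f)
        = cdual_apply (canon e \<box> \<delta> (b * c)) f + cdual_apply (\<psi> e) (bidual_lact (canon (b * c)) f)" for e
      using arg_cong[OF balanced[of e b c], of "\<lambda>F. cdual_apply F f"]
      by (simp add: plus_cdual.rep_eq arens_assoc[symmetric] arens_canon) (simp add: arens.rep_eq)
    ultimately have "cdual_apply (canon b \<box> \<delta> c) f + cdual_apply (\<psi> b) (bidual_lact (canon c) f)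
        = cdual_apply (\<delta> (b * c)) f + cdual_apply (\<eta>\<^sup>\<star>) (bidual_lact (canon (b * c)) f)"
      using tendsto_unique[OF L(1)] by simp
    then show "cdual_apply (canon b \<box> \<delta> c + \<psi> b \<box> canon c) f
        = cdual_apply (\<delta> (b * c) + \<eta>\<^sup>\<star> \<box> canon (b * c)) f"
      by (simp add: plus_cdual.rep_eq arens.rep_eq)
  qed
  \<comment> \<open>The limit of \<open>left\<close> as \<open>c\<close> runs through the approximate unit.\<close>
  have right: "canon b \<box> \<eta> + \<psi> b = \<delta> b + \<eta>\<^sup>\<star> \<box> canon b" for b
  proof (rule cdual_eqI)
    fix f
    have "((\<lambda>e. cdual_apply (canon b \<box> \<delta> e) f + cdual_apply (\<psi> b \<box> canon e) f)
        \<longlongrightarrow> cdual_apply (canon b \<box> \<eta>) f + cdual_apply (\<psi> b) f) L"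
      unfolding canon_arens_apply by (intro tendsto_add \<eta> tendsto_arens_canon_approx_unit L)
    moreover have "((\<lambda>e. cdual_apply (\<delta> (b * e)) f + cdual_apply ((\<eta>\<^sup>\<star> \<box> canon b) \<box> canon e) f)
        \<longlongrightarrow> cdual_apply (\<delta> b) f + cdual_apply (\<eta>\<^sup>\<star> \<box> canon b) f) L"
      by (intro tendsto_add \<delta>_lim tendsto_arens_canon_approx_unit L)
    moreover have "cdual_apply (canon b \<box> \<delta> e) f + cdual_apply (\<psi> b \<box> canon e) f
        = cdual_apply (\<delta> (b * e)) f + cdual_apply ((\<eta>\<^sup>\<star> \<box> canon b) \<box> canon e) f" for e
      using arg_cong[OF left[of b e], of "\<lambda>F. cdual_apply F f"]
      by (simp add: plus_cdual.rep_eq arens_assoc arens_canon)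
    ultimately have "cdual_apply (canon b \<box> \<eta>) f + cdual_apply (\<psi> b) f
        = cdual_apply (\<delta> b) f + cdual_apply (\<eta>\<^sup>\<star> \<box> canon b) f"
      using tendsto_unique[OF L(1)] by simp
    then show "cdual_apply (canon b \<box> \<eta> + \<psi> b) f = cdual_apply (\<delta> b + \<eta>\<^sup>\<star> \<box> canon b) f"
      by (simp add: plus_cdual.rep_eq)
  qed
  define d where "d a = \<delta> a - canon a \<box> \<eta>" for a
  have \<psi>_eq: "\<psi> b = d b + \<eta>\<^sup>\<star> \<box> canon b" for b
    using right[of b] by (simp add: d_def algebra_simps)
  have "clinear d"
    by (simp add: clinear_def d_def \<delta>_add \<delta>_scaleC canon_add canon_scaleC arens_add_left arens_scaleC_left
        scaleC_diff_right)
  moreover have "d (a * b) = canon a \<box> d b + d a \<box> canon b" for a b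
    using left[of a b]
    by (simp add: \<psi>_eq d_def arens_add_left arens_diff_left arens_diff_right arens_assoc arens_canon[symmetric])
  moreover have "d (a\<^sup>\<star>) = (d a)\<^sup>\<star>" for a
    using \<psi>_eq[of "a\<^sup>\<star>"] by (simp add: \<psi>_def d_def star_star star_diff star_canon_arens algebra_simps)
  ultimately have "bidual_star_derivation d"
    by (simp add: bidual_star_derivation_def bidual_derivation_def star_map_def)
  moreover have "continuous_on UNIV d"
  proof -
    have "bounded_linear (\<lambda>a. canon a \<box> \<eta>)"
    proof (rule bounded_linear_intro)
      show "norm (canon a \<box> \<eta>) \<le> norm a * norm \<eta>" for a
        by (rule order_trans[OF norm_arens_le mult_right_mono[OF norm_canon_le]]) simp
    qed (simp_all add: canon_add canon_scaleR arens_add_left arens_scaleR_left)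
    then show ?thesis
      unfolding d_def by (intro continuous_on_diff cont linear_continuous_on)
  qed
  moreover have "\<delta> a = d a + canon a \<box> \<eta>" for a
    by (simp add: d_def)
  ultimately show ?thesis by (rule that)
qed

theorem corollary2p3:
  fixes \<delta> :: "'a::cstar_algebra \<Rightarrow> 'a bidual"
  assumes "clinear \<delta>" and "continuous_on UNIV \<delta>"
  shows "(\<forall>a b. a\<^sup>\<star> * b = 0 \<longrightarrow> canon (a\<^sup>\<star>) \<box> \<delta> b + (\<delta> a)\<^sup>\<star> \<box> canon b = 0) \<longleftrightarrow>
    (\<exists>(d :: 'a \<Rightarrow> 'a bidual) (\<eta> :: 'a bidual).
      bidual_star_derivation d \<and> continuous_on UNIV d \<and> (\<forall>a. \<delta> a = d a + canon a \<box> \<eta>))"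
proof
  assume "\<forall>a b. a\<^sup>\<star> * b = 0 \<longrightarrow> canon (a\<^sup>\<star>) \<box> \<delta> b + (\<delta> a)\<^sup>\<star> \<box> canon b = 0"
  then obtain d \<eta> where "bidual_star_derivation d" "continuous_on UNIV d" "\<And>a. \<delta> a = d a + canon a \<box> \<eta>"
    using star_derivation_of_zero_product[OF assms] by blast
  then show "\<exists>(d :: 'a \<Rightarrow> 'a bidual) (\<eta> :: 'a bidual).
      bidual_star_derivation d \<and> continuous_on UNIV d \<and> (\<forall>a. \<delta> a = d a + canon a \<box> \<eta>)"
    by blast
next
  assume "\<exists>(d :: 'a \<Rightarrow> 'a bidual) (\<eta> :: 'a bidual).
      bidual_star_derivation d \<and> continuous_on UNIV d \<and> (\<forall>a. \<delta> a = d a + canon a \<box> \<eta>)"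
  then show "\<forall>a b. a\<^sup>\<star> * b = 0 \<longrightarrow> canon (a\<^sup>\<star>) \<box> \<delta> b + (\<delta> a)\<^sup>\<star> \<box> canon b = 0"
    using star_derivation_plus_multiplier_zero_product by blast
qed

end
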